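(* Let $\Omega\subset\mathbb{R}^N$ be an open bounded set, and consider the Dirichlet eigenvalue problem $(I-\Delta)^{\log}u=\lambda u$ in $\Omega$, $u=0$ on $\mathbb{R}^N\setminus\Omega$, in the weak sense defined in the context. Then: (i) The problem admits an eigenvalue $\lambda_1(\Omega)>0$ characterized by $$\lambda_1(\Omega)=\inf_{u\in\mathcal{H}_0^{\log}(\Omega),\,u\ne0}\frac{\mathcal{E}_\omega(u,u)}{\|u\|^2_{L^2(\Omega)}}=\inf_{u\in\mathcal{P}_1(\Omega)}\mathcal{E}_\omega(u,u),\qquad \mathcal{P}_1(\Omega):=\{u\in\mathcal{H}_0^{\log}(\Omega):\|u\|_{L^2(\Omega)}=1\},$$ and there exists a positive function $\varphi_1\in\mathcal{H}_0^{\log}(\Omega)$ which is an eigenfunction corresponding to $\lambda_1(\Omega)$ and attains the minimum, i.e. $\|\varphi_1\|_{L^2(\Omega)}=1$ and $\lambda_1(\Omega)=\mathcal{E}_\omega(\varphi_1,\varphi_1)$. (ii) The first eigenvalue $\lambda_1(\Omega)$ is simple: if $u\in\mathcal{H}_0^{\log}(\Omega)$ satisfies $\mathcal{E}_\omega(u,\phi)=\lambda_1(\Omega)\int_\Omega u\phi\,dx$ for all $\phi\in C_c^\infty(\Omega)$, then $u=\alpha\varphi_1$ for some $\alpha\in\mathbb{R}$. (iii) The problem admits a sequence of eigenvalues $\{\lambda_k(\Omega)\}_{k\in\mathbb{N}}$ with $$0<\lambda_1(\Omega)<\lambda_2(\Omega)\le\cdots\le\lambda_k(\Omega)\le\lambda_{k+1}(\Omega)\le\cdots,$$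 with corresponding eigenfunctions $\varphi_k$, $k\in\mathbb{N}$, and $\lim_{k\to\infty}\lambda_k(\Omega)=+\infty$. Moreover, for every $k\in\mathbb{N}$, $$\lambda_k(\Omega)=\inf_{u\in\mathcal{P}_k(\Omega)}\mathcal{E}_\omega(u,u),$$ where $\mathcal{P}_k(\Omega):=\{u\in\mathcal{H}_0^{\log}(\Omega):\int_\Omega u\varphi_j\,dx=0\text{ for }j=1,\dots,k-1\text{ and }\|u\|_{L^2(\Omega)}=1\}$. (iv) The sequence $\{\varphi_k\}_{k\in\mathbb{N}}$ of eigenfunctions corresponding to the eigenvalues $\lambda_k(\Omega)$ forms a complete orthonormal basis of $L^2(\Omega)$ and an orthogonal system of $\mathcal{H}_0^{\log}(\Omega)$.
   Context: Let $J(z)=\pi^{-N/2}|z|^{-N}\omega(|z|)$, $\omega(r)=2^{1-\frac N2}r^{\frac N2}K_{\frac N2}(r)=\int_0^\infty t^{-1+\frac N2}e^{-t-\frac{r^2}{4t}}dt$, where $K_\nu$ is the modified Bessel function of the second kind. For measurable $u,v:\mathbb{R}^N\to\mathbb{R}$ set $$\mathcal{E}_\omega(u,v)=\frac12\int_{\mathbb{R}^N}\int_{\mathbb{R}^N}(u(x)-u(y))(v(x)-v(y))J(x-y)\,dx\,dy.$$ $H^{\log}(\mathbb{R}^N)=\{u\in L^2(\mathbb{R}^N):\mathcal{E}_\omega(u,u)<\infty\}$ with norm $\|u\|_{H^{\log}(\mathbb{R}^N)}=(\|u\|_{L^2(\mathbb{R}^N)}^2+\mathcal{E}_\omega(u,u))^{1/2}$.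 $L^2(\Omega)$ is identified with the functions in $L^2(\mathbb{R}^N)$ vanishing on $\mathbb{R}^N\setminus\Omega$. $\mathcal{H}_0^{\log}(\Omega)$ is the completion of $C_c^\infty(\Omega)$ with respect to $\|\cdot\|_{H^{\log}(\mathbb{R}^N)}$; for bounded $\Omega$ it is a Hilbert space with scalar product $\mathcal{E}_\omega$. A (nonzero) function $u\in\mathcal{H}_0^{\log}(\Omega)$ is an eigenfunction corresponding to the eigenvalue $\lambda$ if $\mathcal{E}_\omega(u,\phi)=\lambda\int_\Omega u\phi\,dx$ for all $\phi\in C_c^\infty(\Omega)$. The index $k\in\mathbb{N}$ starts at $1$. *)

theory Defs
  imports "HOL-Analysis.Analysis"
begin

section \<open>The kernel\<close>

text \<open>
  The modified Bessel function of the second kind by its standard integral representation,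
  valid for \<open>r > 0\<close>.
\<close>

definition bessel_K :: "real \<Rightarrow> real \<Rightarrow> real" where
  "bessel_K \<nu> r = (LINT t:{0<..}|lborel. exp (- r * cosh t) * cosh (\<nu> * t))"

definition log_omega :: "nat \<Rightarrow> real \<Rightarrow> real" where
  "log_omega n r = (LINT t:{0<..}|lborel. t powr (- 1 + real n / 2) * exp (- t - r\<^sup>2 / (4 * t)))"

lemma log_omega_bessel_K:
  assumes "n > 0" and r: "r > 0"
  shows "log_omega n r = 2 powr (1 - real n / 2) * r powr (real n / 2) * bessel_K (real n / 2) r"
proof -
  define \<nu> where "\<nu> = real n / 2"
  have nu: "\<nu> > 0" using assms by (simp add: \<nu>_def)
  define f where "f = (\<lambda>t::real. t powr (- 1 + \<nu>) * exp (- t - r\<^sup>2 / (4 * t)))"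
  define C where "C = (r / 2) powr \<nu>"
  have C: "C > 0" using r by (simp add: C_def)
  have gam: "set_integrable lborel {0<..} (\<lambda>t. t powr (\<nu> - 1) / exp t)"
  proof -
    have "((\<lambda>t. t powr (\<nu> - 1) / exp t) has_integral Gamma \<nu>) {0..}"
      by (rule Gamma_integral_real[OF nu])
    hence "(\<lambda>t. t powr (\<nu> - 1) / exp t) absolutely_integrable_on {0..}"
      by (intro nonnegative_absolutely_integrable_1) (auto simp: has_integral_iff)
    hence "(\<lambda>t. t powr (\<nu> - 1) / exp t) absolutely_integrable_on {0<..}"
      by (rule set_integrable_subset) auto
    thus ?thesis
      unfolding set_integrable_def by (subst (asm) integrable_completion) auto
  qed
  have f_int: "set_integrable lborel {0<..} f"
    by (rule set_integrable_bound[OF gam])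
       (auto simp: f_def set_borel_measurable_def exp_diff exp_minus field_simps
          intro!: mult_left_mono AE_I2)
  have f_sub: "set_integrable lborel A f" if "A \<subseteq> {0<..}" "A \<in> sets borel" for A
    by (rule set_integrable_subset[OF f_int]) (use that in auto)
  have half: "set_integrable lborel {0<..} (\<lambda>s. exp (- r * cosh s) * exp (\<sigma> * \<nu> * s)) \<and>
      (LINT t:B|lborel. f t) = C * (LINT s:{0<..}|lborel. exp (- r * cosh s) * exp (\<sigma> * \<nu> * s))"
    if \<sigma>: "\<bar>\<sigma>\<bar> = 1" and B: "B = (\<lambda>s. r / 2 * exp (\<sigma> * s)) ` {0<..}"
      and Bm: "B \<in> sets borel" for \<sigma> and B
  proof -
    define g where "g = (\<lambda>s. r / 2 * exp (\<sigma> * s))"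
    define h where "h = (\<lambda>s. exp (- r * cosh s) * exp (\<sigma> * \<nu> * s))"
    have B0: "B \<subseteq> {0<..}" using r by (auto simp: B)
    note fB = f_sub[OF B0 Bm]
    have fB': "f absolutely_integrable_on (g ` {0<..}) \<and> integral (g ` {0<..}) f = (LINT t:B|lborel. f t)"
    proof -
      have "f absolutely_integrable_on B"
        using fB unfolding set_integrable_def
        by (subst integrable_completion) (auto dest: borel_measurable_integrable)
      thus ?thesis using set_borel_integral_eq_integral(2)[OF fB] B by (simp add: g_def)
    qed
    have inj: "inj_on g {0<..}" using r \<sigma> by (auto simp: inj_on_def g_def)
    have "(\<lambda>s. \<bar>\<sigma> * g s\<bar> * f (g s)) absolutely_integrable_on {0<..} \<and>
        integral {0<..} (\<lambda>s. \<bar>\<sigma> * g s\<bar> * f (g s)) = (LINT t:B|lborel. f t)"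
      by (rule has_absolute_integral_change_of_variables_1'[THEN iffD2, OF _ _ inj fB'])
         (auto simp: g_def intro!: derivative_eq_intros)
    moreover have eq: "\<bar>\<sigma> * g s\<bar> * f (g s) = C * h s" for s
    proof -
      have gp: "g s > 0" using r by (simp add: g_def)
      have "\<bar>\<sigma> * g s\<bar> * f (g s) = (g s * g s powr (- 1 + \<nu>)) * exp (- g s - r\<^sup>2 / (4 * g s))"
        using gp \<sigma> by (simp add: abs_mult f_def)
      also have "g s * g s powr (- 1 + \<nu>) = g s powr \<nu>"
        using gp by (simp add: powr_mult_base)
      also have "g s powr \<nu> = C * exp (\<sigma> * \<nu> * s)"
        using r unfolding g_def C_def by (subst powr_mult) (auto simp: powr_def mult_ac)
      also have "- g s - r\<^sup>2 / (4 * g s) = - r * cosh s"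
      proof -
        have "r\<^sup>2 / (4 * g s) = r / 2 * exp (- (\<sigma> * s))"
          using r by (simp add: g_def exp_minus field_simps power2_eq_square)
        moreover have "cosh s = (exp (\<sigma> * s) + exp (- (\<sigma> * s))) / 2"
        proof (cases "\<sigma> = 1")
          case False
          hence "\<sigma> = - 1" using \<sigma> by linarith
          thus ?thesis by (simp add: cosh_field_def)
        qed (simp add: cosh_field_def)
        ultimately show ?thesis by (simp add: g_def field_simps)
      qed
      finally show ?thesis by (simp add: h_def mult_ac)
    qed
    ultimately have Ch: "(\<lambda>s. C * h s) absolutely_integrable_on {0<..}"
        "integral {0<..} (\<lambda>s. C * h s) = (LINT t:B|lborel. f t)" by simp_all
    have Ch': "set_integrable lborel {0<..} (\<lambda>s. C * h s)"
      using Ch(1) unfolding set_integrable_def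
      by (subst (asm) integrable_completion)
         (auto simp: h_def cosh_field_def)
    hence hi: "set_integrable lborel {0<..} h" using C by simp
    have "(LINT t:B|lborel. f t) = (LINT s:{0<..}|lborel. C * h s)"
      using set_borel_integral_eq_integral(2)[OF Ch'] Ch(2) by (rule trans[OF sym sym, rotated])
    thus ?thesis using hi by (simp add: h_def)
  qed
  have im1: "{r / 2<..} = (\<lambda>s. r / 2 * exp (1 * s)) ` {0<..}"
  proof (intro equalityI subsetI)
    fix t assume t: "t \<in> {r / 2<..}"
    have "t = r / 2 * exp (1 * ln (2 * t / r))" "ln (2 * t / r) > 0"
      using t r by (auto simp: field_simps)
    thus "t \<in> (\<lambda>s. r / 2 * exp (1 * s)) ` {0<..}" by blast
  qed (use r in auto)
  have im2: "{0<..<r / 2} = (\<lambda>s. r / 2 * exp (- 1 * s)) ` {0<..}"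
  proof (intro equalityI subsetI)
    fix t assume t: "t \<in> {0<..<r / 2}"
    hence "2 * t / r > 0" "2 * t / r < 1" using r by (auto simp: field_simps)
    hence "t = r / 2 * exp (- 1 * (- ln (2 * t / r)))" "- ln (2 * t / r) > 0"
      using r by (auto simp del: zero_less_divide_iff)
    thus "t \<in> (\<lambda>s. r / 2 * exp (- 1 * s)) ` {0<..}" by blast
  qed (use r in auto)
  note h1 = half[OF _ im1] and h2 = half[OF _ im2]
  have "log_omega n r = (LINT t:{0<..}|lborel. f t)"
    by (simp add: log_omega_def f_def \<nu>_def)
  also have "\<dots> = (LINT t:{r / 2<..} \<union> {0<..<r / 2}|lborel. f t)"
  proof (rule set_integral_cong_set)
    have "AE t in lborel. t \<noteq> r / 2" by (rule AE_lborel_singleton)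
    thus "AE x in lborel. (x \<in> {r / 2<..} \<union> {0<..<r / 2}) = (x \<in> {0<..})"
      by eventually_elim (use r in auto)
  qed (auto simp: f_def set_borel_measurable_def)
  also have "\<dots> = (LINT t:{r / 2<..}|lborel. f t) + (LINT t:{0<..<r / 2}|lborel. f t)"
    by (rule set_integral_Un) (use r in \<open>auto intro!: f_sub\<close>)
  also have "\<dots> = C * ((LINT s:{0<..}|lborel. exp (- r * cosh s) * exp (1 * \<nu> * s))
                   + (LINT s:{0<..}|lborel. exp (- r * cosh s) * exp (- 1 * \<nu> * s)))"
    using h1 h2 by (simp add: distrib_left)
  also have "\<dots> = C * (LINT s:{0<..}|lborel. exp (- r * cosh s) * exp (1 * \<nu> * s)
                   + exp (- r * cosh s) * exp (- 1 * \<nu> * s))"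
    using h1 h2 by (subst set_integral_add) auto
  also have "(\<lambda>s. exp (- r * cosh s) * exp (1 * \<nu> * s) + exp (- r * cosh s) * exp (- 1 * \<nu> * s))
           = (\<lambda>s. 2 * (exp (- r * cosh s) * cosh (\<nu> * s)))"
    by (auto simp: cosh_field_def field_simps)
  also have "C * (LINT s:{0<..}|lborel. 2 * (exp (- r * cosh s) * cosh (\<nu> * s))) = 2 * C * bessel_K \<nu> r"
    by (simp add: bessel_K_def)
  also have "2 * C = 2 powr (1 - \<nu>) * r powr \<nu>"
    using r by (simp add: C_def powr_divide powr_diff)
  finally show ?thesis by (simp add: \<nu>_def)
qed

definition log_kernel :: "'a::euclidean_space \<Rightarrow> real" where
  "log_kernel z = pi powr (- real DIM('a) / 2) * norm z powr (- real DIM('a)) * log_omega DIM('a) (norm z)"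

section \<open>Function spaces\<close>

text \<open>
  Elements of the spaces below are Borel measurable representatives; equality of elements is
  equality almost everywhere.
\<close>

definition log_integrand :: "('a::euclidean_space \<Rightarrow> real) \<Rightarrow> ('a \<Rightarrow> real) \<Rightarrow> 'a \<times> 'a \<Rightarrow> real" where
  "log_integrand u v = (\<lambda>(x, y). (u x - u y) * (v x - v y) * log_kernel (x - y))"

definition log_form :: "('a::euclidean_space \<Rightarrow> real) \<Rightarrow> ('a \<Rightarrow> real) \<Rightarrow> real" where
  "log_form u v = 1 / 2 * integral\<^sup>L (lborel \<Otimes>\<^sub>M lborel) (log_integrand u v)"

definition L2_on :: "'a::euclidean_space set \<Rightarrow> ('a \<Rightarrow> real) set" where
  "L2_on \<Omega> = {u \<in> borel_measurable lborel. integrable lborel (\<lambda>x. (u x)\<^sup>2) \<and>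
                (AE x in lborel. x \<notin> \<Omega> \<longrightarrow> u x = 0)}"

definition L2_inner :: "'a::euclidean_space set \<Rightarrow> ('a \<Rightarrow> real) \<Rightarrow> ('a \<Rightarrow> real) \<Rightarrow> real" where
  "L2_inner \<Omega> u v = (LINT x:\<Omega>|lborel. u x * v x)"

definition L2_norm :: "'a::euclidean_space set \<Rightarrow> ('a \<Rightarrow> real) \<Rightarrow> real" where
  "L2_norm \<Omega> u = sqrt (LINT x:\<Omega>|lborel. (u x)\<^sup>2)"

text \<open>
  The integrand of \<open>log_form u u\<close> is nonnegative and measurable, so its integrability says that
  the double integral is finite.
\<close>

definition H_log :: "('a::euclidean_space \<Rightarrow> real) set" where
  "H_log = {u \<in> L2_on UNIV. integrable (lborel \<Otimes>\<^sub>M lborel) (log_integrand u u)}"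

definition H_log_norm :: "('a::euclidean_space \<Rightarrow> real) \<Rightarrow> real" where
  "H_log_norm u = sqrt ((L2_norm UNIV u)\<^sup>2 + log_form u u)"

fun Ck :: "nat \<Rightarrow> ('a::euclidean_space \<Rightarrow> real) \<Rightarrow> bool" where
  "Ck 0 f \<longleftrightarrow> continuous_on UNIV f"
| "Ck (Suc n) f \<longleftrightarrow> (\<forall>x. f differentiable (at x)) \<and>
     (\<forall>b\<in>Basis. Ck n (\<lambda>x. frechet_derivative f (at x) b))"

definition Cc_inf :: "'a::euclidean_space set \<Rightarrow> ('a \<Rightarrow> real) set" where
  "Cc_inf \<Omega> = {f. (\<forall>n. Ck n f) \<and> compact (closure {x. f x \<noteq> 0}) \<and> closure {x. f x \<noteq> 0} \<subseteq> \<Omega>}"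

text \<open>
  The space \<open>H_log\<close> is complete, so the completion of the test functions is realised as their
  closure in it.
\<close>

definition H0_log :: "'a::euclidean_space set \<Rightarrow> ('a \<Rightarrow> real) set" where
  "H0_log \<Omega> = {u \<in> H_log. \<exists>f. (\<forall>n. f n \<in> Cc_inf \<Omega>) \<and>
                 (\<lambda>n. H_log_norm (\<lambda>x. f n x - u x)) \<longlonglongrightarrow> 0}"

section \<open>The Dirichlet eigenvalue problem\<close>

definition weak_solution :: "'a::euclidean_space set \<Rightarrow> real \<Rightarrow> ('a \<Rightarrow> real) \<Rightarrow> bool" where
  "weak_solution \<Omega> \<mu> u \<longleftrightarrow> u \<in> H0_log \<Omega> \<and>
     (\<forall>\<phi>\<in>Cc_inf \<Omega>. log_form u \<phi> = \<mu> * (LINT x:\<Omega>|lborel. u x * \<phi> x))"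

definition eigenfunction :: "'a::euclidean_space set \<Rightarrow> real \<Rightarrow> ('a \<Rightarrow> real) \<Rightarrow> bool" where
  "eigenfunction \<Omega> \<mu> u \<longleftrightarrow> weak_solution \<Omega> \<mu> u \<and> \<not> (AE x in lborel. u x = 0)"

definition eigenvalue :: "'a::euclidean_space set \<Rightarrow> real \<Rightarrow> bool" where
  "eigenvalue \<Omega> \<mu> \<longleftrightarrow> (\<exists>u. eigenfunction \<Omega> \<mu> u)"

definition P_set :: "'a::euclidean_space set \<Rightarrow> (nat \<Rightarrow> 'a \<Rightarrow> real) \<Rightarrow> nat \<Rightarrow> ('a \<Rightarrow> real) set" where
  "P_set \<Omega> \<phi> k = {u \<in> H0_log \<Omega>. (\<forall>j\<in>{1..<k}. (LINT x:\<Omega>|lborel. u x * \<phi> j x) = 0) \<and> L2_norm \<Omega> u = 1}"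

text \<open>Sequences are indexed from \<open>1\<close>; the entry at \<open>0\<close> plays no role.\<close>

definition L2_orthonormal_basis :: "'a::euclidean_space set \<Rightarrow> (nat \<Rightarrow> 'a \<Rightarrow> real) \<Rightarrow> bool" where
  "L2_orthonormal_basis \<Omega> \<phi> \<longleftrightarrow>
     (\<forall>k\<ge>1. \<phi> k \<in> L2_on \<Omega>) \<and>
     (\<forall>j\<ge>1. \<forall>k\<ge>1. L2_inner \<Omega> (\<phi> j) (\<phi> k) = (if j = k then 1 else 0)) \<and>
     (\<forall>f\<in>L2_on \<Omega>. (\<lambda>n. L2_norm \<Omega> (\<lambda>x. f x - (\<Sum>k=1..n. L2_inner \<Omega> f (\<phi> k) * \<phi> k x))) \<longlonglongrightarrow> 0)"

definition H0_log_orthogonal :: "'a::euclidean_space set \<Rightarrow> (nat \<Rightarrow> 'a \<Rightarrow> real) \<Rightarrow> bool" where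
  "H0_log_orthogonal \<Omega> \<phi> \<longleftrightarrow>
     (\<forall>k\<ge>1. \<phi> k \<in> H0_log \<Omega>) \<and> (\<forall>j\<ge>1. \<forall>k\<ge>1. j \<noteq> k \<longrightarrow> log_form (\<phi> j) (\<phi> k) = 0)"

end

theory Submission
  imports Defs "HOL-Library.Function_Algebras" "HOL-Library.Diagonal_Subsequence"
begin

text \<open>
  The form controls the \<open>L\<^sup>2\<close> oscillation on dyadic cells at all scales simultaneously, because the
  kernel is comparable to \<open>|z|\<close> to the power \<open>-N\<close> near the origin. Averaging over \<open>m\<close> scales shows that
  the \<open>L\<^sup>2\<close> norm is at most \<open>C / m\<close> times the form plus finitely many averages, so bounded sequences
  have \<open>L\<^sup>2\<close> Cauchy subsequences. Successive minimisation of the Rayleigh quotient then gives the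
  eigenfunctions, and the parallelogram law makes minimising sequences converge strongly. For the first
  eigenfunction, \<open>|u|\<close> is again a minimiser, and testing the equation with the positive part of
  \<open>v - n u\<close> gives a strong maximum principle; hence a first eigenfunction with zero mean vanishes,
  which is simplicity.
\<close>

section \<open>Spectral theory of a form with compact embedding\<close>

text \<open>The singularity |z|^(-N) is borderline: it yields no positive order of smoothness, so
  compactness cannot come from a fractional Sobolev embedding. A second obstacle is that
  \<open>H0_log\<close> is a closure of test functions, while absolute values of test functions are
  not test functions. Smoothing |u| gives test functions of bounded energy that are controlled in
  L^2 only. In place of weak compactness, membership of their limit is read off from the
  eigenfunction expansion, which is why the abstract spectral theory has to precede the study of
  |u|. Vectors are representatives rather than classes, so the forms are only semidefinite, and
  convergence is stated through quadratic forms instead of norms. Finally, minimisation does not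
  deliver a first eigenfunction that is positive at every point. The first vector is exchanged
  afterwards; simplicity makes old and new vector proportional, so all later orthogonality
  conditions stay the same and nothing is minimised again.\<close>

lemma tendsto_0_le:
  fixes g h :: "nat \<Rightarrow> real"
  assumes "h \<longlonglongrightarrow> 0" "\<And>n. 0 \<le> g n" "\<And>n. g n \<le> h n"
  shows "g \<longlonglongrightarrow> 0"
  by (rule tendsto_sandwich[OF _ _ tendsto_const assms(1)]) (use assms in auto)

locale psd_form =
  fixes S :: "'v::real_vector set" and f :: "'v \<Rightarrow> 'v \<Rightarrow> real"
  assumes subspace_S: "subspace S"
    and sym: "u \<in> S \<Longrightarrow> v \<in> S \<Longrightarrow> f u v = f v u"
    and add_left: "u \<in> S \<Longrightarrow> v \<in> S \<Longrightarrow> w \<in> S \<Longrightarrow> f (u + v) w = f u w + f v w"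
    and scale_left: "u \<in> S \<Longrightarrow> w \<in> S \<Longrightarrow> f (c *\<^sub>R u) w = c * f u w"
    and nonneg: "u \<in> S \<Longrightarrow> 0 \<le> f u u"
begin

lemma mem [simp, intro]:
  "0 \<in> S" "u \<in> S \<Longrightarrow> v \<in> S \<Longrightarrow> u + v \<in> S" "u \<in> S \<Longrightarrow> v \<in> S \<Longrightarrow> u - v \<in> S"
  "u \<in> S \<Longrightarrow> c *\<^sub>R u \<in> S" "(\<And>i. i \<in> I \<Longrightarrow> g i \<in> S) \<Longrightarrow> sum g I \<in> S"
  using subspace_S by (auto intro: subspace_0 subspace_add subspace_diff subspace_scale subspace_sum)

lemma add_right: "u \<in> S \<Longrightarrow> v \<in> S \<Longrightarrow> w \<in> S \<Longrightarrow> f w (u + v) = f w u + f w v"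
  by (metis add_left mem(2) sym)

lemma scale_right: "u \<in> S \<Longrightarrow> w \<in> S \<Longrightarrow> f w (c *\<^sub>R u) = c * f w u"
  by (metis scale_left mem(4) sym)

lemma diff_left: "u \<in> S \<Longrightarrow> v \<in> S \<Longrightarrow> w \<in> S \<Longrightarrow> f (u - v) w = f u w - f v w"
  using add_left[of u "(-1) *\<^sub>R v" w] scale_left[of v w "-1"] subspace_neg[OF subspace_S, of v] by simp

lemma diff_right: "u \<in> S \<Longrightarrow> v \<in> S \<Longrightarrow> w \<in> S \<Longrightarrow> f w (u - v) = f w u - f w v"
  by (metis diff_left mem(3) sym)

lemma zero_left: "w \<in> S \<Longrightarrow> f 0 w = 0"
  using scale_left[of 0 w 0] by simp

lemma sum_left: "(\<And>i. i \<in> I \<Longrightarrow> g i \<in> S) \<Longrightarrow> w \<in> S \<Longrightarrow> f (sum g I) w = (\<Sum>i\<in>I. f (g i) w)"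
  by (induction I rule: infinite_finite_induct) (auto simp: zero_left add_left)

lemma sum_right: "(\<And>i. i \<in> I \<Longrightarrow> g i \<in> S) \<Longrightarrow> w \<in> S \<Longrightarrow> f w (sum g I) = (\<Sum>i\<in>I. f w (g i))"
  using sum_left[of I g w] sym[of w "sum g I"] sym[of w] by simp

lemmas expand = add_left add_right diff_left diff_right scale_left scale_right

lemma cauchy_schwarz:
  assumes "u \<in> S" "v \<in> S"
  shows "(f u v)\<^sup>2 \<le> f u u * f v v"
proof -
  have q: "0 \<le> f u u + 2 * t * f u v + t\<^sup>2 * f v v" for t
    using nonneg[of "u + t *\<^sub>R v"] assms sym[of v u]
    by (simp add: expand algebra_simps power2_eq_square)
  show ?thesis
  proof (cases "f v v = 0")
    case True
    have "f u v = 0"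
    proof (rule ccontr)
      assume "f u v \<noteq> 0"
      \<comment> \<open>With \<open>f v v = 0\<close> the polynomial is affine in \<open>t\<close>;
        at this \<open>t\<close> it would have the value -1.\<close>
      then show False using q[of "- (f u u + 1) / (2 * f u v)"] True by (simp add: field_simps)
    qed
    then show ?thesis by (simp add: True)
  next
    case False
    then have p: "f v v > 0" using nonneg[OF assms(2)] by simp
    have "0 \<le> f u u - (f u v)\<^sup>2 / f v v"
      using q[of "- f u v / f v v"] p by (simp add: field_simps power2_eq_square)
    then show ?thesis using p by (simp add: field_simps)
  qed
qed

text \<open>Parallelogram law with the square of the difference dropped. It takes the place of the
  triangle inequality and keeps square roots out of all approximation arguments.\<close>

lemma add_le: "u \<in> S \<Longrightarrow> v \<in> S \<Longrightarrow> f (u + v) (u + v) \<le> 2 * f u u + 2 * f v v"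
  using nonneg[of "u - v"] sym[of u v] by (simp add: expand)

lemma diff_le: "u \<in> S \<Longrightarrow> v \<in> S \<Longrightarrow> f (u - v) (u - v) \<le> 2 * f u u + 2 * f v v"
  using nonneg[of "u + v"] sym[of u v] by (simp add: expand)

lemma tendsto_left:
  assumes "\<And>n. s n \<in> S" "u \<in> S" "v \<in> S" "(\<lambda>n. f (s n - u) (s n - u)) \<longlonglongrightarrow> 0"
  shows "(\<lambda>n. f (s n) v) \<longlonglongrightarrow> f u v"
proof -
  have "(\<lambda>n. f (s n - u) (s n - u) * f v v) \<longlonglongrightarrow> 0"
    using tendsto_mult_right[OF assms(4), of "f v v"] by (simp add: mult.commute)
  then have "(\<lambda>n. (f (s n - u) v)\<^sup>2) \<longlonglongrightarrow> 0"
    by (rule tendsto_0_le) (intro zero_le_power2 cauchy_schwarz mem assms)+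
  then have "(\<lambda>n. f (s n - u) v) \<longlonglongrightarrow> 0"
    using tendsto_real_sqrt by (fastforce simp: tendsto_rabs_zero_iff)
  then have "(\<lambda>n. f (s n - u) v + f u v) \<longlonglongrightarrow> 0 + f u v" by (intro tendsto_intros)
  then show ?thesis using assms by (simp add: diff_left)
qed

lemma tendsto_diag:
  assumes "\<And>n. s n \<in> S" "u \<in> S" "(\<lambda>n. f (s n - u) (s n - u)) \<longlonglongrightarrow> 0"
  shows "(\<lambda>n. f (s n) (s n)) \<longlonglongrightarrow> f u u"
proof -
  have "(\<lambda>n. f (s n - u) (s n - u) + 2 * f (s n) u - f u u) \<longlonglongrightarrow> 0 + 2 * f u u - f u u"
    using assms by (intro tendsto_intros tendsto_left) auto
  moreover have "f (s n - u) (s n - u) + 2 * f (s n) u - f u u = f (s n) (s n)" for n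
    using assms sym[of u "s n"] by (simp add: expand)
  ultimately show ?thesis by simp
qed

lemma orthonormal_expansion:
  assumes "finite J" "\<And>j. j \<in> J \<Longrightarrow> e j \<in> S" "u \<in> S"
    and on: "\<And>i j. i \<in> J \<Longrightarrow> j \<in> J \<Longrightarrow> f (e i) (e j) = (if i = j then 1 else 0)"
  defines "w \<equiv> u - (\<Sum>j\<in>J. f u (e j) *\<^sub>R e j)"
  shows "w \<in> S" "j \<in> J \<Longrightarrow> f w (e j) = 0" "f w w = f u u - (\<Sum>j\<in>J. (f u (e j))\<^sup>2)"
proof -
  let ?p = "\<Sum>j\<in>J. f u (e j) *\<^sub>R e j"
  have p: "?p \<in> S" using assms by (intro mem) auto
  then show w: "w \<in> S" unfolding w_def using assms by (intro mem)
  have pe: "f ?p (e j) = f u (e j)" if "j \<in> J" for j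
  proof -
    have "f ?p (e j) = (\<Sum>i\<in>J. f u (e i) * f (e i) (e j))"
      using assms that by (subst sum_left) (auto simp: scale_left)
    also have "\<dots> = (\<Sum>i\<in>J. if i = j then f u (e i) else 0)"
      using on that by (intro sum.cong) auto
    finally show ?thesis using assms(1) that by simp
  qed
  then show we: "f w (e j) = 0" if "j \<in> J" for j
    using that assms p by (simp add: w_def diff_left)
  have "f w ?p = 0"
    using assms w we by (subst sum_right) (auto simp: scale_right)
  then have "f w w = f w u" using assms w p unfolding w_def by (simp add: diff_right)
  also have "\<dots> = f u u - f ?p u" using assms p by (simp add: w_def diff_left)
  also have "f ?p u = (\<Sum>j\<in>J. (f u (e j))\<^sup>2)"
    using assms sym[of u] by (subst sum_left) (auto simp: scale_left power2_eq_square intro!: sum.cong)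
  finally show "f w w = f u u - (\<Sum>j\<in>J. (f u (e j))\<^sup>2)" .
qed

lemma bessel:
  assumes "finite J" "\<And>j. j \<in> J \<Longrightarrow> e j \<in> S" "u \<in> S"
    and "\<And>i j. i \<in> J \<Longrightarrow> j \<in> J \<Longrightarrow> f (e i) (e j) = (if i = j then 1 else 0)"
  shows "(\<Sum>j\<in>J. (f u (e j))\<^sup>2) \<le> f u u"
  using nonneg[OF orthonormal_expansion(1)[of J e u]] orthonormal_expansion(3)[of J e u] assms by simp

end

text \<open>\<open>V\<close> is the form domain with energy \<open>a\<close>, and \<open>L\<close>
  is the ambient space with inner product \<open>b\<close>. \<open>coercive\<close> is a Poincare
  inequality. \<open>compact\<close> promises only a \<open>b\<close>-Cauchy subsequence, since
  \<open>L\<close> is not assumed complete. \<open>infinite_dim\<close> keeps the successive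
  minimisation from stopping, and \<open>dense\<close> serves to carry expansions from
  \<open>V\<close> over to \<open>L\<close>.\<close>

locale compact_form = A: psd_form V a + B: psd_form L b
  for V L :: "'v::real_vector set" and a b :: "'v \<Rightarrow> 'v \<Rightarrow> real" +
  fixes c :: real
  assumes V_sub_L: "V \<subseteq> L"
    and c_pos: "c > 0"
    and coercive: "u \<in> V \<Longrightarrow> c * b u u \<le> a u u"
    and complete: "(\<And>n. s n \<in> V) \<Longrightarrow>
      (\<And>e. e > 0 \<Longrightarrow> \<exists>N. \<forall>i\<ge>N. \<forall>j\<ge>N. a (s i - s j) (s i - s j) < e) \<Longrightarrow>
      \<exists>u\<in>V. (\<lambda>n. a (s n - u) (s n - u)) \<longlonglongrightarrow> 0"
    and compact: "(\<And>n. s n \<in> V) \<Longrightarrow> (\<And>n. a (s n) (s n) \<le> C) \<Longrightarrow>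
      \<exists>r::nat \<Rightarrow> nat. strict_mono r \<and> (\<forall>e>0. \<exists>N. \<forall>i\<ge>N. \<forall>j\<ge>N. b (s (r i) - s (r j)) (s (r i) - s (r j)) < e)"
    and infinite_dim: "\<exists>e::nat \<Rightarrow> 'v. (\<forall>i. e i \<in> V) \<and> (\<forall>i j. b (e i) (e j) = (if i = j then 1 else 0))"
    and dense: "f \<in> L \<Longrightarrow> \<epsilon> > 0 \<Longrightarrow> \<exists>g\<in>V. b (f - g) (f - g) < \<epsilon>"
begin

lemma VL [simp, intro]: "u \<in> V \<Longrightarrow> u \<in> L"
  using V_sub_L by blast

lemma b_tendsto_if_a_tendsto:
  assumes "\<And>n. s n \<in> V" "u \<in> V" "(\<lambda>n. a (s n - u) (s n - u)) \<longlonglongrightarrow> 0"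
  shows "(\<lambda>n. b (s n - u) (s n - u)) \<longlonglongrightarrow> 0"
proof -
  have "(\<lambda>n. a (s n - u) (s n - u) / c) \<longlonglongrightarrow> 0 / c"
    using assms(3) c_pos by (intro tendsto_intros) auto
  then have "(\<lambda>n. a (s n - u) (s n - u) / c) \<longlonglongrightarrow> 0" by simp
  then show ?thesis
  proof (rule tendsto_0_le)
    show "b (s n - u) (s n - u) \<le> a (s n - u) (s n - u) / c" for n
      using assms coercive c_pos by (auto simp: field_simps)
  qed (use assms B.nonneg in auto)
qed

text \<open>
  No weak convergence is needed: the parallelogram law turns a minimising sequence that is Cauchy
  for \<open>b\<close> into one that is Cauchy for \<open>a\<close>.
\<close>

lemma minimizer_exists:
  fixes G :: "'v set"
  assumes G: "G \<subseteq> L"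
  defines "W \<equiv> {u \<in> V. \<forall>g\<in>G. b u g = 0}"
  assumes ne: "\<exists>w\<in>W. b w w \<noteq> 0"
  shows "\<exists>u\<in>W. b u u = 1 \<and> (\<forall>w\<in>W. a u u * b w w \<le> a w w)"
proof -
  have WV: "w \<in> V" "w \<in> L" if "w \<in> W" for w using that by (auto simp: W_def)
  have Wadd: "u + v \<in> W" if "u \<in> W" "v \<in> W" for u v
    using that G by (auto simp: W_def B.add_left subset_iff)
  have Wscale: "t *\<^sub>R v \<in> W" if "v \<in> W" for v t
    using that G by (auto simp: W_def B.scale_left subset_iff)
  define U where "U = {w \<in> W. b w w = 1}"
  define X where "X = (\<lambda>w. a w w) ` U"
  define l where "l = Inf X"
  obtain w0 where w0: "w0 \<in> W" "b w0 w0 \<noteq> 0" using ne by auto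
  have normalize: "(1 / sqrt (b w w)) *\<^sub>R w \<in> U \<and>
      a ((1 / sqrt (b w w)) *\<^sub>R w) ((1 / sqrt (b w w)) *\<^sub>R w) = a w w / b w w"
    if "w \<in> W" "b w w \<noteq> 0" for w
  proof -
    have "b w w > 0" using that B.nonneg[of w] WV by force
    then show ?thesis using that Wscale WV
      by (auto simp: U_def B.expand A.expand real_div_sqrt divide_simps power2_eq_square[symmetric])
  qed
  have Xne: "X \<noteq> {}" using normalize[OF w0] by (auto simp: X_def)
  have Xb: "bdd_below X" unfolding X_def U_def
    by (rule bdd_belowI2[of _ 0]) (use A.nonneg WV in auto)
  have l0: "0 \<le> l" unfolding l_def
    by (rule cInf_greatest[OF Xne]) (use A.nonneg WV in \<open>auto simp: X_def U_def\<close>)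
  have low: "l * b w w \<le> a w w" if "w \<in> W" for w
  proof (cases "b w w = 0")
    case True then show ?thesis using A.nonneg WV that by simp
  next
    case False
    then have "b w w > 0" using that B.nonneg[of w] WV by force
    have "a w w / b w w \<in> X" 
      unfolding X_def by (intro image_eqI[where x="(1 / sqrt (b w w)) *\<^sub>R w"]) (use normalize[OF that False] in simp_all)
    then have "l \<le> a w w / b w w" unfolding l_def by (rule cInf_lower[OF _ Xb])
    then show ?thesis using \<open>b w w > 0\<close> by (simp add: field_simps)
  qed
  have "\<exists>w\<in>U. a w w < l + 1 / Suc n" for n
  proof -
    have "l < l + 1 / Suc n" by simp
    then obtain x where "x \<in> X" "x < l + 1 / Suc n"
      unfolding l_def using cInf_lessD[OF Xne] by metis
    then show ?thesis by (auto simp: X_def)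
  qed
  then obtain s where s: "\<And>n. s n \<in> U" "\<And>n. a (s n) (s n) < l + 1 / Suc n" by metis
  then have sW: "s n \<in> W" "b (s n) (s n) = 1" for n by (auto simp: U_def)
  have sb: "a (s n) (s n) \<le> l + 1" for n
  proof -
    have "1 / real (Suc n) \<le> 1" by simp
    then show ?thesis using s(2)[of n] by linarith
  qed
  from compact[of s, OF WV(1)[OF sW(1)] sb] obtain r :: "nat \<Rightarrow> nat" where r: "strict_mono r"
    and r': "\<forall>e>0. \<exists>N. \<forall>i\<ge>N. \<forall>j\<ge>N. b (s (r i) - s (r j)) (s (r i) - s (r j)) < e"
    by blast
  define t where "t = s \<circ> r"
  have t: "t n \<in> W" "t n \<in> V" "t n \<in> L" "b (t n) (t n) = 1" for n using sW WV by (auto simp: t_def)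
  have ta: "a (t n) (t n) < l + 1 / Suc n" for n
  proof -
    have "1 / real (Suc (r n)) \<le> 1 / real (Suc n)"
      using strict_mono_imp_increasing[OF r, of n] by (simp add: frac_le)
    then show ?thesis using s(2)[of "r n"] by (simp add: t_def)
  qed
  have key: "a (t i - t j) (t i - t j) \<le> 2 / Suc i + 2 / Suc j + l * b (t i - t j) (t i - t j)" for i j
  proof -
    have "l * b (t i + t j) (t i + t j) \<le> a (t i + t j) (t i + t j)"
      using low Wadd t by blast
    moreover have "a (t i - t j) (t i - t j) = 2 * a (t i) (t i) + 2 * a (t j) (t j) - a (t i + t j) (t i + t j)"
      using t by (simp add: A.expand)
    moreover have "b (t i + t j) (t i + t j) = 4 - b (t i - t j) (t i - t j)"
      using t by (simp add: B.expand)
    ultimately show ?thesis using ta[of i] ta[of j] by (simp add: algebra_simps)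
  qed
  have "\<exists>u\<in>V. (\<lambda>n. a (t n - u) (t n - u)) \<longlonglongrightarrow> 0"
  proof (rule complete[of t])
    fix e :: real assume e: "e > 0"
    \<comment> \<open>The denominator has \<open>l + 1\<close> because only \<open>0 \<le> l\<close>
      is known. In \<open>key\<close> the first two terms stay below \<open>e / 4\<close> each and
      the last is at most \<open>e / 2\<close>.\<close>
    obtain N where N: "\<And>i j. i \<ge> N \<Longrightarrow> j \<ge> N \<Longrightarrow> b (t i - t j) (t i - t j) < e / (2 * (l + 1))"
      using r'[rule_format, of "e / (2 * (l + 1))"] e l0 by (auto simp: t_def)
    obtain M where M: "1 / Suc M < e / 8" using reals_Archimedean[of "e / 8"] e by (auto simp: inverse_eq_divide)
    show "\<exists>N. \<forall>i\<ge>N. \<forall>j\<ge>N. a (t i - t j) (t i - t j) < e"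
    proof (intro exI[of _ "max M N"] allI impI)
      fix i j assume ij: "max M N \<le> i" "max M N \<le> j"
      have "1 / real (Suc i) < e / 8" "1 / real (Suc j) < e / 8"
        using M ij by (smt (verit) Suc_le_mono frac_le max.bounded_iff of_nat_0_less_iff of_nat_mono zero_less_Suc)+
      moreover have "l * b (t i - t j) (t i - t j) \<le> e / 2"
      proof -
        have "l * b (t i - t j) (t i - t j) \<le> (l + 1) * (e / (2 * (l + 1)))"
          using N[of i j] ij l0 B.nonneg[of "t i - t j"] t by (intro mult_mono) auto
        also have "\<dots> = e / 2" using l0 by (simp add: field_simps)
        finally show ?thesis .
      qed
      ultimately show "a (t i - t j) (t i - t j) < e" using key[of i j] by simp
    qed
  qed (use t in auto)
  then obtain u where u: "u \<in> V" "(\<lambda>n. a (t n - u) (t n - u)) \<longlonglongrightarrow> 0" by auto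
  have bu: "(\<lambda>n. b (t n - u) (t n - u)) \<longlonglongrightarrow> 0"
    using b_tendsto_if_a_tendsto[OF t(2) u] .
  have "b u g = 0" if "g \<in> G" for g
  proof -
    have "(\<lambda>n. b (t n) g) \<longlonglongrightarrow> b u g"
      using bu u t that G by (intro B.tendsto_left) auto
    moreover have "b (t n) g = 0" for n using t(1)[of n] that by (simp add: W_def)
    ultimately show ?thesis using LIMSEQ_unique[OF _ tendsto_const] by simp
  qed
  then have uW: "u \<in> W" using u by (simp add: W_def)
  have "(\<lambda>n. b (t n) (t n)) \<longlonglongrightarrow> b u u" using bu u t by (intro B.tendsto_diag) auto
  then have b1: "b u u = 1" using t LIMSEQ_unique[OF _ tendsto_const] by simp
  have "(\<lambda>n. a (t n) (t n)) \<longlonglongrightarrow> a u u" using u t by (intro A.tendsto_diag) auto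
  moreover have "(\<lambda>n. l + 1 / Suc n) \<longlonglongrightarrow> l + 0"
    by (intro tendsto_intros LIMSEQ_inverse_real_of_nat[unfolded inverse_eq_divide])
  ultimately have "a u u \<le> l" using ta by (intro LIMSEQ_le[of "\<lambda>n. a (t n) (t n)" _ "\<lambda>n. l + 1 / Suc n"]) (auto intro: less_imp_le)
  then have "a u u * b w w \<le> a w w" if "w \<in> W" for w
    using low[OF that] B.nonneg[OF WV(2)[OF that]] by (smt (verit) mult_right_mono)
  then show ?thesis using uW b1 by blast
qed

text \<open>Minimality says that \<open>a - a u u * b\<close> is positive semidefinite on
  \<open>W\<close>, and it vanishes at \<open>u\<close>. Cauchy-Schwarz for this form then makes it
  vanish at \<open>(u, v)\<close> for every \<open>v\<close>; no derivative of the Rayleigh quotient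
  is taken.\<close>

lemma minimizer_eigen:
  assumes G: "G \<subseteq> L"
  defines "W \<equiv> {u \<in> V. \<forall>g\<in>G. b u g = 0}"
  assumes u: "u \<in> W" "b u u = 1" "\<And>w. w \<in> W \<Longrightarrow> a u u * b w w \<le> a w w" and v: "v \<in> W"
  shows "a u v = a u u * b u v"
proof -
  have sub: "subspace W"
    using G by (auto simp: subspace_def W_def B.expand subset_iff B.zero_left)
  interpret D: psd_form W "\<lambda>x y. a x y - a u u * b x y"
    by (unfold_locales; (rule sub)?)
       (use u(3) in \<open>auto simp: W_def A.expand B.expand algebra_simps A.sym B.sym\<close>)
  show ?thesis using D.cauchy_schwarz[OF u(1) v] u(2) by simp
qed

text \<open>A dimension count by double summation. Otherwise each \<open>e i\<close> would have a
  \<open>b\<close>-null remainder after projection, so its squared coefficients along the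
  \<open>\<phi> j\<close> would sum to 1. Adding this over \<open>k + 1\<close> indices and applying
  Bessel to each \<open>\<phi> j\<close> in turn gives \<open>k + 1 \<le> k\<close>.\<close>

lemma orthogonal_element:
  fixes k :: nat
  assumes "\<And>j. j < k \<Longrightarrow> \<phi> j \<in> V"
    and on: "\<And>i j. i < k \<Longrightarrow> j < k \<Longrightarrow> b (\<phi> i) (\<phi> j) = (if i = j then 1 else 0)"
  shows "\<exists>w\<in>V. (\<forall>j<k. b w (\<phi> j) = 0) \<and> b w w \<noteq> 0"
proof (rule ccontr)
  assume no: "\<not> ?thesis"
  obtain e :: "nat \<Rightarrow> 'v" where e: "\<And>i. e i \<in> V" "\<And>i j. b (e i) (e j) = (if i = j then 1 else 0)"
    using infinite_dim by blast
  have one: "(\<Sum>j<k. (b (e i) (\<phi> j))\<^sup>2) = 1" for i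
  proof -
    define w where "w = e i - (\<Sum>j<k. b (e i) (\<phi> j) *\<^sub>R \<phi> j)"
    have "w \<in> V" unfolding w_def using assms e by (intro A.mem) auto
    moreover have "b w (\<phi> j) = 0" if "j < k" for j
      unfolding w_def using assms e that by (intro B.orthonormal_expansion(2)) auto
    ultimately have "b w w = 0" using no by blast
    moreover have "b w w = b (e i) (e i) - (\<Sum>j<k. (b (e i) (\<phi> j))\<^sup>2)"
      unfolding w_def using assms e by (intro B.orthonormal_expansion(3)) auto
    ultimately show ?thesis using e by simp
  qed
  have "real (Suc k) = (\<Sum>i<Suc k. \<Sum>j<k. (b (e i) (\<phi> j))\<^sup>2)" using one by simp
  also have "\<dots> = (\<Sum>j<k. \<Sum>i<Suc k. (b (\<phi> j) (e i))\<^sup>2)"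
    using assms e by (subst sum.swap) (auto intro!: sum.cong simp: B.sym)
  also have "\<dots> \<le> (\<Sum>j<k. b (\<phi> j) (\<phi> j))"
    using assms e by (intro sum_mono B.bessel) auto
  also have "\<dots> = k" using on by simp
  finally show False by simp
qed

theorem eigen_sequence:
  "\<exists>(\<phi> :: nat \<Rightarrow> 'v) \<mu>. (\<forall>k. \<phi> k \<in> V) \<and> (\<forall>i j. b (\<phi> i) (\<phi> j) = (if i = j then 1 else 0)) \<and>
    (\<forall>k. \<forall>v\<in>V. a (\<phi> k) v = \<mu> k * b (\<phi> k) v) \<and> (\<forall>k. 0 < \<mu> k) \<and> mono \<mu> \<and>
    filterlim \<mu> at_top sequentially \<and>
    (\<forall>k. \<forall>u\<in>V. (\<forall>j<k. b u (\<phi> j) = 0) \<longrightarrow> \<mu> k * b u u \<le> a u u)"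
proof -
  define P where "P f k r \<longleftrightarrow> r \<in> V \<and> b r r = 1 \<and> (\<forall>j<k. b r (f j) = 0) \<and>
      (\<forall>u\<in>V. (\<forall>j<k. b u (f j) = 0) \<longrightarrow> a r r * b u u \<le> a u u)" for f :: "nat \<Rightarrow> 'v" and k r
  have "\<exists>\<phi>. \<forall>k. P \<phi> k (\<phi> k)"
  \<comment> \<open>\<open>P f k\<close> reads \<open>f\<close> only below \<open>k\<close>, so
    choosing one minimiser for every valid past defines the whole sequence by well-founded
    choice.\<close>
  proof (rule dependent_wf_choice[OF wf_less])
    show "P f x r = P g x r" if "\<And>z. (z, x) \<in> {(x, y). x < y} \<Longrightarrow> f z = g z" for f g x r
      using that by (simp add: P_def)
    fix k :: nat and f assume "\<And>y. (y, k) \<in> {(x, y). x < y} \<Longrightarrow> P f y (f y)"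
    then have Pf: "\<And>j. j < k \<Longrightarrow> P f j (f j)" by simp
    have f: "\<And>j. j < k \<Longrightarrow> f j \<in> V" using Pf by (simp add: P_def)
    have on: "b (f i) (f j) = (if i = j then 1 else 0)" if "i < k" "j < k" for i j
      using Pf[OF that(1)] Pf[OF that(2)] B.sym[of "f i" "f j"] f that
      by (cases i j rule: linorder_cases) (auto simp: P_def)
    obtain w where "w \<in> V" "\<forall>j<k. b w (f j) = 0" "b w w \<noteq> 0"
      using orthogonal_element[of k f] f on by blast
    then have "\<exists>u\<in>{u \<in> V. \<forall>g\<in>f ` {..<k}. b u g = 0}. b u u = 1 \<and>
        (\<forall>w\<in>{u \<in> V. \<forall>g\<in>f ` {..<k}. b u g = 0}. a u u * b w w \<le> a w w)"
      using f by (intro minimizer_exists) auto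
    then show "\<exists>r. P f k r" unfolding P_def by auto
  qed
  then obtain \<phi> where \<phi>: "\<And>k. P \<phi> k (\<phi> k)" by blast
  define \<mu> where "\<mu> k = a (\<phi> k) (\<phi> k)" for k
  have V: "\<phi> k \<in> V" and min: "u \<in> V \<Longrightarrow> (\<forall>j<k. b u (\<phi> j) = 0) \<Longrightarrow> \<mu> k * b u u \<le> a u u" for k u
    using \<phi>[of k] by (auto simp: P_def \<mu>_def)
  have on: "b (\<phi> i) (\<phi> j) = (if i = j then 1 else 0)" for i j
    using \<phi>[of i] \<phi>[of j] B.sym[of "\<phi> i" "\<phi> j"] V
    by (cases i j rule: linorder_cases) (auto simp: P_def)
  have pos: "0 < \<mu> k" for k
    using coercive[OF V[of k]] c_pos on[of k k] by (simp add: \<mu>_def)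
  \<comment> \<open>The minimisation yields the equation only against vectors orthogonal to the
    earlier \<open>\<phi> j\<close>. Against those earlier vectors both sides vanish: the right one
    by orthonormality, the left one by symmetry and their own equations, hence strong
    induction.\<close>
  have eig: "a (\<phi> k) v = \<mu> k * b (\<phi> k) v" if "v \<in> V" for k v
    using that
  proof (induction k arbitrary: v rule: less_induct)
    case (less k)
    define p where "p = (\<Sum>j<k. b v (\<phi> j) *\<^sub>R \<phi> j)"
    define w where "w = v - p"
    have p: "p \<in> V" unfolding p_def using V by (intro A.mem) auto
    then have w: "w \<in> V" unfolding w_def using less.prems by (intro A.mem)
    have wo: "b w (\<phi> j) = 0" if "j < k" for j
      unfolding w_def p_def using less.prems V on that by (intro B.orthonormal_expansion(2)) auto
    have "a (\<phi> k) w = a (\<phi> k) (\<phi> k) * b (\<phi> k) w"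
    proof (rule minimizer_eigen[of "\<phi> ` {..<k}"])
      show "w' \<in> {u \<in> V. \<forall>g\<in>\<phi> ` {..<k}. b u g = 0} \<Longrightarrow> a (\<phi> k) (\<phi> k) * b w' w' \<le> a w' w'" for w'
        using min[of w' k] by (auto simp: \<mu>_def)
    qed (use V on w wo in auto)
    moreover have "b (\<phi> k) p = 0"
      using V on unfolding p_def by (subst B.sum_right) (auto simp: B.expand)
    moreover have "a (\<phi> k) p = 0"
    proof -
      have "a (\<phi> k) p = (\<Sum>j<k. b v (\<phi> j) * a (\<phi> k) (\<phi> j))"
        using V unfolding p_def by (subst A.sum_right) (auto simp: A.expand)
      also have "\<dots> = 0"
        using less.IH[OF _ V[of k]] V on by (intro sum.neutral) (auto simp: A.sym[of "\<phi> k"])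
      finally show ?thesis .
    qed
    moreover have "v = w + p" by (simp add: w_def)
    ultimately show ?case using V w p by (simp add: A.expand B.expand \<mu>_def)
  qed
  have mono: "mono \<mu>"
  proof (rule monoI)
    fix i j :: nat assume "i \<le> j"
    then show "\<mu> i \<le> \<mu> j" using min[OF V[of j], of i] on by (simp add: \<mu>_def)
  qed
  \<comment> \<open>Bounded \<open>\<mu>\<close> would make the orthonormal sequence bounded in
    energy. Distinct orthonormal vectors have squared \<open>b\<close>-distance 2, so no subsequence
    of it is \<open>b\<close>-Cauchy.\<close>
  have "filterlim \<mu> at_top sequentially"
  proof (rule ccontr)
    assume n: "\<not> ?thesis"
    have "\<exists>C. \<forall>k. \<mu> k \<le> C"
    proof (rule ccontr)
      assume "\<nexists>C. \<forall>k. \<mu> k \<le> C"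
      then have "\<exists>k0. \<mu> k0 > Z" for Z by (metis not_le)
      then have "\<exists>k0. \<forall>k\<ge>k0. Z \<le> \<mu> k" for Z by (metis less_imp_le mono monoD order_trans)
      then have "filterlim \<mu> at_top sequentially"
        unfolding filterlim_at_top eventually_sequentially by blast
      then show False using n by blast
    qed
    then obtain C where C: "\<And>k. a (\<phi> k) (\<phi> k) \<le> C" by (auto simp: \<mu>_def)
    from compact[of \<phi>, OF V C] obtain r :: "nat \<Rightarrow> nat" where r: "strict_mono r"
      and r': "\<forall>e>0. \<exists>N. \<forall>i\<ge>N. \<forall>j\<ge>N. b (\<phi> (r i) - \<phi> (r j)) (\<phi> (r i) - \<phi> (r j)) < e"
      by blast
    obtain N where "\<forall>i\<ge>N. \<forall>j\<ge>N. b (\<phi> (r i) - \<phi> (r j)) (\<phi> (r i) - \<phi> (r j)) < 1"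
      using r'[rule_format, of 1] by auto
    then have "b (\<phi> (r N) - \<phi> (r (Suc N))) (\<phi> (r N) - \<phi> (r (Suc N))) < 1" by simp
    moreover have "r N \<noteq> r (Suc N)" using r(1) by (metis n_not_Suc_n strict_mono_eq)
    ultimately show False using V on by (simp add: B.expand)
  qed
  then show ?thesis using V on eig pos mono min by blast
qed

text \<open>For \<open>u\<close> in \<open>V\<close> the remainder after \<open>n\<close> terms is
  orthogonal to \<open>\<phi> 0\<close>, ..., \<open>\<phi> (n - 1)\<close>, so \<open>min\<close>
  bounds its \<open>b\<close>-square by \<open>a u u / \<mu> n\<close>. For \<open>f\<close> in
  \<open>L\<close> this is combined with density and the fact that passing to the remainder does not
  increase \<open>b\<close>.\<close>

lemma eigen_basis:
  assumes V: "\<And>k. \<phi> k \<in> V" and on: "\<And>i j. b (\<phi> i) (\<phi> j) = (if i = j then 1 else 0)"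
    and eig: "\<And>k v. v \<in> V \<Longrightarrow> a (\<phi> k) v = \<mu> k * b (\<phi> k) v"
    and inf: "filterlim \<mu> at_top sequentially"
    and min: "\<And>k u. u \<in> V \<Longrightarrow> (\<forall>j<k. b u (\<phi> j) = 0) \<Longrightarrow> \<mu> k * b u u \<le> a u u"
    and f: "f \<in> L"
  shows "(\<lambda>n. b (f - (\<Sum>j<n. b f (\<phi> j) *\<^sub>R \<phi> j)) (f - (\<Sum>j<n. b f (\<phi> j) *\<^sub>R \<phi> j))) \<longlonglongrightarrow> 0"
proof -
  define S where "S f n = (\<Sum>j<n. b f (\<phi> j) *\<^sub>R \<phi> j)" for f and n :: nat
  have SV: "S f n \<in> V" for f n unfolding S_def using V by (intro A.mem) auto
  have lin: "(f - S f n) - (g - S g n) = (f - g) - S (f - g) n" if "f \<in> L" "g \<in> L" for f g n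
    using that V by (simp add: S_def B.diff_left scaleR_diff_left sum_subtractf)
  have bS: "b (f - S f n) (f - S f n) \<le> b f f" if "f \<in> L" for f n
    unfolding S_def using B.orthonormal_expansion(3)[of "{..<n}" \<phi> f] V on that by (simp add: sum_nonneg)
  \<comment> \<open>By the eigenvalue equation the remainder is orthogonal to the partial sum for
    \<open>a\<close> as well, so its energy is at most that of \<open>u\<close>.\<close>
  have aS: "a (u - S u n) (u - S u n) \<le> a u u" if u: "u \<in> V" for u n
  proof -
    define w where "w = u - S u n"
    have wV: "w \<in> V" using u SV by (simp add: w_def)
    have wo: "b w (\<phi> j) = 0" if "j < n" for j
      unfolding w_def S_def using u V on that by (intro B.orthonormal_expansion(2)) auto
    have "a (S u n) w = (\<Sum>j<n. b u (\<phi> j) * a (\<phi> j) w)"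
      unfolding S_def using V wV by (subst A.sum_left) (auto simp: A.expand)
    also have "\<dots> = 0"
      using eig[OF wV] wo wV V by (intro sum.neutral) (auto simp: B.sym[of _ w])
    finally have z: "a (S u n) w = 0" .
    have "a u u = a (w + S u n) (w + S u n)" by (simp add: w_def)
    also have "\<dots> = a w w + a (S u n) (S u n)"
      using wV SV z A.sym[of w "S u n"] by (simp add: A.expand)
    finally show ?thesis using A.nonneg[OF SV] by (simp add: w_def)
  qed
  have conv: "(\<lambda>n. b (u - S u n) (u - S u n)) \<longlonglongrightarrow> 0" if u: "u \<in> V" for u
  proof (rule tendsto_sandwich[OF _ _ tendsto_const])
    show "(\<lambda>n. a u u / \<mu> n) \<longlonglongrightarrow> 0"
      by (rule tendsto_divide_0[OF tendsto_const]) (use inf filterlim_at_top_imp_at_infinity in blast)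
    show "\<forall>\<^sub>F n in sequentially. b (u - S u n) (u - S u n) \<le> a u u / \<mu> n"
    proof -
      have "\<forall>\<^sub>F n in sequentially. \<mu> n > 0" using inf by (simp add: filterlim_at_top_dense)
      then show ?thesis
      proof eventually_elim
        case (elim n)
        have "\<forall>j<n. b (u - S u n) (\<phi> j) = 0"
          unfolding S_def using u V on by (auto intro!: B.orthonormal_expansion(2))
        then have "\<mu> n * b (u - S u n) (u - S u n) \<le> a u u"
          using min[of "u - S u n" n] aS[OF u, of n] SV u by force
        then show ?case using elim by (simp add: field_simps)
      qed
    qed
  qed (use B.nonneg u SV in auto)
  have "(\<lambda>n. b (f - S f n) (f - S f n)) \<longlonglongrightarrow> 0"
  proof (rule LIMSEQ_I)
    fix e :: real assume e: "e > 0"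
    obtain g where g: "g \<in> V" "b (f - g) (f - g) < e / 4" using dense[OF f, of "e / 4"] e by auto
    obtain N where N: "\<And>n. n \<ge> N \<Longrightarrow> norm (b (g - S g n) (g - S g n) - 0) < e / 4"
      using LIMSEQ_D[OF conv[OF g(1)], of "e / 4"] e by auto
    show "\<exists>no. \<forall>n\<ge>no. norm (b (f - S f n) (f - S f n) - 0) < e"
    proof (intro exI allI impI)
      fix n assume n: "n \<ge> N"
      have eq: "f - S f n = ((f - g) - S (f - g) n) + (g - S g n)"
        unfolding lin[OF f VL[OF g(1)], symmetric] by simp
      have "b (f - S f n) (f - S f n) \<le> 2 * b ((f - g) - S (f - g) n) ((f - g) - S (f - g) n) + 2 * b (g - S g n) (g - S g n)"
        unfolding eq using B.add_le[of "(f - g) - S (f - g) n" "g - S g n"] f g SV by blast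
      also have "\<dots> < e" using bS[of "f - g" n] N[OF n] f g by auto
      finally show "norm (b (f - S f n) (f - S f n) - 0) < e"
        using B.nonneg[of "f - S f n"] f SV by auto
    qed
  qed
  then show ?thesis by (simp add: S_def)
qed

text \<open>The substitute for weak compactness: a \<open>b\<close>-limit of a sequence of bounded
  energy lies in \<open>V\<close> up to a \<open>b\<close>-null vector. Coefficients converge along
  the sequence, so the series of \<open>\<mu> j * (b v (\<phi> j))\<^sup>2\<close> is bounded by
  \<open>C\<close>. Hence the partial sums of the expansion of \<open>v\<close> are
  \<open>a\<close>-Cauchy, and their limit in \<open>V\<close> must agree with \<open>v\<close> for
  \<open>b\<close>.\<close>

lemma bounded_b_limit:
  assumes s: "\<And>n. s n \<in> V" "\<And>n. a (s n) (s n) \<le> C" and v: "v \<in> L"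
    and lim: "(\<lambda>n. b (s n - v) (s n - v)) \<longlonglongrightarrow> 0"
  shows "\<exists>w\<in>V. b (w - v) (w - v) = 0"
proof -
  obtain \<phi> :: "nat \<Rightarrow> 'v" and \<mu> where
    V: "\<And>k. \<phi> k \<in> V" and on: "\<And>i j. b (\<phi> i) (\<phi> j) = (if i = j then 1 else 0)"
    and eig: "\<And>k v. v \<in> V \<Longrightarrow> a (\<phi> k) v = \<mu> k * b (\<phi> k) v" and pos: "\<And>k. 0 < \<mu> k"
    and inf: "filterlim \<mu> at_top sequentially"
    and min: "\<And>k u. u \<in> V \<Longrightarrow> (\<forall>j<k. b u (\<phi> j) = 0) \<Longrightarrow> \<mu> k * b u u \<le> a u u"
    using eigen_sequence by blast
  define S where "S u n = (\<Sum>j<n. b u (\<phi> j) *\<^sub>R \<phi> j)" for u and n :: nat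
  have SV: "S u n \<in> V" for u n unfolding S_def using V by (intro A.mem) auto
  have aphi: "a (\<phi> i) (\<phi> j) = (if i = j then \<mu> i else 0)" for i j using eig V on by simp
  have aJ: "a (\<Sum>j\<in>J. t j *\<^sub>R \<phi> j) (\<Sum>j\<in>J. t j *\<^sub>R \<phi> j) = (\<Sum>j\<in>J. \<mu> j * (t j)\<^sup>2)"
    if "finite J" for J and t :: "nat \<Rightarrow> real"
  proof -
    have "a (\<Sum>j\<in>J. t j *\<^sub>R \<phi> j) (\<Sum>j\<in>J. t j *\<^sub>R \<phi> j) = (\<Sum>i\<in>J. \<Sum>j\<in>J. t i * (t j * a (\<phi> i) (\<phi> j)))"
    proof -
      have "a (t i *\<^sub>R \<phi> i) (\<Sum>j\<in>J. t j *\<^sub>R \<phi> j) = (\<Sum>j\<in>J. t i * (t j * a (\<phi> i) (\<phi> j)))" for i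
        using V by (subst A.sum_right) (auto simp: A.scale_left A.scale_right intro!: sum.cong)
      then show ?thesis using V by (subst A.sum_left) auto
    qed
    also have "\<dots> = (\<Sum>i\<in>J. \<Sum>j\<in>J. if i = j then \<mu> i * (t i)\<^sup>2 else 0)"
      by (intro sum.cong) (auto simp: aphi power2_eq_square)
    finally show ?thesis using that by simp
  qed
  have bes: "(\<Sum>j<K. \<mu> j * (b u (\<phi> j))\<^sup>2) \<le> a u u" if u: "u \<in> V" for u K
  proof -
    have "a (S u K) u = (\<Sum>j<K. \<mu> j * (b u (\<phi> j))\<^sup>2)"
      unfolding S_def using V u eig[OF u]
      by (subst A.sum_left) (auto simp: A.expand power2_eq_square B.sym[of u] intro!: sum.cong)
    moreover have "a (S u K) (S u K) = (\<Sum>j<K. \<mu> j * (b u (\<phi> j))\<^sup>2)"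
      unfolding S_def by (rule aJ) simp
    ultimately show ?thesis
      using A.nonneg[of "u - S u K"] u SV A.sym[of u "S u K"] by (simp add: A.expand)
  qed
  \<comment> \<open>The limit is taken in finite sums, where it is termwise; the bound
    \<open>C\<close> does not depend on \<open>K\<close>.\<close>
  have bnd: "(\<Sum>j<K. \<mu> j * (b v (\<phi> j))\<^sup>2) \<le> C" for K
  proof (rule LIMSEQ_le_const2)
    show "(\<lambda>n. \<Sum>j<K. \<mu> j * (b (s n) (\<phi> j))\<^sup>2) \<longlonglongrightarrow> (\<Sum>j<K. \<mu> j * (b v (\<phi> j))\<^sup>2)"
      using s v V lim by (intro tendsto_intros B.tendsto_left) auto
    show "\<exists>N. \<forall>n\<ge>N. (\<Sum>j<K. \<mu> j * (b (s n) (\<phi> j))\<^sup>2) \<le> C"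
      using bes s order_trans by blast
  qed
  have "summable (\<lambda>j. \<mu> j * (b v (\<phi> j))\<^sup>2)"
    by (rule summableI_nonneg_bounded[OF _ bnd]) (simp add: pos less_imp_le)
  then have cau: "Cauchy (\<lambda>n. \<Sum>j<n. \<mu> j * (b v (\<phi> j))\<^sup>2)"
    unfolding summable_iff_convergent by (rule convergent_Cauchy)
  have "\<exists>w\<in>V. (\<lambda>n. a (S v n - w) (S v n - w)) \<longlonglongrightarrow> 0"
  proof (rule complete[of "S v"])
    fix e :: real assume "e > 0"
    then obtain N where N: "\<And>i j. i \<ge> N \<Longrightarrow> j \<ge> N \<Longrightarrow>
        dist (\<Sum>j<i. \<mu> j * (b v (\<phi> j))\<^sup>2) (\<Sum>j<j. \<mu> j * (b v (\<phi> j))\<^sup>2) < e"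
      using metric_CauchyD[OF cau] by blast
    have *: "a (S v i - S v j) (S v i - S v j) < e" if "N \<le> j" "j \<le> i" for i j
    proof -
      have "S v i - S v j = (\<Sum>k\<in>{j..<i}. b v (\<phi> k) *\<^sub>R \<phi> k)"
        using sum_diff_nat_ivl[of 0 j i "\<lambda>k. b v (\<phi> k) *\<^sub>R \<phi> k"] that
        by (simp add: S_def lessThan_atLeast0)
      then have "a (S v i - S v j) (S v i - S v j) = (\<Sum>k\<in>{j..<i}. \<mu> k * (b v (\<phi> k))\<^sup>2)"
        by (simp add: aJ)
      also have "\<dots> = (\<Sum>k<i. \<mu> k * (b v (\<phi> k))\<^sup>2) - (\<Sum>k<j. \<mu> k * (b v (\<phi> k))\<^sup>2)"
        using sum_diff_nat_ivl[of 0 j i "\<lambda>k. \<mu> k * (b v (\<phi> k))\<^sup>2"] that by (simp add: lessThan_atLeast0)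
      also have "\<dots> < e" using N[of i j] that by (auto simp: dist_real_def)
      finally show ?thesis .
    qed
    show "\<exists>N. \<forall>i\<ge>N. \<forall>j\<ge>N. a (S v i - S v j) (S v i - S v j) < e"
    proof (intro exI allI impI)
      fix i j assume ij: "N \<le> i" "N \<le> j"
      have "a (S v i - S v j) (S v i - S v j) = a (S v j - S v i) (S v j - S v i)"
        using SV by (simp add: A.expand)
      then show "a (S v i - S v j) (S v i - S v j) < e"
        using *[of j i] *[of i j] ij by (cases "i \<le> j") auto
    qed
  qed (rule SV)
  then obtain w where w: "w \<in> V" "(\<lambda>n. a (S v n - w) (S v n - w)) \<longlonglongrightarrow> 0" by blast
  have 1: "(\<lambda>n. b (S v n - w) (S v n - w)) \<longlonglongrightarrow> 0"
    using b_tendsto_if_a_tendsto[OF SV w] .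
  have 2: "(\<lambda>n. b (v - S v n) (v - S v n)) \<longlonglongrightarrow> 0"
    unfolding S_def by (rule eigen_basis[OF V on eig inf min v])
  have "(\<lambda>n. 2 * b (S v n - w) (S v n - w) + 2 * b (v - S v n) (v - S v n)) \<longlonglongrightarrow> 2 * 0 + 2 * 0"
    using 1 2 by (intro tendsto_intros)
  moreover have "b (w - v) (w - v) \<le> 2 * b (S v n - w) (S v n - w) + 2 * b (v - S v n) (v - S v n)" for n
  proof -
    have "b (w - v) (w - v) = b ((S v n - w) + (v - S v n)) ((S v n - w) + (v - S v n))"
      using v w SV by (simp add: B.expand)
    then show ?thesis using B.add_le[of "S v n - w" "v - S v n"] v w SV by simp
  qed
  ultimately have "b (w - v) (w - v) \<le> 2 * 0 + 2 * 0"
    by (intro LIMSEQ_le_const) auto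
  then show ?thesis using w v B.nonneg[of "w - v"] by force
qed

end

section \<open>Test functions\<close>

lemma Ck_SucI:
  assumes "\<And>x. (f has_derivative D x) (at x)" "\<And>b. b \<in> Basis \<Longrightarrow> Ck n (\<lambda>x. D x b)"
  shows "Ck (Suc n) f"
proof -
  have "frechet_derivative f (at x) = D x" for x
    using frechet_derivative_at[OF assms(1)] by simp
  then show ?thesis using assms by (auto simp: differentiable_def)
qed

lemma Ck_Suc_has_derivative:
  "Ck (Suc n) f \<Longrightarrow> (f has_derivative frechet_derivative f (at x)) (at x)"
  by (simp add: frechet_derivative_works)

lemma Ck_Suc_imp_Ck: "Ck (Suc n) f \<Longrightarrow> Ck n f"
proof (induction n arbitrary: f)
  case 0
  then show ?case
    by (auto intro!: continuous_at_imp_continuous_on differentiable_imp_continuous_within)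
next
  case (Suc n)
  from Suc.prems have 1: "\<forall>x. f differentiable at x"
    and 2: "\<And>b. b \<in> Basis \<Longrightarrow> Ck (Suc n) (\<lambda>x. frechet_derivative f (at x) b)"
    unfolding Ck.simps(2)[of "Suc n" f] by blast+
  show ?case unfolding Ck.simps(2)[of n f] using 1 Suc.IH[OF 2] by blast
qed

lemma Ck_const: "Ck n (\<lambda>x. c)"
proof (induction n arbitrary: c)
  case (Suc n)
  show ?case by (rule Ck_SucI[where D="\<lambda>x h. 0"]) (auto intro: Suc)
qed simp

lemma Ck_inner_left: "Ck n (\<lambda>x. x \<bullet> b)"
proof (cases n)
  case (Suc m)
  show ?thesis unfolding Suc
    by (rule Ck_SucI[where D="\<lambda>x h. h \<bullet> b"]) (auto intro!: derivative_eq_intros Ck_const)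
qed (auto intro!: continuous_intros)

lemma Ck_add: "Ck n f \<Longrightarrow> Ck n g \<Longrightarrow> Ck n (\<lambda>x. f x + g x)"
proof (induction n arbitrary: f g)
  case (Suc n)
  show ?case
    by (rule Ck_SucI[OF has_derivative_add[OF Suc.prems[THEN Ck_Suc_has_derivative]]])
       (use Suc in auto)
qed (auto intro!: continuous_intros)

lemma Ck_mult: "Ck n f \<Longrightarrow> Ck n g \<Longrightarrow> Ck n (\<lambda>x. f x * g x)"
proof (induction n arbitrary: f g)
  case (Suc n)
  show ?case
    by (rule Ck_SucI[OF has_derivative_mult[OF Suc.prems[THEN Ck_Suc_has_derivative]]])
       (use Suc Suc.prems[THEN Ck_Suc_imp_Ck] in \<open>auto intro!: Ck_add Suc.IH\<close>)
qed (auto intro!: continuous_intros)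

lemma Ck_diff: "Ck n f \<Longrightarrow> Ck n g \<Longrightarrow> Ck n (\<lambda>x. f x - g x)"
  using Ck_add[OF _ Ck_mult[OF Ck_const[of n "-1"]], of f g] by simp

lemma Ck_prod: "(\<And>i. i \<in> I \<Longrightarrow> Ck n (f i)) \<Longrightarrow> Ck n (\<lambda>x. \<Prod>i\<in>I. f i x)"
  by (induction I rule: infinite_finite_induct) (auto intro: Ck_const Ck_mult)

text \<open>\<open>G\<close> lists a function together with all its derivatives. Claiming the result
  for every \<open>k\<close> at once is what lets the induction on \<open>n\<close> absorb the chain
  rule.\<close>

lemma Ck_compose:
  fixes G :: "nat \<Rightarrow> real \<Rightarrow> real"
  assumes G: "\<And>k t. (G k has_real_derivative G (Suc k) t) (at t)"
  shows "Ck n f \<Longrightarrow> Ck n (\<lambda>x. G k (f x))"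
proof (induction n arbitrary: k)
  case 0
  have "continuous_on UNIV (G k)"
    using G by (meson DERIV_isCont continuous_at_imp_continuous_on)
  then show ?case using 0 by (auto intro!: continuous_on_compose2[of UNIV "G k" UNIV f])
next
  case (Suc n)
  have d: "((\<lambda>x. G k (f x)) has_derivative (\<lambda>h. frechet_derivative f (at x) h * G (Suc k) (f x))) (at x)" for x
    using has_derivative_compose[OF Ck_Suc_has_derivative[OF Suc.prems] G[unfolded has_field_derivative_def, of k "f x"]]
    by (simp add: mult.commute)
  show ?case
    by (rule Ck_SucI[OF d], rule Ck_mult)
       (use Suc.prems Suc.IH Ck_Suc_imp_Ck[OF Suc.prems] in auto)
qed

lemma Cc_infI:
  assumes "\<And>n. Ck n f" "compact K" "K \<subseteq> \<Omega>" "\<And>x. x \<notin> K \<Longrightarrow> f x = 0"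
  shows "f \<in> Cc_inf \<Omega>"
proof -
  have "closure {x. f x \<noteq> 0} \<subseteq> K"
    using assms by (intro closure_minimal) (auto intro: compact_imp_closed)
  moreover from this have "compact (closure {x. f x \<noteq> 0})"
    using compact_Int_closed[OF assms(2) closed_closure] inf.absorb2 by metis
  ultimately show ?thesis using assms unfolding Cc_inf_def by blast
qed

lemma Cc_inf_Ck: "f \<in> Cc_inf \<Omega> \<Longrightarrow> Ck n f"
  by (simp add: Cc_inf_def)

lemma Cc_inf_support:
  assumes "f \<in> Cc_inf \<Omega>"
  shows "\<exists>K. compact K \<and> K \<subseteq> \<Omega> \<and> (\<forall>x. x \<notin> K \<longrightarrow> f x = 0)"
  using assms closure_subset[of "{x. f x \<noteq> 0}"] unfolding Cc_inf_def by blast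

lemma Cc_inf_add:
  assumes f: "f \<in> Cc_inf \<Omega>" and g: "g \<in> Cc_inf \<Omega>"
  shows "(\<lambda>x. f x + g x) \<in> Cc_inf \<Omega>"
proof -
  obtain K where K: "compact K" "K \<subseteq> \<Omega>" "\<And>x. x \<notin> K \<Longrightarrow> f x = 0"
    using Cc_inf_support[OF f] by blast
  obtain L where L: "compact L" "L \<subseteq> \<Omega>" "\<And>x. x \<notin> L \<Longrightarrow> g x = 0"
    using Cc_inf_support[OF g] by blast
  show ?thesis
    by (rule Cc_infI[OF Ck_add[OF Cc_inf_Ck[OF f] Cc_inf_Ck[OF g]] compact_Un[OF K(1) L(1)]]) (use K L in auto)
qed

lemma Cc_inf_mult:
  assumes f: "f \<in> Cc_inf \<Omega>" and g: "\<And>n. Ck n g"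
  shows "(\<lambda>x. f x * g x) \<in> Cc_inf \<Omega>"
proof -
  obtain K where K: "compact K" "K \<subseteq> \<Omega>" "\<And>x. x \<notin> K \<Longrightarrow> f x = 0"
    using Cc_inf_support[OF f] by blast
  show ?thesis by (rule Cc_infI[OF Ck_mult[OF Cc_inf_Ck[OF f] g] K(1,2)]) (simp add: K(3))
qed

lemma Cc_inf_scale: "f \<in> Cc_inf \<Omega> \<Longrightarrow> (\<lambda>x. c * f x) \<in> Cc_inf \<Omega>"
  using Cc_inf_mult[OF _ Ck_const[of _ c], of f] by (simp add: mult.commute)

lemma Cc_inf_compose:
  fixes G :: "nat \<Rightarrow> real \<Rightarrow> real"
  assumes G: "\<And>k t. (G k has_real_derivative G (Suc k) t) (at t)" "G 0 0 = 0" and f: "f \<in> Cc_inf \<Omega>"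
  shows "(\<lambda>x. G 0 (f x)) \<in> Cc_inf \<Omega>"
proof -
  obtain K where K: "compact K" "K \<subseteq> \<Omega>" "\<And>x. x \<notin> K \<Longrightarrow> f x = 0"
    using Cc_inf_support[OF f] by blast
  show ?thesis by (rule Cc_infI[OF Ck_compose[of G, OF G(1) Cc_inf_Ck[OF f]] K(1,2)]) (simp add: K(3) G(2))
qed

lemma Cc_inf_zero: "(\<lambda>x. 0) \<in> Cc_inf \<Omega>"
  by (rule Cc_infI[where K="{}"]) (auto intro: Ck_const)

lemma Cc_inf_continuous: "f \<in> Cc_inf \<Omega> \<Longrightarrow> continuous_on UNIV f"
  using Cc_inf_Ck[of f _ 0] by simp

lemma Cc_inf_measurable: "f \<in> Cc_inf \<Omega> \<Longrightarrow> f \<in> borel_measurable borel"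
  by (intro borel_measurable_continuous_onI Cc_inf_continuous)

lemma Cc_inf_bounded:
  assumes "f \<in> Cc_inf \<Omega>" obtains M where "M \<ge> 0" "\<And>x. \<bar>f x\<bar> \<le> M"
proof -
  obtain K where K: "compact K" "\<And>x. x \<notin> K \<Longrightarrow> f x = 0" using Cc_inf_support[OF assms] by blast
  have "compact (f ` K)" using K(1) Cc_inf_continuous[OF assms]
    by (meson compact_continuous_image continuous_on_subset subset_UNIV)
  then obtain M where "\<forall>y\<in>f ` K. norm y \<le> M" "M > 0"
    using compact_imp_bounded[THEN bounded_pos[THEN iffD1]] by blast
  then have "\<bar>f x\<bar> \<le> M" for x using K(2) by (cases "x \<in> K") auto
  then show thesis using that[of M] \<open>M > 0\<close> by auto
qed

text \<open>The partial derivatives are continuous and vanish off the compact support, hence are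
  bounded, and the mean value inequality applies. The Lipschitz bound is what tames the singularity
  of the kernel on the diagonal.\<close>

lemma Cc_inf_lipschitz:
  fixes f :: "'a::euclidean_space \<Rightarrow> real"
  assumes "f \<in> Cc_inf \<Omega>" obtains M where "M \<ge> 0" "\<And>x y. \<bar>f x - f y\<bar> \<le> M * norm (x - y)"
proof -
  define D where "D x = frechet_derivative f (at x)" for x
  note f = Cc_inf_Ck[OF assms, of "Suc 0"]
  obtain K where K: "compact K" "\<And>x. x \<notin> K \<Longrightarrow> f x = 0" using Cc_inf_support[OF assms] by blast
  have der: "(f has_derivative D x) (at x)" for x
    using Ck_Suc_has_derivative[OF f] by (simp add: D_def)
  have D0: "D x = (\<lambda>h. 0)" if "x \<notin> K" for x
  proof -
    have "(f has_derivative (\<lambda>h. 0)) (at x)"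
    proof (rule has_derivative_transform_within_open[where f="\<lambda>x. 0" and s="- K"])
      show "open (- K)" using K(1) by (simp add: compact_imp_closed open_Compl)
    qed (use that K in auto)
    then show ?thesis using has_derivative_unique der by blast
  qed
  have "\<exists>B. \<forall>x. \<bar>D x b\<bar> \<le> B" if "b \<in> Basis" for b
  proof -
    have "continuous_on K (\<lambda>x. D x b)"
      using f that by (auto simp: D_def intro: continuous_on_subset)
    then have "compact ((\<lambda>x. D x b) ` K)" using K(1) compact_continuous_image by blast
    then obtain B where "\<forall>y\<in>(\<lambda>x. D x b) ` K. norm y \<le> B" "B > 0"
      using compact_imp_bounded[THEN bounded_pos[THEN iffD1]] by blast
    then have "\<bar>D x b\<bar> \<le> B" for x using D0 by (cases "x \<in> K") auto
    then show ?thesis by blast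
  qed
  then obtain B where B: "\<And>b x. b \<in> Basis \<Longrightarrow> \<bar>D x b\<bar> \<le> B b" by metis
  define M where "M = (\<Sum>b\<in>Basis. \<bar>B b\<bar>)"
  have on: "onorm (D x) \<le> M" for x
  proof (rule onorm_bound)
    show "0 \<le> M" by (simp add: M_def sum_nonneg)
    fix h :: 'a
    have "linear (D x)" using der has_derivative_linear by blast
    then have "D x h = (\<Sum>b\<in>Basis. (h \<bullet> b) * D x b)"
      by (subst euclidean_representation[of h, symmetric]) (simp add: linear_sum linear_scale)
    also have "norm \<dots> \<le> (\<Sum>b\<in>Basis. norm h * \<bar>B b\<bar>)"
    proof (rule sum_norm_le)
      fix b :: 'a assume b: "b \<in> Basis"
      have "\<bar>D x b\<bar> \<le> \<bar>B b\<bar>" using B[OF b, of x] by linarith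
      then show "norm ((h \<bullet> b) * D x b) \<le> norm h * \<bar>B b\<bar>"
        using Basis_le_norm[OF b, of h] by (auto simp: abs_mult intro!: mult_mono)
    qed
    finally show "norm (D x h) \<le> M * norm h" by (simp add: M_def sum_distrib_left mult.commute)
  qed
  have "\<bar>f x - f y\<bar> \<le> M * norm (x - y)" for x y
    using differentiable_bound[of UNIV f D M x y] der on by simp
  then show thesis using that[of M] by (simp add: M_def sum_nonneg)
qed

text \<open>A family containing the classical flat function \<open>exp (- 1 / t)\<close> (for
  \<open>p = 1\<close>) that is closed under differentiation; smoothness then needs only one
  derivative formula.\<close>

definition flat :: "real poly \<Rightarrow> real \<Rightarrow> real" where
  "flat p t = (if t > 0 then poly p (1 / t) * exp (- (1 / t)) else 0)"

lemma flat_tendsto_0: "(flat p \<longlongrightarrow> 0) (at 0)"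
proof -
  have "((\<lambda>s. \<Sum>i\<le>degree p. coeff p i * (s ^ i / exp s)) \<longlongrightarrow> (\<Sum>i\<le>degree p. coeff p i * 0)) at_top"
    by (intro tendsto_intros tendsto_power_div_exp_0)
  then have lim: "((\<lambda>s. poly p s * exp (- s)) \<longlongrightarrow> 0) at_top"
    by (simp add: poly_altdef sum_distrib_right exp_minus divide_inverse mult.assoc)
  have "((\<lambda>t. poly p (inverse t) * exp (- inverse t)) \<longlongrightarrow> 0) (at_right 0)"
    using filterlim_compose[OF lim filterlim_inverse_at_top_right] .
  then have "(flat p \<longlongrightarrow> 0) (at_right 0)"
    by (rule filterlim_cong[THEN iffD2, OF refl refl, rotated])
       (auto simp: flat_def eventually_at_filter inverse_eq_divide)
  moreover have "(flat p \<longlongrightarrow> 0) (at_left 0)"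
    by (rule filterlim_cong[THEN iffD2, OF refl refl _ tendsto_const])
       (auto simp: flat_def eventually_at_filter)
  ultimately show ?thesis by (simp add: filterlim_split_at)
qed

text \<open>With \<open>s = 1 / t\<close> the derivative of \<open>p(s) * exp (- s)\<close> in
  \<open>t\<close> is \<open>s^2 * (p(s) - p'(s)) * exp (- s)\<close>, which explains the
  polynomial.\<close>

lemma flat_has_derivative:
  "(flat p has_real_derivative flat ([:0, 0, 1:] * (p - pderiv p)) t) (at t)"
proof -
  consider "t > 0" | "t < 0" | "t = 0" by linarith
  then show ?thesis
  proof cases
    case 1
    have "((\<lambda>t. poly p (1 / t) * exp (- (1 / t))) has_real_derivative flat ([:0, 0, 1:] * (p - pderiv p)) t) (at t)"
      using 1 by (auto intro!: derivative_eq_intros DERIV_chain2[OF poly_DERIV]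
          simp: flat_def field_simps power2_eq_square)
    then show ?thesis
      by (rule has_field_derivative_transform_within_open[where S="{0<..}"]) (use 1 in \<open>auto simp: flat_def\<close>)
  next
    case 2
    have "((\<lambda>t. 0) has_real_derivative flat ([:0, 0, 1:] * (p - pderiv p)) t) (at t)"
      using 2 by (simp add: flat_def)
    then show ?thesis
      by (rule has_field_derivative_transform_within_open[where S="{..<0}"]) (use 2 in \<open>auto simp: flat_def\<close>)
  next
    case 3
    \<comment> \<open>At the origin the difference quotient of \<open>flat p\<close> is itself a
      member of the family, with \<open>p\<close> multiplied by the variable.\<close>
    have "((\<lambda>h. flat ([:0, 1:] * p) h) \<longlongrightarrow> 0) (at 0)" by (rule flat_tendsto_0)
    then have "((\<lambda>h. (flat p (0 + h) - flat p 0) / h) \<longlongrightarrow> 0) (at 0)"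
      by (rule filterlim_cong[THEN iffD2, OF refl refl, rotated]) (auto simp: flat_def eventually_at_filter)
    then show ?thesis using 3 by (simp add: DERIV_def flat_def)
  qed
qed

lemma Ck_flat: "Ck n f \<Longrightarrow> Ck n (\<lambda>x. flat p (f x))"
  using Ck_compose[of "\<lambda>k. flat (((\<lambda>p. [:0, 0, 1:] * (p - pderiv p)) ^^ k) p)" n f 0]
    flat_has_derivative by simp

text \<open>The exponent \<open>1 / (m t)\<close> makes these bumps converge to the indicator of the box as \<open>m\<close> grows.\<close>

definition box_bump :: "nat \<Rightarrow> 'a::euclidean_space \<Rightarrow> 'a \<Rightarrow> 'a \<Rightarrow> real" where
  "box_bump m a c x = (\<Prod>i\<in>Basis. flat 1 (real m * (x \<bullet> i - a \<bullet> i)) * flat 1 (real m * (c \<bullet> i - x \<bullet> i)))"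

lemma flat_1_bounds: "0 \<le> flat 1 t" "flat 1 t \<le> 1" "flat 1 t > 0 \<longleftrightarrow> t > 0" "flat 1 t = 0 \<longleftrightarrow> t \<le> 0"
  by (auto simp: flat_def)

lemma flat_1_tendsto: "s > 0 \<Longrightarrow> (\<lambda>m. flat 1 (real m * s)) \<longlonglongrightarrow> 1"
proof -
  assume s: "s > 0"
  have "(\<lambda>m. exp (- ((1 / s) * (1 / real m)))) \<longlonglongrightarrow> exp (- ((1 / s) * 0))"
    by (intro tendsto_intros lim_1_over_n)
  moreover have "\<forall>\<^sub>F m in sequentially. exp (- ((1 / s) * (1 / real m))) = flat 1 (real m * s)"
    using eventually_gt_at_top[of 0] by eventually_elim (use s in \<open>auto simp: flat_def\<close>)
  ultimately show ?thesis by (simp add: filterlim_cong)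
qed

lemma box_bump_bounds: "0 \<le> box_bump m a c x" "box_bump m a c x \<le> 1"
  unfolding box_bump_def by (auto intro!: prod_nonneg prod_le_1 mult_nonneg_nonneg mult_le_one flat_1_bounds)

lemma box_bump_eq_0: "x \<notin> box a c \<Longrightarrow> box_bump m a c x = 0"
  unfolding box_bump_def by (auto simp: mem_box flat_1_bounds not_less mult_nonneg_nonpos intro!: bexI)

lemma box_bump_pos: "m > 0 \<Longrightarrow> x \<in> box a c \<Longrightarrow> 0 < box_bump m a c x"
  unfolding box_bump_def by (auto simp: mem_box flat_1_bounds intro!: prod_pos mult_pos_pos)

lemma box_bump_tendsto: "x \<in> box a c \<Longrightarrow> (\<lambda>m. box_bump m a c x) \<longlonglongrightarrow> 1"
proof -
  assume x: "x \<in> box a c"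
  have "(\<lambda>m. box_bump m a c x) \<longlonglongrightarrow> (\<Prod>i\<in>(Basis::'a set). 1 * 1)"
    unfolding box_bump_def by (intro tendsto_intros flat_1_tendsto) (use x in \<open>auto simp: mem_box\<close>)
  then show ?thesis by simp
qed

lemma Ck_box_bump: "Ck n (box_bump m a c)"
proof -
  have "Ck n (\<lambda>x. flat 1 (real m * (x \<bullet> i - a \<bullet> i)) * flat 1 (real m * (c \<bullet> i - x \<bullet> i)))" for i
    by (intro Ck_mult Ck_flat Ck_const Ck_diff Ck_inner_left)
  then show ?thesis unfolding box_bump_def[abs_def] by (intro Ck_prod)
qed

lemma box_bump_Cc_inf:
  assumes "cbox a c \<subseteq> \<Omega>"
  shows "box_bump m a c \<in> Cc_inf \<Omega>"
proof (rule Cc_infI[OF Ck_box_bump compact_cbox assms])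
  fix x assume "x \<notin> cbox a c"
  then have "x \<notin> box a c" using box_subset_cbox[of a c] by blast
  then show "box_bump m a c x = 0" by (rule box_bump_eq_0)
qed

text \<open>The first derivative of \<open>ln (cosh t)\<close> is \<open>tanh t\<close>, and
  \<open>tanh' = 1 - tanh^2\<close>, so every higher derivative is a polynomial in
  \<open>tanh t\<close>; \<open>[:1, 0, -1:]\<close> is the factor \<open>1 - x^2\<close> produced
  by the chain rule.\<close>

definition lncosh_derivs :: "nat \<Rightarrow> real \<Rightarrow> real" where
  "lncosh_derivs k t = (if k = 0 then ln (cosh t)
     else poly (((\<lambda>p. pderiv p * [:1, 0, -1:]) ^^ (k - 1)) [:0, 1:]) (tanh t))"

lemma lncosh_has_derivative: "(lncosh_derivs k has_real_derivative lncosh_derivs (Suc k) t) (at t)"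
proof (cases k)
  case 0
  have "((\<lambda>t. ln (cosh t)) has_real_derivative tanh t) (at t)"
    by (auto intro!: derivative_eq_intros simp: tanh_def)
  then show ?thesis using 0 by (simp add: lncosh_derivs_def[abs_def])
next
  case (Suc m)
  define p where "p = ((\<lambda>p. pderiv p * [:1, 0, -1:]) ^^ m) [:0, 1::real:]"
  have "((\<lambda>t. poly p (tanh t)) has_real_derivative poly (pderiv p) (tanh t) * (1 - (tanh t)\<^sup>2)) (at t)"
    by (auto intro!: derivative_eq_intros DERIV_chain2[OF poly_DERIV] simp: less_imp_neq[OF cosh_real_pos, symmetric])
  then show ?thesis unfolding lncosh_derivs_def Suc p_def by (simp add: power2_eq_square algebra_simps)
qed

text \<open>A smooth regularisation of the absolute value that vanishes at 0, so that supports do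
  not grow, and is 1-Lipschitz for \<open>\<epsilon> > 0\<close>, so that energies do not grow
  either.\<close>

definition smooth_abs :: "real \<Rightarrow> real \<Rightarrow> real" where
  "smooth_abs \<epsilon> t = \<epsilon> * ln (cosh (t / \<epsilon>))"

lemma smooth_abs_Cc_inf: "f \<in> Cc_inf \<Omega> \<Longrightarrow> (\<lambda>x. smooth_abs \<epsilon> (f x)) \<in> Cc_inf \<Omega>"
  using Cc_inf_scale[OF Cc_inf_compose[of lncosh_derivs, OF lncosh_has_derivative _ Cc_inf_scale[of f \<Omega> "1 / \<epsilon>"]], of \<epsilon>]
  by (simp add: smooth_abs_def lncosh_derivs_def)

text \<open>From \<open>exp \<bar>s\<bar> / 2 \<le> cosh s \<le> exp \<bar>s\<bar>\<close> the
  logarithm is off by at most \<open>ln 2\<close>, which is below 1.\<close>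

lemma smooth_abs_approx: "\<epsilon> > 0 \<Longrightarrow> \<bar>smooth_abs \<epsilon> t - \<bar>t\<bar>\<bar> \<le> \<epsilon>"
proof -
  assume e: "\<epsilon> > 0"
  define s where "s = t / \<epsilon>"
  have c: "cosh s = (exp \<bar>s\<bar> + exp (- \<bar>s\<bar>)) / 2" by (simp add: cosh_field_def abs_if)
  have "exp (- \<bar>s\<bar>) \<le> exp \<bar>s\<bar>" "exp (- \<bar>s\<bar>) > 0" by auto
  then have le: "cosh s \<le> exp \<bar>s\<bar>" and ge: "exp \<bar>s\<bar> / 2 \<le> cosh s" unfolding c by (simp_all add: field_simps)
  have "ln (cosh s) \<le> \<bar>s\<bar>" using ln_mono[OF le] by simp
  moreover have "ln (exp \<bar>s\<bar> / 2) \<le> ln (cosh s)" using ln_mono[OF ge] by simp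
  moreover have "ln (exp \<bar>s\<bar> / 2) = \<bar>s\<bar> - ln 2" by (simp add: ln_div)
  moreover have "ln 2 \<le> (1::real)" using ln_le_minus_one[of 2] by simp
  ultimately have "\<bar>ln (cosh s) - \<bar>s\<bar>\<bar> \<le> 1" by linarith
  then have "\<epsilon> * \<bar>ln (cosh s) - \<bar>s\<bar>\<bar> \<le> \<epsilon>" using e by (simp add: mult_le_cancel_left1)
  moreover have "\<epsilon> * \<bar>ln (cosh s) - \<bar>s\<bar>\<bar> = \<bar>smooth_abs \<epsilon> t - \<bar>t\<bar>\<bar>"
  proof -
    have "\<epsilon> * \<bar>s\<bar> = \<bar>t\<bar>" using e by (simp add: s_def)
    then have "smooth_abs \<epsilon> t - \<bar>t\<bar> = \<epsilon> * (ln (cosh s) - \<bar>s\<bar>)"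
      by (simp add: smooth_abs_def s_def right_diff_distrib)
    then show ?thesis using e by (simp add: abs_mult)
  qed
  ultimately show ?thesis by simp
qed

lemma smooth_abs_lipschitz: "\<epsilon> > 0 \<Longrightarrow> \<bar>smooth_abs \<epsilon> s - smooth_abs \<epsilon> t\<bar> \<le> \<bar>s - t\<bar>"
proof -
  assume e: "\<epsilon> > 0"
  have "(smooth_abs \<epsilon> has_real_derivative tanh (t / \<epsilon>)) (at t)" for t
    unfolding smooth_abs_def[abs_def] using e by (auto intro!: derivative_eq_intros simp: tanh_def)
  moreover have "norm (tanh (t / \<epsilon>)) \<le> 1" for t using tanh_real_bounds[of "t / \<epsilon>"] by auto
  ultimately show ?thesis using field_differentiable_bound[of UNIV "smooth_abs \<epsilon>" "\<lambda>t. tanh (t / \<epsilon>)" 1 s t] by simp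
qed

section \<open>Square integrable functions\<close>

lemma integrable_mult_of_squares:
  fixes f g :: "'a \<Rightarrow> real"
  assumes [measurable]: "f \<in> borel_measurable M" "g \<in> borel_measurable M"
    and "integrable M (\<lambda>x. (f x)\<^sup>2)" "integrable M (\<lambda>x. (g x)\<^sup>2)"
  shows "integrable M (\<lambda>x. f x * g x)"
proof (rule Bochner_Integration.integrable_bound)
  show "integrable M (\<lambda>x. (f x)\<^sup>2 + (g x)\<^sup>2)" using assms by simp
  have "\<bar>s * t\<bar> \<le> s\<^sup>2 + t\<^sup>2" for s t :: real
  proof -
    have "2 * (\<bar>s\<bar> * \<bar>t\<bar>) \<le> s\<^sup>2 + t\<^sup>2" using sum_squares_bound[of "\<bar>s\<bar>" "\<bar>t\<bar>"] by simp
    moreover have "0 \<le> \<bar>s\<bar> * \<bar>t\<bar>" by simp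
    ultimately show ?thesis unfolding abs_mult by linarith
  qed
  then show "AE x in M. norm (f x * g x) \<le> norm ((f x)\<^sup>2 + (g x)\<^sup>2)" by simp
qed simp

lemma integrable_square_add:
  fixes f g :: "'a \<Rightarrow> real"
  assumes "f \<in> borel_measurable M" "g \<in> borel_measurable M"
    and "integrable M (\<lambda>x. (f x)\<^sup>2)" "integrable M (\<lambda>x. (g x)\<^sup>2)"
  shows "integrable M (\<lambda>x. (f x + g x)\<^sup>2)"
proof -
  have "(\<lambda>x. (f x + g x)\<^sup>2) = (\<lambda>x. (f x)\<^sup>2 + (g x)\<^sup>2 + 2 * (f x * g x))"
    by (auto simp: power2_eq_square algebra_simps)
  then show ?thesis using assms integrable_mult_of_squares[OF assms] by simp
qed

lemma integrable_square_diff: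
  fixes f g :: "'a \<Rightarrow> real"
  assumes "f \<in> borel_measurable M" "g \<in> borel_measurable M"
    and "integrable M (\<lambda>x. (f x)\<^sup>2)" "integrable M (\<lambda>x. (g x)\<^sup>2)"
  shows "integrable M (\<lambda>x. (f x - g x)\<^sup>2)"
  using integrable_square_add[of f M "\<lambda>x. - g x"] assms by simp

lemma integral_square_add_le:
  fixes f g :: "'a \<Rightarrow> real"
  assumes "f \<in> borel_measurable M" "g \<in> borel_measurable M"
    and "integrable M (\<lambda>x. (f x)\<^sup>2)" "integrable M (\<lambda>x. (g x)\<^sup>2)"
  shows "(LINT x|M. (f x + g x)\<^sup>2) \<le> 2 * (LINT x|M. (f x)\<^sup>2) + 2 * (LINT x|M. (g x)\<^sup>2)"
proof -
  have "(s + t)\<^sup>2 \<le> 2 * s\<^sup>2 + 2 * t\<^sup>2" for s t :: real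
    using sum_squares_bound[of s t] by (simp add: power2_sum)
  then have "(LINT x|M. (f x + g x)\<^sup>2) \<le> (LINT x|M. 2 * (f x)\<^sup>2 + 2 * (g x)\<^sup>2)"
    using assms integrable_square_add[OF assms] by (intro integral_mono) auto
  then show ?thesis using assms by simp
qed

lemma Cc_inf_square_integrable:
  assumes "g \<in> Cc_inf \<Omega>"
  shows "integrable lborel (\<lambda>x. (g x)\<^sup>2)"
proof -
  obtain K where K: "compact K" "\<And>x. x \<notin> K \<Longrightarrow> g x = 0" using Cc_inf_support[OF assms] by blast
  obtain M where M: "M \<ge> 0" "\<And>x. \<bar>g x\<bar> \<le> M" using Cc_inf_bounded[OF assms] by blast
  have [measurable]: "g \<in> borel_measurable borel" by (rule Cc_inf_measurable[OF assms])
  show ?thesis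
  proof (rule Bochner_Integration.integrable_bound)
    have "K \<in> sets lborel" "emeasure lborel K < \<infinity>"
      using K(1) emeasure_compact_finite[of K] by (auto simp: compact_imp_closed)
    then show "integrable lborel (\<lambda>x. M\<^sup>2 * indicator K x :: real)" by simp
    have "(g x)\<^sup>2 \<le> M\<^sup>2 * indicator K x" for x
      using K(2)[of x] M power_mono[OF M(2)[of x], of 2] by (cases "x \<in> K") auto
    then show "AE x in lborel. norm ((g x)\<^sup>2) \<le> norm (M\<^sup>2 * indicator K x :: real)" by simp
  qed simp
qed

text \<open>Approximability as a predicate is stable under sums, multiples and limits, which is the
  shape that induction over measurable functions asks for.\<close>

definition L2_approx :: "'a::euclidean_space set \<Rightarrow> ('a \<Rightarrow> real) \<Rightarrow> bool" where
  "L2_approx \<Omega> f \<longleftrightarrow> f \<in> borel_measurable borel \<and> integrable lborel (\<lambda>x. (f x)\<^sup>2) \<and>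
     (\<forall>e>0. \<exists>g\<in>Cc_inf \<Omega>. (LINT x|lborel. (f x - g x)\<^sup>2) < e)"

lemma L2_approx_limit:
  assumes f [measurable]: "f \<in> borel_measurable borel" and f2: "integrable lborel (\<lambda>x. (f x)\<^sup>2)"
    and ap: "\<And>e. e > 0 \<Longrightarrow> \<exists>h. L2_approx \<Omega> h \<and> (LINT x|lborel. (f x - h x)\<^sup>2) < e"
  shows "L2_approx \<Omega> f"
  unfolding L2_approx_def
proof (intro conjI allI impI f f2)
  fix e :: real assume e: "e > 0"
  obtain h where h: "L2_approx \<Omega> h" "(LINT x|lborel. (f x - h x)\<^sup>2) < e / 4" using ap[of "e / 4"] e by auto
  obtain g where g: "g \<in> Cc_inf \<Omega>" "(LINT x|lborel. (h x - g x)\<^sup>2) < e / 4"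
    using h(1) e unfolding L2_approx_def by (meson zero_less_divide_iff zero_less_numeral)
  have m: "h \<in> borel_measurable borel" "g \<in> borel_measurable borel" "integrable lborel (\<lambda>x. (h x)\<^sup>2)"
      "integrable lborel (\<lambda>x. (g x)\<^sup>2)"
    using h g by (auto simp: L2_approx_def intro: Cc_inf_measurable Cc_inf_square_integrable)
  have "(LINT x|lborel. ((f x - h x) + (h x - g x))\<^sup>2)
      \<le> 2 * (LINT x|lborel. (f x - h x)\<^sup>2) + 2 * (LINT x|lborel. (h x - g x)\<^sup>2)"
    using m f2 by (intro integral_square_add_le integrable_square_diff) auto
  then show "\<exists>g\<in>Cc_inf \<Omega>. (LINT x|lborel. (f x - g x)\<^sup>2) < e"
    using h(2) g by (intro bexI[of _ g]) auto
qed

lemma L2_approx_Cc_inf: "g \<in> Cc_inf \<Omega> \<Longrightarrow> L2_approx \<Omega> g"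
  unfolding L2_approx_def
  by (auto intro!: Cc_inf_measurable Cc_inf_square_integrable bexI[of _ g])

lemma L2_approx_add:
  assumes "L2_approx \<Omega> f" "L2_approx \<Omega> g"
  shows "L2_approx \<Omega> (\<lambda>x. f x + g x)"
  unfolding L2_approx_def
proof (intro conjI allI impI)
  note a = assms[unfolded L2_approx_def]
  show "(\<lambda>x. f x + g x) \<in> borel_measurable borel" by (rule borel_measurable_add) (use a in auto)
  show "integrable lborel (\<lambda>x. (f x + g x)\<^sup>2)" using a by (intro integrable_square_add) auto
  fix e :: real assume e: "e > 0"
  then have e4: "e / 4 > 0" by simp
  obtain p where p: "p \<in> Cc_inf \<Omega>" "(LINT x|lborel. (f x - p x)\<^sup>2) < e / 4" using a e4 by blast
  obtain q where q: "q \<in> Cc_inf \<Omega>" "(LINT x|lborel. (g x - q x)\<^sup>2) < e / 4" using a e4 by blast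
  have m: "p \<in> borel_measurable borel" "q \<in> borel_measurable borel" "integrable lborel (\<lambda>x. (p x)\<^sup>2)"
      "integrable lborel (\<lambda>x. (q x)\<^sup>2)"
    using p q by (auto intro: Cc_inf_measurable Cc_inf_square_integrable)
  have "(LINT x|lborel. ((f x - p x) + (g x - q x))\<^sup>2)
      \<le> 2 * (LINT x|lborel. (f x - p x)\<^sup>2) + 2 * (LINT x|lborel. (g x - q x)\<^sup>2)"
    using m a by (intro integral_square_add_le integrable_square_diff) auto
  moreover have "(\<lambda>x. ((f x - p x) + (g x - q x))\<^sup>2) = (\<lambda>x. (f x + g x - (p x + q x))\<^sup>2)"
    by (simp add: algebra_simps)
  ultimately have "(LINT x|lborel. (f x + g x - (p x + q x))\<^sup>2) < e" using p q by simp
  then show "\<exists>h\<in>Cc_inf \<Omega>. (LINT x|lborel. (f x + g x - h x)\<^sup>2) < e"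
    by (intro bexI[OF _ Cc_inf_add[OF p(1) q(1)]])
qed

lemma L2_approx_scale:
  assumes "L2_approx \<Omega> f"
  shows "L2_approx \<Omega> (\<lambda>x. c * f x)"
  unfolding L2_approx_def
proof (intro conjI allI impI)
  note a = assms[unfolded L2_approx_def]
  show "(\<lambda>x. c * f x) \<in> borel_measurable borel" by (rule borel_measurable_times) (use a in auto)
  show "integrable lborel (\<lambda>x. (c * f x)\<^sup>2)" using a by (simp add: power_mult_distrib)
  fix e :: real assume e: "e > 0"
  then have "e / (c\<^sup>2 + 1) > 0" by (simp add: add_nonneg_pos)
  then obtain p where p: "p \<in> Cc_inf \<Omega>" "(LINT x|lborel. (f x - p x)\<^sup>2) < e / (c\<^sup>2 + 1)" using a by blast
  have "(LINT x|lborel. (c * f x - c * p x)\<^sup>2) = c\<^sup>2 * (LINT x|lborel. (f x - p x)\<^sup>2)"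
    by (simp add: right_diff_distrib[symmetric] power_mult_distrib)
  also have "\<dots> \<le> (c\<^sup>2 + 1) * (LINT x|lborel. (f x - p x)\<^sup>2)"
    by (intro mult_right_mono) (auto intro!: Bochner_Integration.integral_nonneg)
  also have "\<dots> < e"
    using p(2) pos_less_divide_eq[of "c\<^sup>2 + 1"] by (simp add: add_nonneg_pos mult.commute)
  finally show "\<exists>h\<in>Cc_inf \<Omega>. (LINT x|lborel. (c * f x - h x)\<^sup>2) < e"
    by (intro bexI[OF _ Cc_inf_scale[OF p(1)]])
qed

lemma L2_approx_dominated:
  fixes f :: "'a::euclidean_space \<Rightarrow> real"
  assumes f [measurable]: "f \<in> borel_measurable borel" and w: "integrable lborel w"
    and h: "\<And>n. L2_approx \<Omega> (h n)" and b: "\<And>n x. (f x - h n x)\<^sup>2 \<le> w x"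
    and f2: "integrable lborel (\<lambda>x. (f x)\<^sup>2)"
    and lim: "\<And>x. (\<lambda>n. h n x) \<longlonglongrightarrow> f x"
  shows "L2_approx \<Omega> f"
proof (rule L2_approx_limit[OF f f2])
  fix e :: real assume e: "e > 0"
  have [measurable]: "h n \<in> borel_measurable borel" for n using h by (simp add: L2_approx_def)
  have "(\<lambda>n. LINT x|lborel. (f x - h n x)\<^sup>2) \<longlonglongrightarrow> (LINT x|(lborel :: 'a measure). 0::real)"
  proof (rule Bochner_Integration.integral_dominated_convergence[where w=w])
    have "(\<lambda>n. (f x - h n x)\<^sup>2) \<longlonglongrightarrow> (f x - f x)\<^sup>2" for x by (intro tendsto_intros lim)
    then show "AE x in lborel. (\<lambda>n. (f x - h n x)\<^sup>2) \<longlonglongrightarrow> 0" by simp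
  qed (use b w in auto)
  then have "\<forall>\<^sub>F n in sequentially. (LINT x|lborel. (f x - h n x)\<^sup>2) < e"
    using e by (simp add: order_tendstoD(2))
  then obtain n where "(LINT x|lborel. (f x - h n x)\<^sup>2) < e" by (auto simp: eventually_sequentially)
  then show "\<exists>h. L2_approx \<Omega> h \<and> (LINT x|lborel. (f x - h x)\<^sup>2) < e" using h by blast
qed

lemma indicator_square: "(\<lambda>x. (indicat_real B x)\<^sup>2) = indicat_real B"
  by (auto simp: indicator_def)

text \<open>An open set is a countable union of boxes with closure inside it. If \<open>B i\<close>
  are bumps on these boxes, then 1 minus the product of \<open>1 - B i\<close> over finitely many
  boxes is a smooth replacement for the indicator of their union.\<close>

lemma L2_approx_open:
  fixes U \<Omega> :: "'a::euclidean_space set"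
  assumes U: "open U" "U \<subseteq> \<Omega>" "bounded \<Omega>"
  shows "L2_approx \<Omega> (indicator U)"
proof (cases "U = {}")
  case True
  have "indicator U = (\<lambda>x. 0::real)" using True by auto
  then show ?thesis using L2_approx_Cc_inf[OF Cc_inf_zero] by simp
next
  case False
  define F where "F = {box a c | a c. cbox a c \<subseteq> U}"
  obtain F' where F': "F' \<subseteq> F" "countable F'" "\<Union>F' = \<Union>F"
    by (rule Lindelof[of F]) (auto simp: F_def)
  have UF: "\<Union>F = U"
  proof
    show "U \<subseteq> \<Union>F"
    proof
      fix x assume "x \<in> U"
      then obtain a c where "cbox a c \<subseteq> U" "x \<in> box a c"
        using open_contains_cbox[OF U(1)] by metis
      then show "x \<in> \<Union>F" unfolding F_def by blast
    qed
    show "\<Union>F \<subseteq> U" unfolding F_def using box_subset_cbox by blast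
  qed
  then have ne: "F' \<noteq> {}" using F' False by auto
  define B where "B = from_nat_into F'"
  have BF: "B n \<in> F" for n using from_nat_into[OF ne, of n] F'(1) by (auto simp: B_def)
  then have "\<exists>a c. B n = box a c \<and> cbox a c \<subseteq> U" for n unfolding F_def by blast
  then obtain a c where ac: "\<And>n. B n = box (a n) (c n)" "\<And>n. cbox (a n) (c n) \<subseteq> U" by metis
  have cover: "\<exists>i. x \<in> box (a i) (c i)" if "x \<in> U" for x
  proof -
    have "x \<in> \<Union>F'" using that UF F'(3) by simp
    then obtain X where "X \<in> F'" "x \<in> X" by (rule UnionE)
    then have "X \<in> range B" using range_from_nat_into[OF ne F'(2)] unfolding B_def by simp
    then obtain i where "X = B i" by (rule rangeE)
    then show ?thesis using \<open>x \<in> X\<close> ac by auto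
  qed
  have smooth: "(\<lambda>x. 1 - (\<Prod>i<n. 1 - box_bump m (a i) (c i) x)) \<in> Cc_inf \<Omega>" for m n
  proof (induction n)
    case 0 then show ?case by (simp add: Cc_inf_zero)
  next
    case (Suc n)
    define p where "p x = 1 - (\<Prod>i<n. 1 - box_bump m (a i) (c i) x)" for x
    \<comment> \<open>In this form each summand has compact support, although the factor
      \<open>1 - p\<close> has not.\<close>
    have eq: "(\<lambda>x. 1 - (\<Prod>i<Suc n. 1 - box_bump m (a i) (c i) x))
        = (\<lambda>x. p x + box_bump m (a n) (c n) x * (1 - p x))"
      by (auto simp: p_def algebra_simps)
    have p: "p \<in> Cc_inf \<Omega>" using Suc by (simp add: p_def[abs_def])
    have "cbox (a n) (c n) \<subseteq> \<Omega>" using ac(2) U(2) by blast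
    then show ?case unfolding eq
      by (intro Cc_inf_add p Cc_inf_mult box_bump_Cc_inf Ck_diff Ck_const Cc_inf_Ck[OF p])
  qed
  \<comment> \<open>One index drives both limits: more boxes are used and the bumps become steeper
    at the same time.\<close>
  define h where "h n x = 1 - (\<Prod>i<n. 1 - box_bump n (a i) (c i) x)" for n x
  have zero: "h n x = 0" if "x \<notin> U" for n x
  proof -
    have "box_bump n (a i) (c i) x = 0" for i
      using that ac(2)[of i] box_subset_cbox[of "a i" "c i"] by (intro box_bump_eq_0) blast
    then show ?thesis by (simp add: h_def)
  qed
  have pr: "0 \<le> (\<Prod>i<n. 1 - box_bump m (a i) (c i) x)" "(\<Prod>i<n. 1 - box_bump m (a i) (c i) x) \<le> 1" for m n x
    using box_bump_bounds by (auto intro!: prod_nonneg prod_le_1)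
  have lim: "(\<lambda>n. h n x) \<longlonglongrightarrow> indicator U x" for x
  proof (cases "x \<in> U")
    case True
    obtain i where i: "x \<in> box (a i) (c i)" using cover[OF True] by blast
    have "(\<lambda>n. h n x) \<longlonglongrightarrow> 1"
    proof (rule tendsto_sandwich[OF _ _ box_bump_tendsto[OF i] tendsto_const])
      show "\<forall>\<^sub>F n in sequentially. box_bump n (a i) (c i) x \<le> h n x"
        using eventually_gt_at_top[of i]
      proof eventually_elim
        case (elim n)
        have "(\<Prod>j<n. 1 - box_bump n (a j) (c j) x)
            = (1 - box_bump n (a i) (c i) x) * (\<Prod>j\<in>{..<n} - {i}. 1 - box_bump n (a j) (c j) x)"
          using elim by (subst prod.remove[of _ i]) auto
        also have "\<dots> \<le> (1 - box_bump n (a i) (c i) x) * 1"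
          using box_bump_bounds by (intro mult_left_mono prod_le_1) auto
        finally show ?case by (simp add: h_def)
      qed
      show "\<forall>\<^sub>F n in sequentially. h n x \<le> 1" using pr by (auto simp: h_def)
    qed
    then show ?thesis using True by simp
  qed (simp add: zero)
  have Um: "U \<in> sets lborel" "emeasure lborel U < \<infinity>"
    using U emeasure_bounded_finite[of U] bounded_subset by auto
  show ?thesis
  proof (rule L2_approx_dominated[where h=h and w="indicator U"])
    show "L2_approx \<Omega> (h n)" for n unfolding h_def using smooth by (intro L2_approx_Cc_inf)
    show "(indicator U x - h n x)\<^sup>2 \<le> indicat_real U x" for n x
    proof (cases "x \<in> U")
      case True
      have "0 \<le> 1 - h n x" "1 - h n x \<le> 1" using pr by (auto simp: h_def)
      then show ?thesis using True by (simp add: power_le_one)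
    qed (simp add: zero)
    show "integrable lborel (\<lambda>x. (indicat_real U x)\<^sup>2)"
      using Um by (simp add: indicator_square)
  qed (use Um lim in auto)
qed

text \<open>Outer regularity gives an open superset of small excess; cutting it with
  \<open>\<Omega>\<close> keeps it admissible without enlarging the excess.\<close>

lemma L2_approx_set:
  fixes A \<Omega> :: "'a::euclidean_space set"
  assumes \<Omega>: "open \<Omega>" "bounded \<Omega>" and A: "A \<in> sets borel" "A \<subseteq> \<Omega>"
  shows "L2_approx \<Omega> (indicator A)"
proof (rule L2_approx_limit)
  have fin: "emeasure lborel A < \<infinity>" using emeasure_bounded_finite[of A] \<Omega> A bounded_subset by blast
  show "integrable lborel (\<lambda>x. (indicat_real A x)\<^sup>2)" using fin A by (simp add: indicator_square)
  show "indicat_real A \<in> borel_measurable borel" using A by simp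
  fix e :: real assume e: "e > 0"
  obtain U where U: "open U" "A \<subseteq> U" "emeasure lborel (U - A) < ennreal e"
    using outer_regular_lborel[OF A(1) e] by auto
  define V where "V = U \<inter> \<Omega>"
  have V: "open V" "A \<subseteq> V" "V \<subseteq> \<Omega>" using U \<Omega> A by (auto simp: V_def)
  have "emeasure lborel (V - A) \<le> emeasure lborel (U - A)"
    using U A by (intro emeasure_mono) (auto simp: V_def)
  then have "emeasure lborel (V - A) < ennreal e" using U(3) by simp
  then have m: "measure lborel (V - A) < e"
    using enn2real_less_iff[OF order.strict_trans[OF _ ennreal_less_top]] unfolding measure_def by blast
  have "(\<lambda>x. (indicat_real A x - indicat_real V x)\<^sup>2) = indicat_real (V - A)"
    using V by (intro ext) (auto simp: indicator_def)
  then have "(LINT x|lborel. (indicat_real A x - indicat_real V x)\<^sup>2) < e" using m by simp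
  then show "\<exists>h. L2_approx \<Omega> h \<and> (LINT x|lborel. (indicat_real A x - h x)\<^sup>2) < e"
    using L2_approx_open[OF V(1,3) \<Omega>(2)] by blast
qed

lemma L2_approx_AE_cong:
  assumes "L2_approx \<Omega> f" "g \<in> borel_measurable borel" "AE x in lborel. f x = g x"
  shows "L2_approx \<Omega> g"
proof -
  note a = assms(1)[unfolded L2_approx_def]
  have [measurable]: "f \<in> borel_measurable borel" "g \<in> borel_measurable borel" using a assms by auto
  have "integrable lborel (\<lambda>x. (g x)\<^sup>2)"
    using a assms(3) by (subst integrable_cong_AE[where g="\<lambda>x. (f x)\<^sup>2"]) auto
  moreover have "(LINT x|lborel. (g x - h x)\<^sup>2) = (LINT x|lborel. (f x - h x)\<^sup>2)" if "h \<in> Cc_inf \<Omega>" for h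
    using assms(3) Cc_inf_measurable[OF that] by (intro integral_cong_AE) auto
  ultimately show ?thesis using a assms(2) unfolding L2_approx_def by auto
qed

text \<open>Monotone class induction for nonnegative functions. Membership in \<open>L2_on\<close>
  is a premise inside the induction claim: the pieces of a nonnegative function lie below it, so
  they inherit integrability and vanishing outside \<open>\<Omega>\<close>. Signed functions are
  split into positive and negative parts.\<close>

theorem Cc_inf_dense_L2:
  fixes \<Omega> :: "'a::euclidean_space set"
  assumes \<Omega>: "open \<Omega>" "bounded \<Omega>" and f: "f \<in> L2_on \<Omega>"
  shows "L2_approx \<Omega> f"
proof -
  have pos: "u \<in> L2_on \<Omega> \<longrightarrow> L2_approx \<Omega> u" if "u \<in> borel_measurable borel" "\<And>x. 0 \<le> u x" for u
    using that
  proof (induction rule: borel_measurable_induct_real)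
    case (set A)
    show ?case
    proof
      assume "indicat_real A \<in> L2_on \<Omega>"
      then have ae: "AE x in lborel. x \<notin> \<Omega> \<longrightarrow> indicat_real A x = 0" by (simp add: L2_on_def)
      have "L2_approx \<Omega> (indicator (A \<inter> \<Omega>))" using set \<Omega> by (intro L2_approx_set) auto
      then show "L2_approx \<Omega> (indicat_real A)"
      proof (rule L2_approx_AE_cong)
        show "AE x in lborel. indicat_real (A \<inter> \<Omega>) x = indicat_real A x"
          using ae by eventually_elim (auto simp: indicator_def)
      qed (use set in simp)
    qed
  next
    case (mult u c)
    show ?case
    proof (cases "c = 0")
      case True
      then show ?thesis using L2_approx_Cc_inf[OF Cc_inf_zero[of \<Omega>]] by simp
    next
      case False
      then have "(\<lambda>x. c * u x) \<in> L2_on \<Omega> \<longrightarrow> u \<in> L2_on \<Omega>"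
        using mult by (auto simp: L2_on_def power_mult_distrib)
      then show ?thesis using mult L2_approx_scale by blast
    qed
  next
    case (add u v)
    show ?case
    proof
      assume L: "(\<lambda>x. v x + u x) \<in> L2_on \<Omega>"
      have le: "(v x)\<^sup>2 \<le> (v x + u x)\<^sup>2" "(u x)\<^sup>2 \<le> (v x + u x)\<^sup>2" for x
        using add.hyps(2,4) by (auto intro!: power_mono)
      have i: "integrable lborel (\<lambda>x. (v x + u x)\<^sup>2)" and ae: "AE x in lborel. x \<notin> \<Omega> \<longrightarrow> v x + u x = 0"
        using L by (auto simp: L2_on_def)
      have "integrable lborel (\<lambda>x. (v x)\<^sup>2)" "integrable lborel (\<lambda>x. (u x)\<^sup>2)"
        using add.hyps(1,3) le by (auto intro!: Bochner_Integration.integrable_bound[OF i])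
      moreover have "AE x in lborel. x \<notin> \<Omega> \<longrightarrow> v x = 0" "AE x in lborel. x \<notin> \<Omega> \<longrightarrow> u x = 0"
        using ae add.hyps(2,4) by (auto elim!: eventually_mono simp: add_nonneg_eq_0_iff)
      ultimately have "v \<in> L2_on \<Omega>" "u \<in> L2_on \<Omega>" using add.hyps(1,3) by (auto simp: L2_on_def)
      then show "L2_approx \<Omega> (\<lambda>x. v x + u x)" using add L2_approx_add by blast
    qed
  next
    case (seq U)
    show ?case
    proof
      assume L: "u \<in> L2_on \<Omega>"
      have le: "U i x \<le> u x" for i x
        using seq.hyps(3,4) by (intro incseq_le) (auto simp: incseq_def le_fun_def)
      have i: "integrable lborel (\<lambda>x. (u x)\<^sup>2)" and ae: "AE x in lborel. x \<notin> \<Omega> \<longrightarrow> u x = 0"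
        and [measurable]: "u \<in> borel_measurable borel"
        using L by (auto simp: L2_on_def)
      have "U i \<in> L2_on \<Omega>" for i
      proof -
        have "integrable lborel (\<lambda>x. (U i x)\<^sup>2)"
          using seq.hyps(1,2) le by (intro Bochner_Integration.integrable_bound[OF i]) (auto intro!: power_mono)
        moreover have "AE x in lborel. x \<notin> \<Omega> \<longrightarrow> U i x = 0"
          using ae
        proof eventually_elim
          case (elim x)
          then show ?case using le[of i x] seq.hyps(2)[of i x] by auto
        qed
        ultimately show ?thesis using seq.hyps(1) by (auto simp: L2_on_def)
      qed
      then have "L2_approx \<Omega> (U i)" for i using seq.IH by blast
      then show "L2_approx \<Omega> u"
      proof (rule L2_approx_dominated[where w="\<lambda>x. (u x)\<^sup>2", rotated 2])
        show "(u x - U n x)\<^sup>2 \<le> (u x)\<^sup>2" for n x using le[of n x] seq.hyps(2)[of n x] by (intro power_mono) auto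
      qed (use seq.hyps(4) i in auto)
    qed
  qed
  have [measurable]: "f \<in> borel_measurable borel" and i: "integrable lborel (\<lambda>x. (f x)\<^sup>2)"
    and ae: "AE x in lborel. x \<notin> \<Omega> \<longrightarrow> f x = 0" using f by (auto simp: L2_on_def)
  have "(\<lambda>x. max (s * f x) 0) \<in> L2_on \<Omega>" if "\<bar>s\<bar> = 1" for s
  proof -
    have "(max (s * t) 0)\<^sup>2 \<le> t\<^sup>2" for t :: real
      using that by (auto simp: max_def power_mult_distrib abs_if split: if_splits)
    then have "integrable lborel (\<lambda>x. (max (s * f x) 0)\<^sup>2)"
      by (intro Bochner_Integration.integrable_bound[OF i]) auto
    moreover have "AE x in lborel. x \<notin> \<Omega> \<longrightarrow> max (s * f x) 0 = 0" using ae by eventually_elim auto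
    ultimately show ?thesis by (simp add: L2_on_def)
  qed
  from this[of 1] this[of "-1"] have "L2_approx \<Omega> (\<lambda>x. max (f x) 0)" "L2_approx \<Omega> (\<lambda>x. max (- f x) 0)"
    using pos[of "\<lambda>x. max (f x) 0"] pos[of "\<lambda>x. max (- f x) 0"] by auto
  then have "L2_approx \<Omega> (\<lambda>x. max (f x) 0 + (-1) * max (- f x) 0)"
    by (intro L2_approx_add L2_approx_scale)
  moreover have "(\<lambda>x. max (f x) 0 + (-1) * max (- f x) 0) = f" by (auto simp: max_def)
  ultimately show ?thesis by simp
qed

text \<open>A box in \<open>\<Omega>\<close> is cut into infinitely many slabs along one coordinate,
  and each slab carries a bump. Functions with disjoint supports are orthogonal, which is how
  infinite dimension is certified.\<close>

lemma disjoint_test_functions: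
  fixes \<Omega> :: "'a::euclidean_space set"
  assumes "open \<Omega>" "\<Omega> \<noteq> {}"
  shows "\<exists>f::nat \<Rightarrow> 'a \<Rightarrow> real. (\<forall>i. f i \<in> Cc_inf \<Omega>) \<and> (\<forall>i j x. i \<noteq> j \<longrightarrow> f i x * f j x = 0) \<and>
     (\<forall>i. (LINT x|lborel. (f i x)\<^sup>2) > 0)"
proof -
  obtain x0 where "x0 \<in> \<Omega>" using assms by blast
  then obtain a c where ac: "cbox a c \<subseteq> \<Omega>" "\<forall>i\<in>Basis. a \<bullet> i < c \<bullet> i"
    using open_contains_cbox[OF assms(1)] by metis
  obtain k :: 'a where k: "k \<in> Basis" using nonempty_Basis by blast
  define d where "d = c \<bullet> k - a \<bullet> k"
  have d: "d > 0" using ac k by (simp add: d_def)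
  \<comment> \<open>Cutting heights that decrease from the top face towards the bottom one; slab
    \<open>i\<close> lies between \<open>\<alpha> (Suc i)\<close> and
    \<open>\<alpha> i\<close>.\<close>
  define \<alpha> where "\<alpha> i = a \<bullet> k + d / (real i + 1)" for i
  have \<alpha>: "a \<bullet> k < \<alpha> i" "\<alpha> i \<le> c \<bullet> k" for i
  proof -
    show "a \<bullet> k < \<alpha> i" using d by (simp add: \<alpha>_def)
    have "d / (real i + 1) \<le> d / 1" using d by (intro divide_left_mono) auto
    then show "\<alpha> i \<le> c \<bullet> k" by (simp add: \<alpha>_def d_def)
  qed
  have \<alpha>_anti: "\<alpha> j \<le> \<alpha> i" if "i \<le> j" for i j
    using that d by (auto simp: \<alpha>_def intro!: divide_left_mono)
  have \<alpha>_Suc: "\<alpha> (Suc i) < \<alpha> i" for i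
    using d by (auto simp: \<alpha>_def intro!: divide_strict_left_mono)
  define l where "l i = a + (\<alpha> (Suc i) - a \<bullet> k) *\<^sub>R k" for i
  define r where "r i = c + (\<alpha> i - c \<bullet> k) *\<^sub>R k" for i
  have l: "l i \<bullet> b = (if b = k then \<alpha> (Suc i) else a \<bullet> b)" if "b \<in> Basis" for i b
    using that k by (auto simp: l_def inner_add_left inner_Basis)
  have r: "r i \<bullet> b = (if b = k then \<alpha> i else c \<bullet> b)" if "b \<in> Basis" for i b
    using that k by (auto simp: r_def inner_add_left inner_Basis)
  have sub: "cbox (l i) (r i) \<subseteq> cbox a c" for i
    using \<alpha> less_imp_le[OF \<alpha>(1)] by (intro subset_box_imp) (auto simp: l r)
  have lr: "\<forall>b\<in>Basis. l i \<bullet> b < r i \<bullet> b" for i using ac(2) \<alpha>_Suc by (auto simp: l r)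
  define f where "f i = box_bump 1 (l i) (r i)" for i
  have C: "f i \<in> Cc_inf \<Omega>" for i
    unfolding f_def using sub ac(1) by (intro box_bump_Cc_inf) blast
  have disj: "f i x * f j x = 0" if "i < j" for i j x
  proof (rule ccontr)
    assume "f i x * f j x \<noteq> 0"
    then have "x \<in> box (l i) (r i)" "x \<in> box (l j) (r j)"
      using box_bump_eq_0[of x "l i" "r i" 1] box_bump_eq_0[of x "l j" "r j" 1] by (auto simp: f_def)
    then have "\<alpha> (Suc i) < x \<bullet> k" "x \<bullet> k < \<alpha> j" using k by (auto simp: mem_box l r)
    then show False using \<alpha>_anti[of "Suc i" j] that by simp
  qed
  have disj': "f i x * f j x = 0" if "i \<noteq> j" for i j x
    using disj[of i j x] disj[of j i x] that by (cases "i < j") (auto simp: mult.commute)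
  have "(LINT x|lborel. (f i x)\<^sup>2) > 0" for i
  proof (rule ccontr)
    assume "\<not> ?thesis"
    moreover have "(LINT x|lborel. (f i x)\<^sup>2) \<ge> 0" by (intro Bochner_Integration.integral_nonneg) auto
    ultimately have "(LINT x|lborel. (f i x)\<^sup>2) = 0" by linarith
    then have "AE x in lborel. (f i x)\<^sup>2 = 0"
      using integral_nonneg_eq_0_iff_AE[OF Cc_inf_square_integrable[OF C]] by auto
    then have "AE x in lborel. x \<notin> box (l i) (r i)"
    proof eventually_elim
      case (elim x)
      then show ?case using box_bump_pos[of 1 x "l i" "r i"] by (auto simp: f_def)
    qed
    then have "emeasure lborel (box (l i) (r i)) = 0" by (simp add: AE_iff_measurable[OF _ refl])
    moreover have "emeasure lborel (box (l i) (r i)) > 0"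
      using lr[of i] by (simp add: emeasure_lborel_box_eq less_imp_le prod_pos inner_diff_left)
    ultimately show False by simp
  qed
  then show ?thesis using C disj' by blast
qed

section \<open>The kernel\<close>

lemma gamma_integrand_integrable:
  assumes "\<nu> > 0"
  shows "set_integrable lborel {0<..} (\<lambda>t::real. t powr (\<nu> - 1) * exp (- t))"
proof -
  have "((\<lambda>t. t powr (\<nu> - 1) / exp t) has_integral Gamma \<nu>) {0..}"
    by (rule Gamma_integral_real[OF assms])
  hence "(\<lambda>t. t powr (\<nu> - 1) / exp t) absolutely_integrable_on {0..}"
    by (intro nonnegative_absolutely_integrable_1) (auto simp: has_integral_iff)
  hence "(\<lambda>t. t powr (\<nu> - 1) / exp t) absolutely_integrable_on {0<..}"
    by (rule set_integrable_subset) auto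
  hence "set_integrable lborel {0<..} (\<lambda>t. t powr (\<nu> - 1) / exp t)"
    unfolding set_integrable_def by (subst (asm) integrable_completion) auto
  then show ?thesis by (simp add: exp_minus divide_inverse)
qed

lemma log_omega_integrable:
  assumes "n > 0"
  shows "set_integrable lborel {0<..} (\<lambda>t. t powr (- 1 + real n / 2) * exp (- t - r\<^sup>2 / (4 * t)))"
proof (rule set_integrable_bound[OF gamma_integrand_integrable[of "real n / 2"]])
  show "AE t in lborel. t \<in> {0<..} \<longrightarrow> norm (t powr (- 1 + real n / 2) * exp (- t - r\<^sup>2 / (4 * t)))
      \<le> norm (t powr (real n / 2 - 1) * exp (- t))"
    by (auto intro!: AE_I2 mult_left_mono simp: add.commute)
qed (use assms in \<open>auto simp: set_borel_measurable_def\<close>)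

lemma log_omega_pos:
  assumes "n > 0"
  shows "log_omega n r > 0"
proof (rule ccontr)
  let ?f = "\<lambda>t. indicator {0<..} t *\<^sub>R (t powr (- 1 + real n / 2) * exp (- t - r\<^sup>2 / (4 * t)))"
  assume "\<not> log_omega n r > 0"
  moreover have "0 \<le> integral\<^sup>L lborel ?f" by (intro Bochner_Integration.integral_nonneg) auto
  moreover have "log_omega n r = integral\<^sup>L lborel ?f"
    by (simp add: log_omega_def set_lebesgue_integral_def)
  ultimately have "integral\<^sup>L lborel ?f = 0" by linarith
  then have "AE t in lborel. ?f t = 0"
    using log_omega_integrable[OF assms, of r] unfolding set_integrable_def
    by (subst (asm) integral_nonneg_eq_0_iff_AE) auto
  then have "AE t in lborel. t \<notin> {0<..<1::real}"
    by eventually_elim (auto simp: indicator_def split: if_splits)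
  then have "emeasure lborel {0<..<1::real} = 0"
    by (intro null_setsD1 AE_iff_null_sets[THEN iffD2]) auto
  then show False by simp
qed

lemma log_omega_antimono:
  assumes "n > 0" "0 \<le> r" "r \<le> s"
  shows "log_omega n s \<le> log_omega n r"
  unfolding log_omega_def
proof (rule set_integral_mono[OF log_omega_integrable[OF assms(1)] log_omega_integrable[OF assms(1)]])
  fix t :: real assume "t \<in> {0<..}"
  moreover have "r\<^sup>2 \<le> s\<^sup>2" using assms by (intro power_mono) auto
  ultimately show "t powr (- 1 + real n / 2) * exp (- t - s\<^sup>2 / (4 * t)) \<le> t powr (- 1 + real n / 2) * exp (- t - r\<^sup>2 / (4 * t))"
    by (intro mult_left_mono) (auto simp: divide_right_mono)
qed

text \<open>The bound \<open>exp (- x) \<le> 1 / x\<close> at \<open>x = r^2 / (4 t)\<close> trades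
  the Gaussian factor for \<open>4 t / r^2\<close>, which leaves a Gamma integral of the next order.
  The true decay is exponential; this power is enough to sum over dyadic shells.\<close>

lemma log_omega_decay:
  assumes "n > 0"
  shows "\<exists>C\<ge>0. \<forall>r>0. log_omega n r \<le> C / r\<^sup>2"
proof -
  define C where "C = 4 * (LINT t:{0<..}|lborel. t powr (real n / 2) * exp (- t))"
  have int: "set_integrable lborel {0<..} (\<lambda>t. t powr (real n / 2) * exp (- t))"
    using gamma_integrand_integrable[of "real n / 2 + 1"] by simp
  have "log_omega n r \<le> C / r\<^sup>2" if r: "r > 0" for r
  proof -
    have "log_omega n r \<le> (LINT t:{0<..}|lborel. (4 / r\<^sup>2) * (t powr (real n / 2) * exp (- t)))"
      unfolding log_omega_def
    proof (rule set_integral_mono[OF log_omega_integrable[OF assms(1)]])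
      show "set_integrable lborel {0<..} (\<lambda>t. (4 / r\<^sup>2) * (t powr (real n / 2) * exp (- t)))"
        using int by simp
      fix t :: real assume t: "t \<in> {0<..}"
      define x where "x = r\<^sup>2 / (4 * t)"
      have x: "x > 0" using r t by (simp add: x_def)
      have "x \<le> exp x" using exp_ge_add_one_self[of x] by linarith
      then have ex': "exp (- x) \<le> 1 / x" using x by (simp add: exp_minus field_simps)
      have ex: "exp (- t - r\<^sup>2 / (4 * t)) = exp (- t) * exp (- x)"
        unfolding exp_add[symmetric] x_def by simp
      have "t powr (- 1 + real n / 2) * (exp (- t) * exp (- x)) \<le> t powr (- 1 + real n / 2) * (exp (- t) * (1 / x))"
        using ex' by (intro mult_left_mono) auto
      also have "\<dots> = (4 / r\<^sup>2) * ((t * t powr (- 1 + real n / 2)) * exp (- t))"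
        using t r by (simp add: x_def field_simps)
      also have "t * t powr (- 1 + real n / 2) = t powr (real n / 2)"
        using t by (simp add: powr_mult_base)
      finally show "t powr (- 1 + real n / 2) * exp (- t - r\<^sup>2 / (4 * t)) \<le> (4 / r\<^sup>2) * (t powr (real n / 2) * exp (- t))"
        unfolding ex .
    qed
    also have "\<dots> = C / r\<^sup>2" by (simp add: C_def)
    finally show ?thesis .
  qed
  moreover have "C \<ge> 0" unfolding C_def set_lebesgue_integral_def
    by (intro mult_nonneg_nonneg Bochner_Integration.integral_nonneg) auto
  ultimately show ?thesis by blast
qed

lemma log_omega_measurable [measurable]: "log_omega n \<in> borel_measurable borel"
  unfolding log_omega_def[abs_def] set_lebesgue_integral_def
  by (rule lborel.borel_measurable_lebesgue_integral) measurable

lemma log_kernel_measurable [measurable]: "log_kernel \<in> borel_measurable borel"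
  unfolding log_kernel_def[abs_def] by measurable

lemma log_kernel_pos: "z \<noteq> 0 \<Longrightarrow> log_kernel z > 0"
  by (auto simp: log_kernel_def intro!: mult_pos_pos log_omega_pos)

lemma log_kernel_nonneg [simp]: "0 \<le> log_kernel z"
  by (auto simp: log_kernel_def intro!: mult_nonneg_nonneg less_imp_le[OF log_omega_pos])

lemma log_kernel_minus: "log_kernel (x - y) = log_kernel (y - x)"
  by (simp add: log_kernel_def norm_minus_commute)

text \<open>\<open>log_omega\<close> is decreasing, so its value at \<open>R\<close> bounds it from
  below on the ball. Poincare's inequality uses this away from the diagonal, the dyadic estimate
  near it.\<close>

lemma log_kernel_lower:
  assumes "R > 0"
  shows "\<exists>c>0. \<forall>z::'a::euclidean_space. z \<noteq> 0 \<longrightarrow> norm z \<le> R \<longrightarrow> c * norm z powr (- real DIM('a)) \<le> log_kernel z"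
proof (intro exI conjI allI impI)
  let ?c = "pi powr (- real DIM('a) / 2) * log_omega DIM('a) R"
  show "?c > 0" by (auto intro!: mult_pos_pos log_omega_pos)
  fix z :: 'a assume "z \<noteq> 0" "norm z \<le> R"
  then have "log_omega DIM('a) R \<le> log_omega DIM('a) (norm z)" by (intro log_omega_antimono) auto
  then have "pi powr (- real DIM('a) / 2) * norm z powr (- real DIM('a)) * log_omega DIM('a) R \<le> log_kernel z"
    unfolding log_kernel_def by (intro mult_left_mono) auto
  then show "?c * norm z powr (- real DIM('a)) \<le> log_kernel z" by (simp add: mult_ac)
qed

text \<open>The first bound serves near the origin and the second at infinity; one constant covers
  both.\<close>

lemma log_kernel_upper:
  "\<exists>C\<ge>0. \<forall>z::'a::euclidean_space. log_kernel z \<le> C * norm z powr (- real DIM('a)) \<and>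
     log_kernel z \<le> C * norm z powr (- real DIM('a)) / (norm z)\<^sup>2"
proof -
  obtain D where D: "D \<ge> 0" "\<And>r. r > 0 \<Longrightarrow> log_omega DIM('a) r \<le> D / r\<^sup>2"
    using log_omega_decay[of "DIM('a)"] by auto
  define P where "P = pi powr (- real DIM('a) / 2)"
  define E where "E = max D (log_omega DIM('a) 0)"
  have P: "P > 0" by (simp add: P_def)
  have E: "E \<ge> 0" using D by (simp add: E_def)
  have 1: "log_omega DIM('a) (norm z) \<le> E" for z :: 'a
    using log_omega_antimono[of "DIM('a)" 0 "norm z"] by (simp add: E_def le_max_iff_disj)
  have 2: "log_omega DIM('a) (norm z) \<le> E / (norm z)\<^sup>2" if "z \<noteq> 0" for z :: 'a
  proof -
    have "D / (norm z)\<^sup>2 \<le> E / (norm z)\<^sup>2" by (intro divide_right_mono) (auto simp: E_def)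
    then show ?thesis using D(2)[of "norm z"] that by simp
  qed
  have "log_kernel z \<le> (P * E) * norm z powr (- real DIM('a)) \<and>
     log_kernel z \<le> (P * E) * norm z powr (- real DIM('a)) / (norm z)\<^sup>2" for z :: 'a
  proof (cases "z = 0")
    case False
    have "P * norm z powr (- real DIM('a)) * log_omega DIM('a) (norm z) \<le> P * norm z powr (- real DIM('a)) * E"
      using P 1 by (intro mult_left_mono) auto
    moreover have "P * norm z powr (- real DIM('a)) * log_omega DIM('a) (norm z) \<le> P * norm z powr (- real DIM('a)) * (E / (norm z)\<^sup>2)"
      using P 2[OF False] by (intro mult_left_mono) auto
    ultimately show ?thesis by (simp add: log_kernel_def P_def mult_ac)
  qed (simp add: log_kernel_def)
  moreover have "P * E \<ge> 0" using P E by simp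
  ultimately show ?thesis by blast
qed

lemma power_2_interval:
  assumes "(1::real) \<le> y"
  shows "\<exists>k::nat. 2 ^ k \<le> y \<and> y < 2 ^ Suc k"
proof -
  have ex: "\<exists>k::nat. y < 2 ^ k" using real_arch_pow[of 2 y] by auto
  define m where "m = (LEAST k::nat. y < 2 ^ k)"
  have m: "y < 2 ^ m" unfolding m_def using ex by (rule LeastI_ex)
  then have "m \<noteq> 0" using assms by (intro notI) simp
  then obtain k where k: "m = Suc k" by (cases m) auto
  have "\<not> y < 2 ^ k" using not_less_Least[of k "\<lambda>k. y < 2 ^ k"] k unfolding m_def by simp
  then show ?thesis using m k by (intro exI[of _ k]) auto
qed

text \<open>The Levy condition, shown by dyadic shells covered with cubes. On a shell the power
  |z|^(-N) cancels the volume, and what remains is a factor \<open>(1 / 4) ^ k\<close>: from |z|^2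
  on the inner shells, from the decay of the kernel on the outer ones.\<close>

lemma log_kernel_levy_integrable:
  "integrable lborel (\<lambda>z::'a::euclidean_space. min 1 ((norm z)\<^sup>2) * log_kernel z)"
proof -
  let ?N = "DIM('a)"
  define g where "g z = min 1 ((norm z)\<^sup>2) * log_kernel z" for z :: 'a
  obtain C where C: "C \<ge> 0" "\<And>z::'a. log_kernel z \<le> C * norm z powr (- real ?N)"
      "\<And>z::'a. log_kernel z \<le> C * norm z powr (- real ?N) / (norm z)\<^sup>2"
    using log_kernel_upper by blast
  define B where "B r = cbox ((- r) *\<^sub>R One) (r *\<^sub>R One :: 'a)" for r :: real
  have Bm: "emeasure lborel (B r) = ennreal ((2 * r) ^ ?N)" if "r > 0" for r
  proof -
    have "(r *\<^sub>R One - (- r) *\<^sub>R One) \<bullet> b = 2 * r" if "b \<in> Basis" for b :: 'a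
      using that by (simp add: inner_diff_left inner_add_left)
    then show ?thesis unfolding B_def using that by (subst emeasure_lborel_cbox) (auto simp del: power_mult_distrib)
  qed
  have inB: "z \<in> B r" if "norm z \<le> r" for z r
    using that Basis_le_norm[of _ z] unfolding B_def mem_box by (auto simp: abs_le_iff) (smt (verit) Basis_le_norm)+
  \<comment> \<open>The first term majorises the shell at radius about \<open>2^(-k)\<close>, the
    second the one at radius about \<open>2^k\<close>. Both integrate to
    \<open>C * 4^N * (1 / 4) ^ k\<close>.\<close>
  define h where "h k z = C * (1 / 4) ^ k * ((2 ^ Suc k) ^ ?N * indicator (B ((1 / 2) ^ k)) z
      + (1 / 2 ^ k) ^ ?N * indicator (B (2 ^ Suc k)) z)" for k z
  have h0: "0 \<le> h k z" for k z using C(1) by (auto simp: h_def)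
  have hm [measurable]: "h k \<in> borel_measurable borel" for k
    unfolding h_def[abs_def] B_def by measurable
  have inv: "norm z powr (- real ?N) = (1 / norm z) ^ ?N" for z :: 'a
    by (cases "z = 0") (auto simp: powr_minus powr_realpow power_one_over inverse_eq_divide)
  have "\<exists>k. g z \<le> h k z" if z: "z \<noteq> 0" for z
  proof (cases "norm z \<ge> 1")
    case True
    obtain k where k: "2 ^ k \<le> norm z" "norm z < 2 ^ Suc k" using power_2_interval[OF True] by blast
    have "g z \<le> 1 * log_kernel z" unfolding g_def by (intro mult_right_mono) auto
    also have "\<dots> \<le> C * (1 / norm z) ^ ?N * (1 / norm z)\<^sup>2"
      using C(3)[of z] by (simp add: inv power_one_over)
    also have "\<dots> \<le> C * (1 / 2 ^ k) ^ ?N * (1 / 2 ^ k)\<^sup>2"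
      using k(1) C(1) z by (intro mult_mono power_mono divide_left_mono) auto
    also have "(1 / 2 ^ k)\<^sup>2 = ((1 / 4) ^ k :: real)"
      by (simp add: power_one_over power2_eq_square flip: power_mult_distrib)
    also have "C * (1 / 2 ^ k) ^ ?N * (1 / 4) ^ k \<le> h k z"
      using inB[of z "2 ^ Suc k"] k(2) C(1) by (auto simp: h_def algebra_simps)
    finally show ?thesis by blast
  next
    case False
    have "1 \<le> 1 / norm z" using False z by simp
    then obtain k where k: "2 ^ k \<le> 1 / norm z" "1 / norm z < 2 ^ Suc k" using power_2_interval by blast
    have nz: "norm z \<le> (1 / 2) ^ k" using k(1) z by (simp add: field_simps power_one_over)
    have "g z \<le> (norm z)\<^sup>2 * (C * (1 / norm z) ^ ?N)"
      unfolding g_def using C(2)[of z] by (intro mult_mono) (auto simp: inv)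
    also have "\<dots> \<le> ((1 / 2) ^ k)\<^sup>2 * (C * (2 ^ Suc k) ^ ?N)"
      using nz k(2) C(1) by (intro mult_mono mult_left_mono power_mono) auto
    also have "((1 / 2) ^ k)\<^sup>2 = ((1 / 4) ^ k :: real)"
      by (simp add: power_one_over power2_eq_square flip: power_mult_distrib)
    also have "(1 / 4) ^ k * (C * (2 ^ Suc k) ^ ?N) \<le> h k z"
      using inB[OF nz] C(1) by (auto simp: h_def algebra_simps)
    finally show ?thesis by blast
  qed
  moreover have "g 0 \<le> h 0 0" using h0 by (simp add: g_def)
  ultimately have "\<exists>k. g z \<le> h k z" for z by (cases "z = 0") auto
  then have le: "ennreal (g z) \<le> (\<Sum>k. ennreal (h k z))" for z
  proof -
    obtain k where "g z \<le> h k z" using \<open>\<And>z. \<exists>k. g z \<le> h k z\<close> by blast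
    then have "ennreal (g z) \<le> ennreal (h k z)" by (rule ennreal_leI)
    also have "\<dots> \<le> (\<Sum>k. ennreal (h k z))"
      using sum_le_suminf[of "\<lambda>k. ennreal (h k z)" "{k}"] by (simp add: summableI)
    finally show ?thesis .
  qed
  have hint: "(\<integral>\<^sup>+z. ennreal (h k z) \<partial>lborel) = ennreal (C * 2 * 4 ^ ?N * (1 / 4) ^ k)" for k
  proof -
    have "(\<integral>\<^sup>+z. ennreal (h k z) \<partial>lborel) = (\<integral>\<^sup>+z. ennreal (C * (1 / 4) ^ k * (2 ^ Suc k) ^ ?N) * indicator (B ((1 / 2) ^ k)) z
        + ennreal (C * (1 / 4) ^ k * (1 / 2 ^ k) ^ ?N) * indicator (B (2 ^ Suc k)) z \<partial>lborel)"
      using C(1) by (intro nn_integral_cong) (auto simp: h_def indicator_def distrib_left ennreal_plus[symmetric] mult.assoc simp del: ennreal_plus)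
    also have "\<dots> = ennreal (C * (1 / 4) ^ k * (2 ^ Suc k) ^ ?N) * ennreal ((2 * (1 / 2) ^ k) ^ ?N)
        + ennreal (C * (1 / 4) ^ k * (1 / 2 ^ k) ^ ?N) * ennreal ((2 * 2 ^ Suc k) ^ ?N)"
    proof -
      have [measurable]: "B r \<in> sets borel" for r by (simp add: B_def)
      show ?thesis by (subst nn_integral_add) (simp_all add: nn_integral_cmult Bm)
    qed
    also have "\<dots> = ennreal (C * (1 / 4) ^ k * (2 ^ Suc k) ^ ?N * (2 * (1 / 2) ^ k) ^ ?N
        + C * (1 / 4) ^ k * (1 / 2 ^ k) ^ ?N * (2 * 2 ^ Suc k) ^ ?N)"
      using C(1) by (simp add: ennreal_mult[symmetric] ennreal_plus[symmetric] del: ennreal_plus)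
    also have "C * (1 / 4) ^ k * (2 ^ Suc k) ^ ?N * (2 * (1 / 2) ^ k) ^ ?N = C * (1 / 4) ^ k * 4 ^ ?N"
    proof -
      have "2 ^ Suc k * (2 * (1 / 2) ^ k) = (4::real)" by (simp add: power_one_over)
      then show ?thesis unfolding mult.assoc power_mult_distrib[symmetric] by simp
    qed
    also have "C * (1 / 4) ^ k * (1 / 2 ^ k) ^ ?N * (2 * 2 ^ Suc k) ^ ?N = C * (1 / 4) ^ k * 4 ^ ?N"
    proof -
      have "1 / 2 ^ k * (2 * 2 ^ Suc k) = (4::real)" by simp
      then show ?thesis unfolding mult.assoc power_mult_distrib[symmetric] by simp
    qed
    finally show ?thesis by (simp add: mult_ac)
  qed
  have "(\<integral>\<^sup>+z. ennreal (g z) \<partial>lborel) \<le> (\<integral>\<^sup>+z. (\<Sum>k. ennreal (h k z)) \<partial>lborel)"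
    by (intro nn_integral_mono le)
  also have "\<dots> = (\<Sum>k. \<integral>\<^sup>+z. ennreal (h k z) \<partial>lborel)" by (intro nn_integral_suminf) measurable
  also have "\<dots> = (\<Sum>k. ennreal (C * 2 * 4 ^ ?N * (1 / 4) ^ k))" by (simp add: hint)
  also have "\<dots> < \<infinity>"
  proof -
    have "summable (\<lambda>k. C * 2 * 4 ^ ?N * (1 / 4) ^ k)" by (intro summable_mult summable_geometric) simp
    then have "(\<Sum>k. ennreal (C * 2 * 4 ^ ?N * (1 / 4) ^ k)) \<noteq> top"
      by (rule ennreal_suminf_neq_top) (use C(1) in simp)
    then show ?thesis unfolding infinity_ennreal_def less_top .
  qed
  finally show ?thesis unfolding g_def
    by (intro integrableI_nonneg) (auto simp: g_def)
qed

lemma nn_integral_lborel_translate: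
  assumes [measurable]: "f \<in> borel_measurable borel"
  shows "(\<integral>\<^sup>+y. f (y - x) \<partial>lborel) = (\<integral>\<^sup>+y. f (y::'a::euclidean_space) \<partial>lborel)"
proof -
  have "(\<integral>\<^sup>+y. f y \<partial>lborel) = (\<integral>\<^sup>+y. f y \<partial>distr lborel borel ((+) (- x)))"
    by (simp add: lborel_distr_plus)
  also have "\<dots> = (\<integral>\<^sup>+y. f (y - x) \<partial>lborel)" by (subst nn_integral_distr) auto
  finally show ?thesis by simp
qed

lemma log_integrand_measurable [measurable]:
  assumes "u \<in> borel_measurable borel" "v \<in> borel_measurable borel"
  shows "log_integrand u v \<in> borel_measurable (lborel \<Otimes>\<^sub>M lborel)"
  using assms unfolding log_integrand_def by measurable

text \<open>Differences of a test function are bounded and Lipschitz, so their squares lie below a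
  multiple of \<open>min 1 |x - y|^2\<close>. They vanish unless one point is in the compact
  support; Fubini and translation invariance then reduce the claim to the Levy condition.\<close>

lemma Cc_inf_log_integrand_integrable:
  fixes f :: "'a::euclidean_space \<Rightarrow> real"
  assumes f: "f \<in> Cc_inf \<Omega>"
  shows "integrable (lborel \<Otimes>\<^sub>M lborel) (log_integrand f f)"
proof -
  obtain K where K: "compact K" "\<And>x. x \<notin> K \<Longrightarrow> f x = 0" using Cc_inf_support[OF f] by blast
  have [measurable]: "K \<in> sets borel" using K(1) by (simp add: compact_imp_closed)
  obtain M where M: "M \<ge> 0" "\<And>x. \<bar>f x\<bar> \<le> M" using Cc_inf_bounded[OF f] by blast
  obtain L where L: "L \<ge> 0" "\<And>x y. \<bar>f x - f y\<bar> \<le> L * norm (x - y)" using Cc_inf_lipschitz[OF f] by blast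
  have [measurable]: "f \<in> borel_measurable borel" by (rule Cc_inf_measurable[OF f])
  define m where "m z = min 1 ((norm z)\<^sup>2) * log_kernel z" for z :: 'a
  have [measurable]: "m \<in> borel_measurable borel" unfolding m_def[abs_def] by measurable
  have m0: "0 \<le> m z" for z by (simp add: m_def)
  \<comment> \<open>Large enough for both estimates: \<open>(2 * M)^2\<close> from boundedness and
    \<open>L^2\<close> from the Lipschitz constant.\<close>
  define D where "D = 4 * M\<^sup>2 + L\<^sup>2"
  have D0: "D \<ge> 0" by (simp add: D_def)
  have b1: "(f x - f y)\<^sup>2 \<le> D * min 1 ((norm (x - y))\<^sup>2)" for x y
  proof -
    have "\<bar>f x - f y\<bar> \<le> 2 * M" using M(2)[of x] M(2)[of y] by linarith
    then have "(f x - f y)\<^sup>2 \<le> (2 * M)\<^sup>2" by (metis abs_ge_zero power2_abs power_mono)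
    then have 1: "(f x - f y)\<^sup>2 \<le> D" by (simp add: D_def add_increasing2 power_mult_distrib)
    have "(f x - f y)\<^sup>2 \<le> (L * norm (x - y))\<^sup>2" using L(2)[of x y] by (metis abs_ge_zero power2_abs power_mono)
    also have "\<dots> \<le> D * (norm (x - y))\<^sup>2"
      unfolding power_mult_distrib by (intro mult_right_mono) (auto simp: D_def)
    finally show ?thesis using 1 by (simp add: min_def)
  qed
  have le: "log_integrand f f (x, y) \<le> D * (indicator K x * m (x - y)) + D * (indicator K y * m (x - y))" for x y
  proof (cases "x \<in> K \<or> y \<in> K")
    case True
    have "log_integrand f f (x, y) = (f x - f y)\<^sup>2 * log_kernel (x - y)"
      by (simp add: log_integrand_def power2_eq_square)
    also have "\<dots> \<le> D * min 1 ((norm (x - y))\<^sup>2) * log_kernel (x - y)"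
      by (intro mult_right_mono b1) simp
    also have "\<dots> = D * m (x - y)" by (simp add: m_def mult.assoc)
    also have "\<dots> \<le> D * (indicator K x * m (x - y)) + D * (indicator K y * m (x - y))"
      using True D0 m0 by (auto simp: indicator_def)
    finally show ?thesis .
  next
    case False
    then show ?thesis using K(2) D0 m0 by (simp add: log_integrand_def)
  qed
  define I where "I = (\<integral>\<^sup>+z. ennreal (m z) \<partial>lborel)"
  have Ifin: "I < \<infinity>"
    using log_kernel_levy_integrable[where 'a='a] m0 unfolding I_def m_def[symmetric]
    by (simp add: integrable_iff_bounded)
  have sym: "m (x - y) = m (y - x)" for x y by (simp add: m_def log_kernel_minus[of x y] norm_minus_commute)
  have tr: "(\<integral>\<^sup>+y. ennreal (m (y - x)) \<partial>lborel) = I" for x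
    unfolding I_def by (rule nn_integral_lborel_translate[of "\<lambda>z. ennreal (m z)"]) measurable
  have i1: "(\<integral>\<^sup>+p. indicator K (fst p) * ennreal (m (fst p - snd p)) \<partial>(lborel \<Otimes>\<^sub>M lborel)) = emeasure lborel K * I"
  proof -
    have "(\<integral>\<^sup>+p. indicator K (fst p) * ennreal (m (fst p - snd p)) \<partial>(lborel \<Otimes>\<^sub>M lborel))
        = (\<integral>\<^sup>+x. \<integral>\<^sup>+y. indicator K x * ennreal (m (y - x)) \<partial>lborel \<partial>lborel)"
      by (subst lborel.nn_integral_fst[symmetric]) (auto simp: sym)
    also have "\<dots> = (\<integral>\<^sup>+x. indicator K x * I \<partial>lborel)"
      by (intro nn_integral_cong) (simp add: nn_integral_cmult tr)
    finally show ?thesis by (simp add: nn_integral_multc)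
  qed
  have i2: "(\<integral>\<^sup>+p. indicator K (snd p) * ennreal (m (fst p - snd p)) \<partial>(lborel \<Otimes>\<^sub>M lborel)) = emeasure lborel K * I"
  proof -
    have "(\<integral>\<^sup>+p. indicator K (snd p) * ennreal (m (fst p - snd p)) \<partial>(lborel \<Otimes>\<^sub>M lborel))
        = (\<integral>\<^sup>+y. \<integral>\<^sup>+x. indicator K y * ennreal (m (x - y)) \<partial>lborel \<partial>lborel)"
      by (subst lborel_pair.nn_integral_snd[symmetric]) auto
    also have "\<dots> = (\<integral>\<^sup>+x. indicator K x * I \<partial>lborel)"
      by (intro nn_integral_cong) (simp add: nn_integral_cmult tr)
    finally show ?thesis by (simp add: nn_integral_multc)
  qed
  have "(\<integral>\<^sup>+p. ennreal (log_integrand f f p) \<partial>(lborel \<Otimes>\<^sub>M lborel))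
      \<le> (\<integral>\<^sup>+p. ennreal D * (indicator K (fst p) * ennreal (m (fst p - snd p)))
             + ennreal D * (indicator K (snd p) * ennreal (m (fst p - snd p))) \<partial>(lborel \<Otimes>\<^sub>M lborel))"
  proof (rule nn_integral_mono)
    fix p :: "'a \<times> 'a"
    obtain x y where p: "p = (x, y)" by (cases p)
    have "ennreal (log_integrand f f p) \<le> ennreal (D * (indicator K x * m (x - y)) + D * (indicator K y * m (x - y)))"
      unfolding p by (intro ennreal_leI le)
    also have "\<dots> = ennreal D * (indicator K x * ennreal (m (x - y))) + ennreal D * (indicator K y * ennreal (m (x - y)))"
      using D0 m0 by (auto simp: indicator_def ennreal_mult ennreal_plus)
    finally show "ennreal (log_integrand f f p) \<le> ennreal D * (indicator K (fst p) * ennreal (m (fst p - snd p)))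
             + ennreal D * (indicator K (snd p) * ennreal (m (fst p - snd p)))" by (simp add: p)
  qed
  also have "\<dots> = ennreal D * (emeasure lborel K * I) + ennreal D * (emeasure lborel K * I)"
    by (subst nn_integral_add) (auto simp: nn_integral_cmult i1 i2)
  also have "\<dots> < \<infinity>"
    using Ifin emeasure_compact_finite[OF K(1)] by (auto simp: ennreal_mult_less_top)
  finally show ?thesis
    by (intro integrableI_nonneg) (auto simp: log_integrand_def)
qed

section \<open>The function spaces\<close>

text \<open>The abstract locales live on a type of class \<open>real_vector\<close>; with pointwise
  operations the function spaces become subspaces of such a type.\<close>

instantiation "fun" :: (type, real_vector) real_vector
begin

definition scaleR_fun :: "real \<Rightarrow> ('a \<Rightarrow> 'b) \<Rightarrow> 'a \<Rightarrow> 'b" where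
  "scaleR_fun c f = (\<lambda>x. c *\<^sub>R f x)"

instance
  by standard (simp_all add: fun_eq_iff scaleR_fun_def scaleR_add_right scaleR_add_left)

end

lemma scaleR_fun_apply [simp]: "(c *\<^sub>R f) x = c *\<^sub>R f x"
  by (simp add: scaleR_fun_def)

lemma sum_fun_apply: "(\<Sum>i\<in>I. f i) x = (\<Sum>i\<in>I. f i x)"
  by (induction I rule: infinite_finite_induct) auto

text \<open>With the square root of the kernel absorbed, \<open>log_form\<close> is half an \<open>L\<^sup>2\<close> inner product.\<close>

definition lift2 :: "('a::euclidean_space \<Rightarrow> real) \<Rightarrow> 'a \<times> 'a \<Rightarrow> real" where
  "lift2 u p = (u (fst p) - u (snd p)) * sqrt (log_kernel (fst p - snd p))"

lemma log_integrand_lift2: "log_integrand u v = (\<lambda>p. lift2 u p * lift2 v p)"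
  by (auto simp: log_integrand_def lift2_def fun_eq_iff algebra_simps)

lemma log_integrand_square: "log_integrand u u = (\<lambda>p. (lift2 u p)\<^sup>2)"
  by (simp add: log_integrand_lift2 power2_eq_square)

lemma lift2_measurable [measurable]:
  assumes [measurable]: "u \<in> borel_measurable borel"
  shows "lift2 u \<in> borel_measurable (lborel \<Otimes>\<^sub>M lborel)"
  unfolding lift2_def[abs_def] by measurable

lemma lift2_add: "lift2 (u + v) = (\<lambda>p. lift2 u p + lift2 v p)"
  and lift2_scale: "lift2 (c *\<^sub>R u) = (\<lambda>p. c * lift2 u p)"
  and lift2_diff: "lift2 (u - v) = (\<lambda>p. lift2 u p - lift2 v p)"
  by (auto simp: lift2_def fun_eq_iff algebra_simps)

lemma H_log_iff:
  "u \<in> H_log \<longleftrightarrow> u \<in> borel_measurable borel \<and> integrable lborel (\<lambda>x. (u x)\<^sup>2) \<and>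
     integrable (lborel \<Otimes>\<^sub>M lborel) (\<lambda>p. (lift2 u p)\<^sup>2)"
  by (auto simp: H_log_def L2_on_def log_integrand_square)

lemma H_log_measurable: "u \<in> H_log \<Longrightarrow> u \<in> borel_measurable borel"
  by (simp add: H_log_iff)

lemma log_integrand_integrable:
  "u \<in> H_log \<Longrightarrow> v \<in> H_log \<Longrightarrow> integrable (lborel \<Otimes>\<^sub>M lborel) (\<lambda>p. lift2 u p * lift2 v p)"
  unfolding H_log_iff by (intro integrable_mult_of_squares) auto

lemma log_form_lift2: "log_form u v = 1 / 2 * (LINT p|(lborel \<Otimes>\<^sub>M lborel). lift2 u p * lift2 v p)"
  by (simp add: log_form_def log_integrand_lift2)

lemma subspace_H_log: "subspace H_log"
  unfolding subspace_def
proof (intro conjI ballI allI)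
  show "0 \<in> H_log" by (auto simp: H_log_iff lift2_def zero_fun_def)
  show "x + y \<in> H_log" if "x \<in> H_log" "y \<in> H_log" for x y :: "'a \<Rightarrow> real"
    using that unfolding H_log_iff lift2_add unfolding plus_fun_def by (auto intro!: integrable_square_add)
  show "c *\<^sub>R x \<in> H_log" if "x \<in> H_log" for c and x :: "'a \<Rightarrow> real"
    using that unfolding H_log_iff lift2_scale unfolding scaleR_fun_def by (auto simp: power_mult_distrib)
qed

global_interpretation E: psd_form H_log log_form
proof
  fix u v w :: "'a \<Rightarrow> real" and c
  show "subspace (H_log :: ('a \<Rightarrow> real) set)" by (rule subspace_H_log)
  show "log_form u v = log_form v u" by (simp add: log_form_lift2 mult.commute)
  show "log_form (u + v) w = log_form u w + log_form v w" if "u \<in> H_log" "v \<in> H_log" "w \<in> H_log"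
    using log_integrand_integrable[OF that(1,3)] log_integrand_integrable[OF that(2,3)]
    by (simp add: log_form_lift2 lift2_add distrib_right)
  show "log_form (c *\<^sub>R u) w = c * log_form u w"
    by (simp add: log_form_lift2 lift2_scale mult.assoc)
  show "0 \<le> log_form u u" by (simp add: log_form_lift2)
qed

section \<open>The spaces on \<open>\<Omega>\<close> and the closure of the test functions\<close>

lemma L2_on_iff:
  "u \<in> L2_on \<Omega> \<longleftrightarrow> u \<in> borel_measurable borel \<and> integrable lborel (\<lambda>x. (u x)\<^sup>2) \<and>
     (AE x in lborel. x \<notin> \<Omega> \<longrightarrow> u x = 0)"
  by (simp add: L2_on_def)

lemma subspace_L2_on: "subspace (L2_on \<Omega>)"
  unfolding subspace_def
proof (intro conjI ballI allI)
  show "0 \<in> L2_on \<Omega>" by (auto simp: L2_on_iff zero_fun_def)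
  show "x + y \<in> L2_on \<Omega>" if "x \<in> L2_on \<Omega>" "y \<in> L2_on \<Omega>" for x y
    using that unfolding L2_on_iff plus_fun_def by (auto intro!: integrable_square_add)
  show "c *\<^sub>R x \<in> L2_on \<Omega>" if "x \<in> L2_on \<Omega>" for c x
    using that unfolding L2_on_iff scaleR_fun_def by (auto simp: power_mult_distrib)
qed

lemma L2_inner_eq:
  assumes "u \<in> L2_on \<Omega>" "v \<in> borel_measurable borel" "\<Omega> \<in> sets borel"
  shows "L2_inner \<Omega> u v = (LINT x|lborel. u x * v x)"
proof -
  have [measurable]: "u \<in> borel_measurable borel" "v \<in> borel_measurable borel" "\<Omega> \<in> sets borel"
    using assms by (auto simp: L2_on_iff)
  have ae: "AE x in lborel. x \<notin> \<Omega> \<longrightarrow> u x = 0" using assms by (simp add: L2_on_iff)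
  show ?thesis unfolding L2_inner_def set_lebesgue_integral_def
    by (rule integral_cong_AE) (use ae in \<open>auto simp: indicator_def\<close>)
qed

lemma L2_norm_eq: "L2_norm \<Omega> u = sqrt (L2_inner \<Omega> u u)"
  by (simp add: L2_norm_def L2_inner_def power2_eq_square)

lemma L2_mult_integrable:
  "u \<in> L2_on \<Omega> \<Longrightarrow> v \<in> L2_on \<Omega>' \<Longrightarrow> integrable lborel (\<lambda>x. u x * v x)"
  by (intro integrable_mult_of_squares) (auto simp: L2_on_iff)

lemma psd_form_L2:
  assumes "\<Omega> \<in> sets borel"
  shows "psd_form (L2_on \<Omega>) (L2_inner \<Omega>)"
proof
  fix u v w :: "'a \<Rightarrow> real" and c
  note eq = L2_inner_eq[OF _ _ assms]
  have m: "u \<in> L2_on \<Omega> \<Longrightarrow> u \<in> borel_measurable borel" for u by (simp add: L2_on_iff)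
  show "subspace (L2_on \<Omega>)" by (rule subspace_L2_on)
  show "L2_inner \<Omega> u v = L2_inner \<Omega> v u" by (simp add: L2_inner_def mult.commute)
  show "L2_inner \<Omega> (u + v) w = L2_inner \<Omega> u w + L2_inner \<Omega> v w"
    if "u \<in> L2_on \<Omega>" "v \<in> L2_on \<Omega>" "w \<in> L2_on \<Omega>"
    using that L2_mult_integrable[OF that(1,3)] L2_mult_integrable[OF that(2,3)] subspace_add[OF subspace_L2_on that(1,2)]
    by (simp add: eq m distrib_right)
  show "L2_inner \<Omega> (c *\<^sub>R u) w = c * L2_inner \<Omega> u w" if "u \<in> L2_on \<Omega>" "w \<in> L2_on \<Omega>"
    using that subspace_scale[OF subspace_L2_on that(1)] by (simp add: eq m mult.assoc)
  show "0 \<le> L2_inner \<Omega> u u" if "u \<in> L2_on \<Omega>"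
    using that by (simp add: eq m)
qed

text \<open>The bilinear form whose quadratic form is the square of
  \<open>H_log_norm\<close>.\<close>

definition H_form :: "('a::euclidean_space \<Rightarrow> real) \<Rightarrow> ('a \<Rightarrow> real) \<Rightarrow> real" where
  "H_form u v = L2_inner UNIV u v + log_form u v"

lemma H_log_L2: "u \<in> H_log \<Longrightarrow> u \<in> L2_on UNIV"
  by (simp add: H_log_def)

global_interpretation H: psd_form H_log H_form
proof -
  interpret B: psd_form "L2_on UNIV" "L2_inner (UNIV :: 'a set)" by (rule psd_form_L2) simp
  show "psd_form (H_log :: ('a \<Rightarrow> real) set) H_form"
    by unfold_locales
       (simp_all add: H_form_def H_log_L2 B.expand E.expand E.sym B.sym E.nonneg B.nonneg algebra_simps subspace_H_log)
qed

lemma H_log_norm_eq: "H_log_norm u = sqrt (H_form u u)"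
  by (simp add: H_log_norm_def H_form_def L2_norm_eq L2_inner_def set_lebesgue_integral_def)

lemma H_form_ge: 
  assumes "u \<in> H_log"
  shows "(LINT x|lborel. (u x)\<^sup>2) \<le> H_form u u" "log_form u u \<le> H_form u u"
  using E.nonneg[OF assms]
  by (auto simp: H_form_def L2_inner_def set_lebesgue_integral_def power2_eq_square)

lemma Cc_inf_subset_H_log: "f \<in> Cc_inf \<Omega> \<Longrightarrow> f \<in> H_log"
  using Cc_inf_log_integrand_integrable[of f \<Omega>]
  by (simp add: H_log_iff Cc_inf_measurable Cc_inf_square_integrable log_integrand_square)

text \<open>The sequential closure restated with one test function per tolerance and without square
  roots, so that closure arguments need no choice of sequences.\<close>

lemma H0_log_iff:
  "u \<in> H0_log \<Omega> \<longleftrightarrow> u \<in> H_log \<and> (\<forall>e>0. \<exists>f\<in>Cc_inf \<Omega>. H_form (f - u) (f - u) < e)"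
proof
  assume u: "u \<in> H0_log \<Omega>"
  then obtain f where f: "u \<in> H_log" "\<And>n. f n \<in> Cc_inf \<Omega>" "(\<lambda>n. H_log_norm (f n - u)) \<longlonglongrightarrow> 0"
    by (auto simp: H0_log_def fun_diff_def)
  have "\<exists>g\<in>Cc_inf \<Omega>. H_form (g - u) (g - u) < e" if "e > 0" for e
  proof -
    have "\<forall>\<^sub>F n in sequentially. H_log_norm (f n - u) < sqrt e"
      using f(3) that by (intro order_tendstoD(2)) auto
    then obtain n where "H_log_norm (f n - u) < sqrt e" by (auto simp: eventually_sequentially)
    then show ?thesis using f(2) by (intro bexI[of _ "f n"]) (auto simp: H_log_norm_eq)
  qed
  then show "u \<in> H_log \<and> (\<forall>e>0. \<exists>f\<in>Cc_inf \<Omega>. H_form (f - u) (f - u) < e)" using f by blast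
next
  assume u: "u \<in> H_log \<and> (\<forall>e>0. \<exists>f\<in>Cc_inf \<Omega>. H_form (f - u) (f - u) < e)"
  then have "\<exists>f\<in>Cc_inf \<Omega>. H_form (f - u) (f - u) < inverse (real (Suc n))" for n by simp
  then obtain f where f: "\<And>n. f n \<in> Cc_inf \<Omega>" "\<And>n. H_form (f n - u) (f n - u) < inverse (real (Suc n))" by metis
  have "(\<lambda>n. H_form (f n - u) (f n - u)) \<longlonglongrightarrow> 0"
    using LIMSEQ_inverse_real_of_nat
  proof (rule tendsto_0_le)
    show "0 \<le> H_form (f n - u) (f n - u)" for n
      using u Cc_inf_subset_H_log[OF f(1)] by (intro H.nonneg H.mem) auto
    show "H_form (f n - u) (f n - u) \<le> inverse (real (Suc n))" for n
      using f(2) by (rule less_imp_le)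
  qed
  then have "(\<lambda>n. H_log_norm (f n - u)) \<longlonglongrightarrow> 0"
    using tendsto_real_sqrt by (fastforce simp: H_log_norm_eq)
  then show "u \<in> H0_log \<Omega>" using u f(1) by (auto simp: H0_log_def fun_diff_def)
qed

lemma H0_log_subset_H_log: "u \<in> H0_log \<Omega> \<Longrightarrow> u \<in> H_log"
  by (simp add: H0_log_iff)

lemma Cc_inf_subset_H0_log:
  fixes f :: "'a::euclidean_space \<Rightarrow> real"
  shows "f \<in> Cc_inf \<Omega> \<Longrightarrow> f \<in> H0_log \<Omega>"
  unfolding H0_log_iff using Cc_inf_subset_H_log[of f \<Omega>] H.zero_left[OF H.mem(1), where 'a='a]
  by (auto intro!: bexI[of _ f])

lemma H0_log_closed:
  assumes u: "u \<in> H_log" and ap: "\<And>e. e > 0 \<Longrightarrow> \<exists>v\<in>H0_log \<Omega>. H_form (v - u) (v - u) < e"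
  shows "u \<in> H0_log \<Omega>"
  unfolding H0_log_iff
proof (intro conjI allI impI u)
  fix e :: real assume e: "e > 0"
  then obtain v where v: "v \<in> H0_log \<Omega>" "H_form (v - u) (v - u) < e / 4" using ap[of "e / 4"] by auto
  then obtain f where f: "f \<in> Cc_inf \<Omega>" "H_form (f - v) (f - v) < e / 4"
    using e unfolding H0_log_iff by (meson zero_less_divide_iff zero_less_numeral)
  have "H_form ((f - v) + (v - u)) ((f - v) + (v - u)) \<le> 2 * H_form (f - v) (f - v) + 2 * H_form (v - u) (v - u)"
    using u v f by (intro H.add_le H.mem) (auto simp: Cc_inf_subset_H_log H0_log_subset_H_log)
  then show "\<exists>f\<in>Cc_inf \<Omega>. H_form (f - u) (f - u) < e" using v f by (intro bexI[of _ f]) auto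
qed

lemma subspace_H0_log: "subspace (H0_log \<Omega>)"
  unfolding subspace_def
proof (intro conjI ballI allI)
  show "0 \<in> H0_log \<Omega>" using Cc_inf_subset_H0_log[OF Cc_inf_zero] by (simp add: zero_fun_def)
  fix u assume u: "u \<in> H0_log \<Omega>"
  note uH = H0_log_subset_H_log[OF u]
  show "u + v \<in> H0_log \<Omega>" if v: "v \<in> H0_log \<Omega>" for v
    unfolding H0_log_iff
  proof (intro conjI allI impI)
    note vH = H0_log_subset_H_log[OF v]
    show "u + v \<in> H_log" using uH vH by simp
    fix e :: real assume "e > 0"
    then have e: "e / 4 > 0" by simp
    obtain f where f: "f \<in> Cc_inf \<Omega>" "H_form (f - u) (f - u) < e / 4" using u e unfolding H0_log_iff by blast
    obtain g where g: "g \<in> Cc_inf \<Omega>" "H_form (g - v) (g - v) < e / 4" using v e unfolding H0_log_iff by blast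
    have "H_form ((f - u) + (g - v)) ((f - u) + (g - v)) \<le> 2 * H_form (f - u) (f - u) + 2 * H_form (g - v) (g - v)"
      using uH vH f g by (intro H.add_le H.mem) (auto simp: Cc_inf_subset_H_log)
    moreover have "(f - u) + (g - v) = (f + g) - (u + v)" by simp
    moreover have "f + g \<in> Cc_inf \<Omega>" using Cc_inf_add[OF f(1) g(1)] by (simp add: plus_fun_def)
    ultimately show "\<exists>h\<in>Cc_inf \<Omega>. H_form (h - (u + v)) (h - (u + v)) < e"
      using f g by (intro bexI[of _ "f + g"]) auto
  qed
  show "c *\<^sub>R u \<in> H0_log \<Omega>" for c
    unfolding H0_log_iff
  proof (intro conjI allI impI)
    show "c *\<^sub>R u \<in> H_log" using uH by simp
    fix e :: real assume e: "e > 0"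
    have c1: "c\<^sup>2 + 1 > 0" by (simp add: add_nonneg_pos)
    obtain f where f: "f \<in> Cc_inf \<Omega>" "H_form (f - u) (f - u) < e / (c\<^sup>2 + 1)"
      using u e c1 unfolding H0_log_iff by (meson divide_pos_pos)
    have fu: "f - u \<in> H_log" using f uH by (simp add: Cc_inf_subset_H_log)
    have "H_form (c *\<^sub>R f - c *\<^sub>R u) (c *\<^sub>R f - c *\<^sub>R u) = c\<^sup>2 * H_form (f - u) (f - u)"
      using fu by (simp add: scaleR_diff_right[symmetric] H.expand power2_eq_square)
    also have "\<dots> \<le> (c\<^sup>2 + 1) * H_form (f - u) (f - u)"
      using H.nonneg[OF fu] by (intro mult_right_mono) auto
    also have "\<dots> < e" using f(2) pos_less_divide_eq[OF c1] by (simp add: mult.commute)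
    finally have "H_form (c *\<^sub>R f - c *\<^sub>R u) (c *\<^sub>R f - c *\<^sub>R u) < e" .
    moreover have "c *\<^sub>R f \<in> Cc_inf \<Omega>" using Cc_inf_scale[OF f(1), of c] by (simp add: scaleR_fun_def)
    ultimately show "\<exists>h\<in>Cc_inf \<Omega>. H_form (h - c *\<^sub>R u) (h - c *\<^sub>R u) < e" by blast
  qed
qed

text \<open>Test functions vanish off \<open>\<Omega>\<close>, so the mass of \<open>u\<close>
  outside is at most the squared distance of \<open>u\<close> to any of them.\<close>

lemma H0_log_subset_L2_on:
  assumes \<Omega>: "open \<Omega>" and u: "u \<in> H0_log \<Omega>"
  shows "u \<in> L2_on \<Omega>"
proof -
  have [measurable]: "\<Omega> \<in> sets borel" using \<Omega> by simp
  have uH: "u \<in> H_log" using u by (rule H0_log_subset_H_log)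
  then have [measurable]: "u \<in> borel_measurable borel" and u2: "integrable lborel (\<lambda>x. (u x)\<^sup>2)"
    by (auto simp: H_log_iff)
  define g where "g x = indicator (- \<Omega>) x * (u x)\<^sup>2" for x
  have g: "integrable lborel g"
    unfolding g_def by (rule Bochner_Integration.integrable_bound[OF u2]) (auto simp: indicator_def)
  have "integral\<^sup>L lborel g \<le> 0"
  proof (rule field_le_epsilon)
    fix e :: real assume "e > 0"
    then obtain f where f: "f \<in> Cc_inf \<Omega>" "H_form (f - u) (f - u) < e" using u unfolding H0_log_iff by blast
    have fu: "f - u \<in> H_log" using f uH by (simp add: Cc_inf_subset_H_log)
    obtain K where K: "K \<subseteq> \<Omega>" "\<And>x. x \<notin> K \<Longrightarrow> f x = 0" using Cc_inf_support[OF f(1)] by blast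
    have "f x = 0" if "x \<notin> \<Omega>" for x using K that by blast
    then have "g x \<le> ((f - u) x)\<^sup>2" for x by (auto simp: g_def indicator_def)
    then have "integral\<^sup>L lborel g \<le> (LINT x|lborel. ((f - u) x)\<^sup>2)"
      using fu g by (intro integral_mono) (auto simp: H_log_iff)
    also have "\<dots> \<le> H_form (f - u) (f - u)" by (rule H_form_ge[OF fu])
    finally show "integral\<^sup>L lborel g \<le> 0 + e" using f(2) by simp
  qed
  moreover have "integral\<^sup>L lborel g \<ge> 0" by (simp add: g_def)
  ultimately have "AE x in lborel. g x = 0"
    using integral_nonneg_eq_0_iff_AE[OF g] by (simp add: g_def)
  then have "AE x in lborel. x \<notin> \<Omega> \<longrightarrow> u x = 0" by eventually_elim (auto simp: g_def indicator_def)
  then show ?thesis using u2 by (simp add: L2_on_iff)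
qed

text \<open>Carries almost-everywhere facts about functions over to the product space on which the
  form is an integral. \<open>P\<close> may fail to be measurable, so a measurable null superset
  \<open>N\<close> of its failures is used.\<close>

lemma AE_pair_lborel:
  fixes P :: "'a::euclidean_space \<Rightarrow> bool"
  assumes "AE x in lborel. P x"
  shows "AE p in lborel \<Otimes>\<^sub>M lborel. P (fst p) \<and> P (snd p)"
proof -
  obtain N where N: "{x. \<not> P x} \<subseteq> N" "N \<in> null_sets lborel"
    using assms by (auto simp: eventually_ae_filter)
  have [measurable]: "N \<in> sets borel" using N(2) by auto
  have ae: "AE x in lborel. x \<notin> N" using N(2) by (simp add: AE_not_in)
  have "AE p in lborel \<Otimes>\<^sub>M lborel. fst p \<notin> N \<and> snd p \<notin> N"
  proof (rule lborel_pair.AE_pair_measure)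
    show "{p \<in> space (lborel \<Otimes>\<^sub>M lborel). fst p \<notin> N \<and> snd p \<notin> N} \<in> sets (lborel \<Otimes>\<^sub>M lborel)" by measurable
    show "AE x in lborel. AE y in lborel. fst (x, y) \<notin> N \<and> snd (x, y) \<notin> N"
      using ae by eventually_elim (use ae in auto)
  qed
  then show ?thesis by eventually_elim (use N in auto)
qed

lemma H_log_AE_cong:
  assumes u: "u \<in> H_log" and v [measurable]: "v \<in> borel_measurable borel" and ae: "AE x in lborel. u x = v x"
  shows "v \<in> H_log" "H_form (u - v) (u - v) = 0" "w \<in> H_log \<Longrightarrow> log_form v w = log_form u w"
proof -
  have um [measurable]: "u \<in> borel_measurable borel" using u by (rule H_log_measurable)
  have l: "AE p in lborel \<Otimes>\<^sub>M lborel. lift2 v p = lift2 u p"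
    using AE_pair_lborel[OF ae] by eventually_elim (simp add: lift2_def)
  have "integrable lborel (\<lambda>x. (v x)\<^sup>2) = integrable lborel (\<lambda>x. (u x)\<^sup>2)"
    using ae by (intro integrable_cong_AE) auto
  moreover have "integrable (lborel \<Otimes>\<^sub>M lborel) (\<lambda>p. (lift2 v p)\<^sup>2) = integrable (lborel \<Otimes>\<^sub>M lborel) (\<lambda>p. (lift2 u p)\<^sup>2)"
    using l by (intro integrable_cong_AE) auto
  ultimately show vH: "v \<in> H_log" using u by (simp add: H_log_iff)
  show vw: "log_form v w = log_form u w" if w: "w \<in> H_log" for w
  proof -
    have [measurable]: "w \<in> borel_measurable borel" using w by (rule H_log_measurable)
    show ?thesis unfolding log_form_lift2 using l by (auto intro!: integral_cong_AE)
  qed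
  have "log_form (u - v) (u - v) = 0"
    using vw[of u] vw[of v] u vH by (simp add: E.expand E.sym)
  moreover have "L2_inner UNIV (u - v) (u - v) = 0"
    unfolding L2_inner_def set_lebesgue_integral_def
    using ae by (subst integral_cong_AE[where g="\<lambda>x. 0"]) (auto simp: fun_diff_def)
  ultimately show "H_form (u - v) (u - v) = 0" by (simp add: H_form_def)
qed

lemma H0_log_AE_cong:
  assumes "u \<in> H0_log \<Omega>" "v \<in> borel_measurable borel" "AE x in lborel. u x = v x"
  shows "v \<in> H0_log \<Omega>"
proof (rule H0_log_closed)
  note uH = H0_log_subset_H_log[OF assms(1)]
  show "v \<in> H_log" by (rule H_log_AE_cong(1)[OF uH assms(2,3)])
  show "\<exists>w\<in>H0_log \<Omega>. H_form (w - v) (w - v) < e" if "e > 0" for e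
    using that assms(1) H_log_AE_cong(2)[OF uH assms(2,3)] by (intro bexI[of _ u]) auto
qed

text \<open>Energy between \<open>\<Omega>\<close> and a ball on which \<open>u\<close> vanishes:
  for \<open>x\<close> in \<open>\<Omega>\<close> and \<open>y\<close> in that ball the integrand is
  \<open>(u x)^2\<close> times the kernel, and the kernel is bounded below there by a
  constant.\<close>

lemma poincare:
  fixes \<Omega> :: "'a::euclidean_space set"
  assumes \<Omega>: "open \<Omega>" "bounded \<Omega>"
  shows "\<exists>c>0. \<forall>u. u \<in> H_log \<longrightarrow> u \<in> L2_on \<Omega> \<longrightarrow> c * (LINT x|lborel. (u x)\<^sup>2) \<le> log_form u u"
proof -
  have [measurable]: "\<Omega> \<in> sets borel" using \<Omega> by simp
  obtain R where R: "R > 0" "\<And>x. x \<in> \<Omega> \<Longrightarrow> norm x \<le> R" using \<Omega>(2) by (meson bounded_pos)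
  obtain b :: 'a where b: "b \<in> Basis" using nonempty_Basis by blast
  \<comment> \<open>The unit ball around \<open>z\<close> stays outside the ball of radius
    \<open>R + 1\<close> and inside that of radius \<open>R + 3\<close>, so it misses
    \<open>\<Omega>\<close> and lies at distance at most \<open>2 * R + 3\<close> from its
    points.\<close>
  define z where "z = (R + 2) *\<^sub>R b"
  have nz: "norm z = R + 2" using b R by (simp add: z_def)
  define D where "D = ball z 1"
  have D [measurable]: "D \<in> sets borel" by (simp add: D_def)
  have Dpos: "measure lborel D > 0" unfolding D_def using content_ball_pos[of 1 z] by simp
  have Dfin: "emeasure lborel D < \<infinity>" unfolding D_def by (rule emeasure_bounded_finite) simp
  have far: "x \<noteq> y" "norm (x - y) \<le> 2 * R + 3" if "x \<in> \<Omega>" "y \<in> D" for x y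
  proof -
    have "norm (z - y) < 1" using that(2) by (simp add: D_def dist_norm)
    then have "norm y > R + 1" "norm y < R + 3"
      using norm_triangle_ineq2[of z y] norm_triangle_ineq3[of z y] nz by linarith+
    then show "x \<noteq> y" "norm (x - y) \<le> 2 * R + 3"
      using R(2)[OF that(1)] norm_triangle_ineq4[of x y] by auto
  qed
  obtain c where c: "c > 0" "\<And>z::'a. z \<noteq> 0 \<Longrightarrow> norm z \<le> 2 * R + 3 \<Longrightarrow> c * norm z powr (- real DIM('a)) \<le> log_kernel z"
    using log_kernel_lower[of "2 * R + 3", where 'a='a] R by auto
  define j where "j = c * (2 * R + 3) powr (- real DIM('a))"
  have j: "j > 0" using c R by (simp add: j_def)
  have jle: "j \<le> log_kernel (x - y)" if "x \<in> \<Omega>" "y \<in> D" for x y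
  proof -
    have "(2 * R + 3) powr (- real DIM('a)) \<le> norm (x - y) powr (- real DIM('a))"
      using far[OF that] by (intro powr_mono2') auto
    then show ?thesis using c(2)[of "x - y"] far[OF that] c(1) unfolding j_def
      by (smt (verit) mult_left_mono right_minus_eq)
  qed
  have "(1 / 2 * j * measure lborel D) * (LINT x|lborel. (u x)\<^sup>2) \<le> log_form u u"
    if uH: "u \<in> H_log" and uL: "u \<in> L2_on \<Omega>" for u
  proof -
    have [measurable]: "u \<in> borel_measurable borel" and ae: "AE x in lborel. x \<notin> \<Omega> \<longrightarrow> u x = 0"
      using uL by (auto simp: L2_on_iff)
    define h where "h p = j * (indicator D (snd p) * (u (fst p))\<^sup>2)" for p :: "'a \<times> 'a"
    have le: "AE p in lborel \<Otimes>\<^sub>M lborel. h p \<le> (lift2 u p)\<^sup>2"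
      using AE_pair_lborel[OF ae]
    proof eventually_elim
      case (elim p)
      obtain x y where p: "p = (x, y)" by (cases p)
      show ?case
      proof (cases "x \<in> \<Omega> \<and> y \<in> D")
        case True
        then have "y \<notin> \<Omega>" using far(1)[of y y] by auto
        then have "u y = 0" using elim p by simp
        then have "(lift2 u p)\<^sup>2 = (u x)\<^sup>2 * log_kernel (x - y)" by (simp add: lift2_def p power_mult_distrib)
        then show ?thesis using jle[of x y] True by (simp add: h_def p mult.commute[of _ "log_kernel (x - y)"] mult_right_mono)
      next
        case False
        then have "h p = 0" using elim p by (auto simp: h_def indicator_def)
        then show ?thesis by simp
      qed
    qed
    have h0: "0 \<le> h p" for p using j by (simp add: h_def)
    have [measurable]: "h \<in> borel_measurable (lborel \<Otimes>\<^sub>M lborel)" unfolding h_def[abs_def] by measurable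
    have l: "integrable (lborel \<Otimes>\<^sub>M lborel) (\<lambda>p. (lift2 u p)\<^sup>2)" using uH by (simp add: H_log_iff)
    have hi: "integrable (lborel \<Otimes>\<^sub>M lborel) h"
      by (rule Bochner_Integration.integrable_bound[OF l]) (use le h0 in auto)
    have "(LINT x|lborel. LINT y|lborel. h (x, y)) = (LINT x|lborel. j * measure lborel D * (u x)\<^sup>2)"
      using Dfin by (intro Bochner_Integration.integral_cong refl) (simp add: h_def mult_ac)
    then have "j * measure lborel D * (LINT x|lborel. (u x)\<^sup>2) = integral\<^sup>L (lborel \<Otimes>\<^sub>M lborel) h"
      using lborel_pair.integral_fst'[OF hi] by simp
    also have "\<dots> \<le> (LINT p|(lborel \<Otimes>\<^sub>M lborel). (lift2 u p)\<^sup>2)"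
      using hi l le by (rule integral_mono_AE)
    finally show ?thesis by (simp add: log_form_lift2 power2_eq_square)
  qed
  moreover have "1 / 2 * j * measure lborel D > 0" using j Dpos by simp
  ultimately show ?thesis by blast
qed

section \<open>Compactness\<close>

text \<open>The integer label of the half-open dyadic cube of side \<open>2^(-k)\<close> containing
  \<open>x\<close>. A label rather than a set: cubes are fibres of a measurable map and sharing a
  cube is an equation.\<close>

definition cell :: "nat \<Rightarrow> 'a::euclidean_space \<Rightarrow> 'a" where
  "cell k x = (\<Sum>b\<in>Basis. of_int \<lfloor>2 ^ k * (x \<bullet> b)\<rfloor> *\<^sub>R b)"

lemma cell_measurable [measurable]: "cell k \<in> borel_measurable borel"
  unfolding cell_def[abs_def] by measurable

lemma cell_vimage_measurable [measurable]: "cell k -` {p} \<in> sets borel"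
  using measurable_sets[OF cell_measurable, of "{p}" k] by simp

lemma cell_eq_iff: "cell k x = cell k y \<longleftrightarrow> (\<forall>b\<in>Basis. \<lfloor>2 ^ k * (x \<bullet> b)\<rfloor> = \<lfloor>2 ^ k * (y \<bullet> b)\<rfloor>)"
proof -
  have "cell k x \<bullet> b = of_int \<lfloor>2 ^ k * (x \<bullet> b)\<rfloor>" if "b \<in> Basis" for x :: 'a and b
    using that by (simp add: cell_def inner_sum_left_Basis)
  then show ?thesis by (auto simp: euclidean_eq_iff[of "cell k x"] simp del: inner_Basis)
qed

lemma cell_dist:
  fixes x y :: "'a::euclidean_space"
  assumes "cell k x = cell k y"
  shows "norm (x - y) \<le> real DIM('a) / 2 ^ k"
proof -
  have "\<bar>(x - y) \<bullet> b\<bar> \<le> 1 / 2 ^ k" if b: "b \<in> Basis" for b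
  proof -
    have "\<lfloor>2 ^ k * (x \<bullet> b)\<rfloor> = \<lfloor>2 ^ k * (y \<bullet> b)\<rfloor>" using assms b by (simp add: cell_eq_iff)
    then have "\<bar>2 ^ k * (x \<bullet> b) - 2 ^ k * (y \<bullet> b)\<bar> < 1" by linarith
    then have "2 ^ k * \<bar>(x - y) \<bullet> b\<bar> < 1"
      by (simp add: inner_diff_left right_diff_distrib[symmetric] abs_mult)
    then show ?thesis by (simp add: field_simps)
  qed
  then have "(\<Sum>b\<in>Basis. \<bar>(x - y) \<bullet> b\<bar>) \<le> (\<Sum>b\<in>(Basis :: 'a set). 1 / 2 ^ k)" by (rule sum_mono)
  then show ?thesis using norm_le_l1[of "x - y"] by simp
qed

lemma cell_emeasure:
  fixes x0 :: "'a::euclidean_space"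
  shows "emeasure lborel (cell k -` {cell k x0}) = ennreal ((1 / 2 ^ k) ^ DIM('a))"
proof -
  define n where "n b = real_of_int \<lfloor>2 ^ k * (x0 \<bullet> b)\<rfloor>" for b
  define l where "l = (\<Sum>b\<in>Basis. (n b / 2 ^ k) *\<^sub>R b :: 'a)"
  define r where "r = (\<Sum>b\<in>Basis. ((n b + 1) / 2 ^ k) *\<^sub>R b :: 'a)"
  have lr: "l \<bullet> b = n b / 2 ^ k" "r \<bullet> b = (n b + 1) / 2 ^ k" if "b \<in> Basis" for b
    using that by (simp_all add: l_def r_def)
  have le: "l \<bullet> b \<le> r \<bullet> b" if "b \<in> Basis" for b using lr[OF that] by (simp add: divide_right_mono)
  have mem: "x \<in> cell k -` {cell k x0} \<longleftrightarrow> (\<forall>b\<in>Basis. l \<bullet> b \<le> x \<bullet> b \<and> x \<bullet> b < r \<bullet> b)" for x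
  proof -
    have "\<lfloor>2 ^ k * (x \<bullet> b)\<rfloor> = \<lfloor>2 ^ k * (x0 \<bullet> b)\<rfloor> \<longleftrightarrow> l \<bullet> b \<le> x \<bullet> b \<and> x \<bullet> b < r \<bullet> b" if "b \<in> Basis" for b
    proof -
      have "\<lfloor>2 ^ k * (x \<bullet> b)\<rfloor> = \<lfloor>2 ^ k * (x0 \<bullet> b)\<rfloor> \<longleftrightarrow> n b \<le> 2 ^ k * (x \<bullet> b) \<and> 2 ^ k * (x \<bullet> b) < n b + 1"
        unfolding n_def by linarith
      then show ?thesis by (simp add: lr that field_simps)
    qed
    then show ?thesis by (simp add: cell_eq_iff)
  qed
  have sub: "box l r \<subseteq> cell k -` {cell k x0}" "cell k -` {cell k x0} \<subseteq> cbox l r"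
    unfolding subset_iff mem mem_box by (auto simp: less_imp_le)
  have m: "cell k -` {cell k x0} \<in> sets borel" by (rule cell_vimage_measurable)
  have pr: "(\<Prod>b\<in>Basis. (r - l) \<bullet> b) = (1 / 2 ^ k) ^ DIM('a)"
    by (simp add: inner_diff_left lr diff_divide_distrib[symmetric])
  have "emeasure lborel (box l r) \<le> emeasure lborel (cell k -` {cell k x0})"
    using sub m by (intro emeasure_mono) auto
  moreover have "emeasure lborel (cell k -` {cell k x0}) \<le> emeasure lborel (cbox l r)"
    using sub m by (intro emeasure_mono) auto
  moreover have "emeasure lborel (box l r) = ennreal ((1 / 2 ^ k) ^ DIM('a))"
    using le by (subst emeasure_lborel_box) (auto simp: pr[symmetric])
  moreover have "emeasure lborel (cbox l r) = ennreal ((1 / 2 ^ k) ^ DIM('a))"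
    using le by (subst emeasure_lborel_cbox) (auto simp: pr[symmetric])
  ultimately show ?thesis by (intro antisym) auto
qed

lemma finite_cells:
  assumes "bounded (\<Omega> :: 'a::euclidean_space set)"
  shows "finite (cell k ` \<Omega>)"
proof -
  obtain R where R: "R > 0" "\<And>x. x \<in> \<Omega> \<Longrightarrow> norm x \<le> R" using assms by (meson bounded_pos)
  define M where "M = \<lceil>2 ^ k * R\<rceil>"
  have "cell k ` \<Omega> \<subseteq> (\<lambda>g. \<Sum>b\<in>Basis. of_int (g b) *\<^sub>R b) ` (PiE Basis (\<lambda>_. {- M - 1..M}))"
  proof
    fix z assume "z \<in> cell k ` \<Omega>"
    then obtain x where x: "x \<in> \<Omega>" "z = cell k x" by blast
    define g where "g = restrict (\<lambda>b. \<lfloor>2 ^ k * (x \<bullet> b)\<rfloor>) Basis"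
    have "\<lfloor>2 ^ k * (x \<bullet> b)\<rfloor> \<in> {- M - 1..M}" if "b \<in> Basis" for b
    proof -
      have "\<bar>x \<bullet> b\<bar> \<le> R" using Basis_le_norm[OF that, of x] R(2)[OF x(1)] by linarith
      then have "2 ^ k * \<bar>x \<bullet> b\<bar> \<le> 2 ^ k * R" by (intro mult_left_mono) auto
      then have "\<bar>2 ^ k * (x \<bullet> b)\<bar> \<le> 2 ^ k * R" by (simp add: abs_mult)
      then show ?thesis unfolding M_def atLeastAtMost_iff by linarith
    qed
    then have "g \<in> PiE Basis (\<lambda>_. {- M - 1..M})" by (auto simp: g_def)
    moreover have "z = (\<Sum>b\<in>Basis. of_int (g b) *\<^sub>R b)" by (simp add: x cell_def g_def)
    ultimately show "z \<in> (\<lambda>g. \<Sum>b\<in>Basis. of_int (g b) *\<^sub>R b) ` (PiE Basis (\<lambda>_. {- M - 1..M}))" by blast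
  qed
  moreover have "finite (PiE (Basis :: 'a set) (\<lambda>_. {- M - 1..M}))" by (intro finite_PiE) auto
  ultimately show ?thesis by (meson finite_imageI finite_subset)
qed

text \<open>
  The kernel controls all dyadic scales at once, uniformly in the number of scales. Averaging over
  \<open>m\<close> scales gains the factor \<open>1 / m\<close> that makes the embedding compact.
\<close>

lemma cells_le_kernel:
  "\<exists>C\<ge>0. \<forall>m (x::'a::euclidean_space) y. x \<noteq> y \<longrightarrow>
     (\<Sum>k<m. (2 ^ k) ^ DIM('a) * (if cell k x = cell k y then 1 else 0)) \<le> C * log_kernel (x - y)"
proof -
  let ?N = "DIM('a)"
  have N: "?N > 0" by simp
  obtain c where c: "c > 0" "\<And>z::'a. z \<noteq> 0 \<Longrightarrow> norm z \<le> real ?N \<Longrightarrow> c * norm z powr (- real ?N) \<le> log_kernel z"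
    using log_kernel_lower[of "real ?N", where 'a='a] N by auto
  \<comment> \<open>The 2 comes from the geometric sum and \<open>N^N\<close> from the diameter
    bound \<open>N / 2^K\<close> of a cell; \<open>c\<close> is the lower constant of the
    kernel.\<close>
  define C where "C = 2 * real ?N ^ ?N / c"
  have C0: "C \<ge> 0" using c by (simp add: C_def)
  have geo: "(\<Sum>k<Suc K. (2 ^ k) ^ ?N :: real) \<le> 2 * (2 ^ K) ^ ?N" for K :: nat
  proof (induction K)
    case (Suc K)
    have "(2::real) ^ 1 \<le> 2 ^ ?N" using N by (intro power_increasing) (auto simp: Suc_le_eq)
    then have "2 * (2 ^ K) ^ ?N \<le> (2::real) ^ ?N * (2 ^ K) ^ ?N" by (intro mult_right_mono) auto
    also have "\<dots> = (2 ^ Suc K) ^ ?N" by (simp add: power_mult_distrib)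
    finally show ?case using Suc.IH unfolding sum.lessThan_Suc[of _ "Suc K"] by linarith
  qed simp
  have "(\<Sum>k<m. (2 ^ k) ^ ?N * (if cell k x = cell k y then 1 else 0)) \<le> C * log_kernel (x - y)"
    if xy: "x \<noteq> y" for m and x y :: 'a
  proof -
    define A where "A = {k. k < m \<and> cell k x = cell k y}"
    have fA: "finite A" by (simp add: A_def)
    have eq: "(\<Sum>k<m. (2 ^ k) ^ ?N * (if cell k x = cell k y then 1 else 0)) = (\<Sum>k\<in>A. (2 ^ k) ^ ?N :: real)"
    proof -
      have "(\<Sum>k<m. (2 ^ k) ^ ?N * (if cell k x = cell k y then 1 else 0))
          = (\<Sum>k<m. if cell k x = cell k y then (2 ^ k) ^ ?N else (0::real))" by (intro sum.cong) auto
      also have "\<dots> = (\<Sum>k\<in>A. (2 ^ k) ^ ?N)"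
        unfolding A_def by (subst sum.inter_filter[symmetric]) auto
      finally show ?thesis .
    qed
    show ?thesis
    proof (cases "A = {}")
      case True
      then show ?thesis unfolding eq using C0 by simp
    next
      case False
      \<comment> \<open>The finest scale at which \<open>x\<close> and \<open>y\<close> share a
        cell. The sum is dominated by its term at \<open>K\<close>, and at that scale the points are
        at most \<open>N / 2^K\<close> apart.\<close>
      define K where "K = Max A"
      have K: "cell K x = cell K y" using Max_in[OF fA False] by (simp add: K_def A_def)
      have "A \<subseteq> {..<Suc K}" using fA by (auto simp: K_def less_Suc_eq_le)
      then have "(\<Sum>k\<in>A. (2 ^ k) ^ ?N :: real) \<le> (\<Sum>k<Suc K. (2 ^ k) ^ ?N)" by (intro sum_mono2) auto
      also have "\<dots> \<le> 2 * (2 ^ K) ^ ?N" by (rule geo)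
      also have "\<dots> = C * (c * (real ?N / 2 ^ K) powr (- real ?N))"
      proof -
        have "(real ?N / 2 ^ K) powr (- real ?N) = (2 ^ K) ^ ?N / real ?N ^ ?N"
          using N by (simp add: powr_minus powr_realpow power_divide)
        then show ?thesis using c by (simp add: C_def)
      qed
      also have "\<dots> \<le> C * (c * norm (x - y) powr (- real ?N))"
        using cell_dist[OF K] xy c C0 by (intro mult_left_mono powr_mono2') auto
      also have "\<dots> \<le> C * log_kernel (x - y)"
      proof -
        have "real ?N / 2 ^ K \<le> real ?N" by (simp add: field_simps)
        then have "norm (x - y) \<le> real ?N" using cell_dist[OF K] by linarith
        then show ?thesis using c(2)[of "x - y"] xy C0 by (intro mult_left_mono) auto
      qed
      finally show ?thesis unfolding eq .
    qed
  qed
  then show ?thesis using C0 by blast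
qed

text \<open>The variance identity: expand the square and integrate each variable over
  \<open>Q\<close>.\<close>

lemma integral_pair_difference_square:
  fixes Q :: "'a::euclidean_space set" and w :: "'a \<Rightarrow> real"
  assumes [measurable]: "Q \<in> sets borel" "w \<in> borel_measurable borel"
    and Q: "emeasure lborel Q < \<infinity>" and w: "integrable lborel (\<lambda>x. (w x)\<^sup>2)"
    and int: "integrable (lborel \<Otimes>\<^sub>M lborel) (\<lambda>p. indicator Q (fst p) * indicator Q (snd p) * (w (fst p) - w (snd p))\<^sup>2)"
  shows "(LINT p|(lborel \<Otimes>\<^sub>M lborel). indicator Q (fst p) * indicator Q (snd p) * (w (fst p) - w (snd p))\<^sup>2)
    = 2 * measure lborel Q * (LINT x|lborel. indicator Q x * (w x)\<^sup>2) - 2 * (LINT x|lborel. indicator Q x * w x)\<^sup>2"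
proof -
  define V where "V = measure lborel Q"
  define S where "S = (LINT x|lborel. indicator Q x * (w x)\<^sup>2)"
  define l where "l = (LINT x|lborel. indicator Q x * w x)"
  have i0: "integrable lborel (indicat_real Q)" using Q by simp
  have i1: "integrable lborel (\<lambda>x. indicator Q x * w x)"
    using w i0 by (intro integrable_mult_of_squares) (auto simp: indicator_square)
  have i2: "integrable lborel (\<lambda>x. indicator Q x * (w x)\<^sup>2)"
    by (rule Bochner_Integration.integrable_bound[OF w]) (auto simp: indicator_def)
  have inner: "(LINT y|lborel. indicator Q x * indicator Q y * (w x - w y)\<^sup>2)
      = V * (indicator Q x * (w x)\<^sup>2) - 2 * l * (indicator Q x * w x) + S * indicator Q x" for x
  proof -
    have "(LINT y|lborel. indicator Q x * indicator Q y * (w x - w y)\<^sup>2)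
        = (LINT y|lborel. indicator Q x * (w x)\<^sup>2 * indicator Q y - 2 * indicator Q x * w x * (indicator Q y * w y)
            + indicator Q x * (indicator Q y * (w y)\<^sup>2))"
      by (intro Bochner_Integration.integral_cong refl) (simp add: power2_eq_square algebra_simps)
    also have "\<dots> = indicator Q x * (w x)\<^sup>2 * V - 2 * indicator Q x * w x * l + indicator Q x * S"
      using i0 i1 i2 by (simp add: V_def S_def l_def)
    finally show ?thesis by (simp add: algebra_simps)
  qed
  have "(LINT p|(lborel \<Otimes>\<^sub>M lborel). indicator Q (fst p) * indicator Q (snd p) * (w (fst p) - w (snd p))\<^sup>2)
      = (LINT x|lborel. V * (indicator Q x * (w x)\<^sup>2) - 2 * l * (indicator Q x * w x) + S * indicator Q x)"
    using lborel_pair.integral_fst'[OF int] by (simp add: inner)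
  also have "\<dots> = V * S - 2 * l * l + S * V"
    using i0 i1 i2 by (simp add: V_def S_def l_def)
  finally show ?thesis by (simp add: V_def S_def l_def power2_eq_square algebra_simps)
qed

text \<open>At each scale the variance identity splits the \<open>L\<^sup>2\<close> norm into
  oscillation inside cells and squares of cell integrals. Added over \<open>m\<close> scales, the
  left side grows like \<open>m\<close>, whereas the oscillations together remain below
  \<open>C * log_form w w\<close> with \<open>C\<close> independent of \<open>m\<close>. Only cells
  meeting \<open>\<Omega>\<close> are summed, since \<open>w\<close> vanishes elsewhere.\<close>

lemma cells_inequality:
  fixes \<Omega> :: "'a::euclidean_space set"
  assumes \<Omega>: "open \<Omega>" "bounded \<Omega>"
  shows "\<exists>C\<ge>0. \<forall>m w. w \<in> H_log \<longrightarrow> w \<in> L2_on \<Omega> \<longrightarrow>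
     real m * (LINT x|lborel. (w x)\<^sup>2) \<le> C * log_form w w +
       (\<Sum>k<m. \<Sum>p\<in>cell k ` \<Omega>. (2 ^ k) ^ DIM('a) * (LINT x|lborel. indicator (cell k -` {p}) x * w x)\<^sup>2)"
proof -
  let ?N = "DIM('a)"
  obtain C where C: "C \<ge> 0" "\<And>m (x::'a) y. x \<noteq> y \<Longrightarrow>
     (\<Sum>k<m. (2 ^ k) ^ ?N * (if cell k x = cell k y then 1 else 0)) \<le> C * log_kernel (x - y)"
    using cells_le_kernel[where 'a='a] by blast
  have "real m * (LINT x|lborel. (w x)\<^sup>2) \<le> C * log_form w w +
       (\<Sum>k<m. \<Sum>p\<in>cell k ` \<Omega>. (2 ^ k) ^ ?N * (LINT x|lborel. indicator (cell k -` {p}) x * w x)\<^sup>2)"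
    if wH: "w \<in> H_log" and wL: "w \<in> L2_on \<Omega>" for m w
  proof -
    have wm [measurable]: "w \<in> borel_measurable borel" and w2: "integrable lborel (\<lambda>x. (w x)\<^sup>2)"
      and ae: "AE x in lborel. x \<notin> \<Omega> \<longrightarrow> w x = 0" using wL by (auto simp: L2_on_iff)
    have l2: "integrable (lborel \<Otimes>\<^sub>M lborel) (\<lambda>p. (lift2 w p)\<^sup>2)" using wH by (simp add: H_log_iff)
    define Q where "Q k p = cell k -` {p}" for k and p :: 'a
    have Qm [measurable]: "Q k p \<in> sets borel" for k p unfolding Q_def by (rule cell_vimage_measurable)
    have Qv: "emeasure lborel (Q k p) = ennreal ((1 / 2 ^ k) ^ ?N)" if p: "p \<in> cell k ` \<Omega>" for k p
    proof -
      obtain x where "p = cell k x" using p by blast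
      then show ?thesis using cell_emeasure[of k x] by (simp add: Q_def)
    qed
    define d where "d k p z = indicator (Q k p) (fst z) * indicator (Q k p) (snd z) * (w (fst z) - w (snd z))\<^sup>2"
      for k p and z :: "'a \<times> 'a"
    have dm [measurable]: "d k p \<in> borel_measurable (lborel \<Otimes>\<^sub>M lborel)" for k p
      unfolding d_def[abs_def] by measurable
    have d0: "0 \<le> d k p z" for k p z by (simp add: d_def)
    have dsum: "(\<Sum>k<m. \<Sum>p\<in>cell k ` \<Omega>. (2 ^ k) ^ ?N * d k p z) \<le> C * (lift2 w z)\<^sup>2" for m z
    proof -
      obtain x y where z: "z = (x, y)" by (cases z)
      show ?thesis
      proof (cases "x = y")
        case True
        then show ?thesis using C(1) by (simp add: d_def z)
      next
        case False
        \<comment> \<open>For a fixed pair at most one cell contributes, namely that of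
          \<open>x\<close>, and only if \<open>y\<close> lies in it too. It may fail to meet
          \<open>\<Omega>\<close>, hence an inequality.\<close>
        have "(\<Sum>p\<in>cell k ` \<Omega>. (2 ^ k) ^ ?N * d k p z) \<le> (2 ^ k) ^ ?N * (if cell k x = cell k y then 1 else 0) * (w x - w y)\<^sup>2" for k
        proof -
          have "(\<Sum>p\<in>cell k ` \<Omega>. (2 ^ k) ^ ?N * d k p z)
              = (\<Sum>p\<in>cell k ` \<Omega>. if p = cell k x then (2 ^ k) ^ ?N * (if cell k x = cell k y then 1 else 0) * (w x - w y)\<^sup>2 else 0)"
            by (intro sum.cong refl) (auto simp: d_def z Q_def indicator_def)
          also have "\<dots> \<le> (2 ^ k) ^ ?N * (if cell k x = cell k y then 1 else 0) * (w x - w y)\<^sup>2"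
            using finite_cells[OF \<Omega>(2), of k] by (simp add: sum.delta)
          finally show ?thesis .
        qed
        then have "(\<Sum>k<m. \<Sum>p\<in>cell k ` \<Omega>. (2 ^ k) ^ ?N * d k p z)
            \<le> (\<Sum>k<m. (2 ^ k) ^ ?N * (if cell k x = cell k y then 1 else 0) * (w x - w y)\<^sup>2)"
          by (intro sum_mono)
        also have "\<dots> = (\<Sum>k<m. (2 ^ k) ^ ?N * (if cell k x = cell k y then 1 else 0)) * (w x - w y)\<^sup>2"
          by (simp add: sum_distrib_right)
        also have "\<dots> \<le> C * log_kernel (x - y) * (w x - w y)\<^sup>2"
          using C(2)[OF False] by (intro mult_right_mono) auto
        also have "\<dots> = C * (lift2 w z)\<^sup>2" by (simp add: z lift2_def power_mult_distrib)
        finally show ?thesis .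
      qed
    qed
    have dint: "integrable (lborel \<Otimes>\<^sub>M lborel) (d k p)" if p: "p \<in> cell k ` \<Omega>" for k p
    proof (rule Bochner_Integration.integrable_bound)
      show "integrable (lborel \<Otimes>\<^sub>M lborel) (\<lambda>z. C * (lift2 w z)\<^sup>2)" using l2 by simp
      have "norm (d k p z) \<le> norm (C * (lift2 w z)\<^sup>2)" for z
      proof -
        have "1 * d k p z \<le> (2 ^ k) ^ ?N * d k p z" using d0 by (intro mult_right_mono) auto
        also have "\<dots> \<le> (\<Sum>p\<in>cell k ` \<Omega>. (2 ^ k) ^ ?N * d k p z)"
          using p d0 finite_cells[OF \<Omega>(2), of k] by (intro member_le_sum) auto
        also have "\<dots> \<le> (\<Sum>k<Suc k. \<Sum>p\<in>cell k ` \<Omega>. (2 ^ k) ^ ?N * d k p z)"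
          using d0 by (intro member_le_sum sum_nonneg) auto
        also have "\<dots> \<le> C * (lift2 w z)\<^sup>2" by (rule dsum)
        finally show ?thesis using d0[of k p z] by simp
      qed
      then show "AE z in lborel \<Otimes>\<^sub>M lborel. norm (d k p z) \<le> norm (C * (lift2 w z)\<^sup>2)" by simp
    qed measurable
    define l where "l k p = (LINT x|lborel. indicator (Q k p) x * w x)" for k p
    have one: "(LINT x|lborel. indicator (Q k p) x * (w x)\<^sup>2)
        = 1 / 2 * (2 ^ k) ^ ?N * integral\<^sup>L (lborel \<Otimes>\<^sub>M lborel) (d k p) + (2 ^ k) ^ ?N * (l k p)\<^sup>2"
      if p: "p \<in> cell k ` \<Omega>" for k p
    proof -
      have mQ: "measure lborel (Q k p) = (1 / 2 ^ k) ^ ?N" using Qv[OF p] by (simp add: measure_def)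
      have "integral\<^sup>L (lborel \<Otimes>\<^sub>M lborel) (d k p)
          = 2 * measure lborel (Q k p) * (LINT x|lborel. indicator (Q k p) x * (w x)\<^sup>2) - 2 * (l k p)\<^sup>2"
        unfolding d_def[abs_def] l_def using dint[OF p] Qv[OF p]
        by (intro integral_pair_difference_square) (auto simp: w2 d_def[abs_def])
      moreover have "(2 ^ k) ^ ?N * (1 / 2 ^ k) ^ ?N = (1::real)" by (simp add: power_mult_distrib[symmetric])
      moreover have "1 / 2 * B * (2 * v * S - 2 * t) + B * t = (B * v) * S" for B v S t :: real
        by (simp add: algebra_simps)
      ultimately show ?thesis unfolding mQ by simp
    qed
    have all: "(LINT x|lborel. (w x)\<^sup>2) = (\<Sum>p\<in>cell k ` \<Omega>. LINT x|lborel. indicator (Q k p) x * (w x)\<^sup>2)" for k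
    proof -
      have i: "integrable lborel (\<lambda>x. indicator (Q k p) x * (w x)\<^sup>2)" for p
        by (rule Bochner_Integration.integrable_bound[OF w2]) (auto simp: indicator_def)
      have "(LINT x|lborel. (w x)\<^sup>2) = (LINT x|lborel. (\<Sum>p\<in>cell k ` \<Omega>. indicator (Q k p) x * (w x)\<^sup>2))"
      proof (rule integral_cong_AE)
        show "AE x in lborel. (w x)\<^sup>2 = (\<Sum>p\<in>cell k ` \<Omega>. indicator (Q k p) x * (w x)\<^sup>2)"
          using ae
        proof eventually_elim
          case (elim x)
          show ?case
          proof (cases "x \<in> \<Omega>")
            case True
            have "(\<Sum>p\<in>cell k ` \<Omega>. indicator (Q k p) x * (w x)\<^sup>2) = (\<Sum>p\<in>cell k ` \<Omega>. if p = cell k x then (w x)\<^sup>2 else 0)"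
              by (intro sum.cong refl) (auto simp: Q_def indicator_def)
            then show ?thesis using True finite_cells[OF \<Omega>(2), of k] by (simp add: sum.delta)
          qed (use elim in simp)
        qed
      qed auto
      also have "\<dots> = (\<Sum>p\<in>cell k ` \<Omega>. LINT x|lborel. indicator (Q k p) x * (w x)\<^sup>2)"
        using i by (intro Bochner_Integration.integral_sum)
      finally show ?thesis .
    qed
    have "real m * (LINT x|lborel. (w x)\<^sup>2) = (\<Sum>k<m. \<Sum>p\<in>cell k ` \<Omega>. LINT x|lborel. indicator (Q k p) x * (w x)\<^sup>2)"
      using all by simp
    also have "\<dots> = (\<Sum>k<m. \<Sum>p\<in>cell k ` \<Omega>. 1 / 2 * (2 ^ k) ^ ?N * integral\<^sup>L (lborel \<Otimes>\<^sub>M lborel) (d k p) + (2 ^ k) ^ ?N * (l k p)\<^sup>2)"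
      by (intro sum.cong refl one)
    also have "\<dots> = 1 / 2 * (\<Sum>k<m. \<Sum>p\<in>cell k ` \<Omega>. (2 ^ k) ^ ?N * integral\<^sup>L (lborel \<Otimes>\<^sub>M lborel) (d k p))
        + (\<Sum>k<m. \<Sum>p\<in>cell k ` \<Omega>. (2 ^ k) ^ ?N * (l k p)\<^sup>2)"
      by (simp add: sum.distrib sum_distrib_left mult.assoc)
    also have "(\<Sum>k<m. \<Sum>p\<in>cell k ` \<Omega>. (2 ^ k) ^ ?N * integral\<^sup>L (lborel \<Otimes>\<^sub>M lborel) (d k p))
        = (LINT z|(lborel \<Otimes>\<^sub>M lborel). (\<Sum>k<m. \<Sum>p\<in>cell k ` \<Omega>. (2 ^ k) ^ ?N * d k p z))"
      using dint by simp
    also have "\<dots> \<le> (LINT z|(lborel \<Otimes>\<^sub>M lborel). C * (lift2 w z)\<^sup>2)"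
      using dint l2 dsum by (intro integral_mono) auto
    finally show ?thesis by (simp add: log_form_lift2 power2_eq_square l_def Q_def)
  qed
  then show ?thesis using C(1) by blast
qed

text \<open>Bolzano-Weierstrass with a diagonal argument. The diagonal sequence is a subsequence of
  the \<open>i\<close>-th one only after its first terms, which do not affect convergence.\<close>

lemma diagonal_convergent_subsequence:
  fixes L :: "nat \<Rightarrow> nat \<Rightarrow> real"
  assumes "\<And>i. \<exists>B. \<forall>n. \<bar>L i n\<bar> \<le> B"
  shows "\<exists>r. strict_mono r \<and> (\<forall>i. convergent (\<lambda>n. L i (r n)))"
proof -
  interpret subseqs "\<lambda>i s. convergent (\<lambda>n. L i (s n))"
  proof
    fix i :: nat and s :: "nat \<Rightarrow> nat"
    obtain B where "\<And>n. \<bar>L i n\<bar> \<le> B" using assms by blast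
    then have "bounded (range (\<lambda>n. L i (s n)))" by (auto intro!: boundedI)
    then obtain l r where "strict_mono r" "((\<lambda>n. L i (s n)) \<circ> r) \<longlonglongrightarrow> l"
      using bounded_imp_convergent_subsequence by blast
    then show "\<exists>r'. strict_mono r' \<and> convergent (\<lambda>n. L i ((s \<circ> r') n))"
      by (auto simp: convergent_def o_def)
  qed
  have "convergent (\<lambda>n. L i ((diagseq \<circ> (+) (Suc i)) n))" for i
  proof (rule diagseq_holds)
    fix r s :: "nat \<Rightarrow> nat" and n assume "strict_mono r" "convergent (\<lambda>m. L n (s m))"
    then show "convergent (\<lambda>m. L n ((s \<circ> r) m))"
      using convergent_subseq_convergent[of "\<lambda>m. L n (s m)" r] by (simp add: o_def)
  qed
  moreover have "(\<lambda>n. L i ((diagseq \<circ> (+) (Suc i)) n)) = (\<lambda>n. L i (diagseq (n + Suc i)))" for i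
    by (simp add: fun_eq_iff add.commute)
  ultimately have "convergent (\<lambda>n. L i (diagseq (n + Suc i)))" for i by metis
  then have "convergent (\<lambda>n. L i (diagseq n))" for i
    using convergent_ignore_initial_segment[of "\<lambda>n. L i (diagseq n)" "Suc i"] by blast
  then show ?thesis using subseq_diagseq by blast
qed

text \<open>The cell integrals form a countable family of bounded sequences, so one subsequence
  makes them all converge. For given tolerance the number of scales is fixed first, to make the
  energy term small, and then finitely many cell integrals are close to their limits.\<close>

lemma compact_embedding:
  fixes \<Omega> :: "'a::euclidean_space set"
  assumes \<Omega>: "open \<Omega>" "bounded \<Omega>" "\<Omega> \<noteq> {}"
    and s: "\<And>n. s n \<in> H0_log \<Omega>" "\<And>n. log_form (s n) (s n) \<le> C0"
  shows "\<exists>r::nat \<Rightarrow> nat. strict_mono r \<and>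
    (\<forall>e>0. \<exists>N. \<forall>i\<ge>N. \<forall>j\<ge>N. L2_inner \<Omega> (s (r i) - s (r j)) (s (r i) - s (r j)) < e)"
proof -
  let ?N = "DIM('a)"
  have \<Omega>m [measurable]: "\<Omega> \<in> sets borel" using \<Omega> by simp
  have sH: "s n \<in> H_log" and sL: "s n \<in> L2_on \<Omega>" for n
    using s(1) by (auto intro: H0_log_subset_H_log H0_log_subset_L2_on[OF \<Omega>(1)])
  have sm [measurable]: "s n \<in> borel_measurable borel" and s2: "integrable lborel (\<lambda>x. (s n x)\<^sup>2)" for n
    using sL by (auto simp: L2_on_iff)
  obtain c where c: "c > 0" "\<And>u. u \<in> H_log \<Longrightarrow> u \<in> L2_on \<Omega> \<Longrightarrow> c * (LINT x|lborel. (u x)\<^sup>2) \<le> log_form u u"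
    using poincare[OF \<Omega>(1,2)] by blast
  obtain C where C: "C \<ge> 0" "\<And>m w. w \<in> H_log \<Longrightarrow> w \<in> L2_on \<Omega> \<Longrightarrow>
     real m * (LINT x|lborel. (w x)\<^sup>2) \<le> C * log_form w w +
       (\<Sum>k<m. \<Sum>p\<in>cell k ` \<Omega>. (2 ^ k) ^ ?N * (LINT x|lborel. indicator (cell k -` {p}) x * w x)\<^sup>2)"
    using cells_inequality[OF \<Omega>(1,2)] by blast
  define l where "l n k p = (LINT x|lborel. indicator (cell k -` {p}) x * s n x)" for n k and p :: 'a
  have fin: "emeasure lborel (cell k -` {p}) < \<infinity>" if p: "p \<in> cell k ` \<Omega>" for k p
  proof -
    obtain x where "p = cell k x" using p by blast
    then show ?thesis using cell_emeasure[of k x] by simp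
  qed
  have li: "integrable lborel (\<lambda>x. indicator (cell k -` {p}) x * s n x)" if "p \<in> cell k ` \<Omega>" for n k p
    using fin[OF that] s2 by (intro integrable_mult_of_squares) (auto simp: indicator_square)
  have C0: "0 \<le> C0" using s(2)[of 0] E.nonneg[OF sH[of 0]] by linarith
  have s2b: "(LINT x|lborel. (s n x)\<^sup>2) \<le> C0 / c" for n
    using c(2)[OF sH sL, of n] s(2)[of n] c(1) by (simp add: field_simps)
  \<comment> \<open>All pairs of a scale and a cell meeting \<open>\<Omega>\<close>: countable
    because each scale has finitely many, and nonempty so that it can be enumerated.\<close>
  define I where "I = (SIGMA k:UNIV. cell k ` \<Omega>)"
  have I: "countable I" unfolding I_def
    by (intro countable_SIGMA) (auto intro: countable_finite finite_cells[OF \<Omega>(2)])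
  have I_ne: "I \<noteq> {}" using \<Omega>(3) by (auto simp: I_def)
  define e where "e = from_nat_into I"
  have eI: "snd (e i) \<in> cell (fst (e i)) ` \<Omega>" for i
    using from_nat_into[OF I_ne, of i] by (auto simp: e_def I_def)
  have "\<exists>B. \<forall>n. \<bar>l n (fst (e i)) (snd (e i))\<bar> \<le> B" for i
  proof (intro exI allI)
    fix n
    let ?Q = "cell (fst (e i)) -` {snd (e i)}"
    have iQ: "integrable lborel (indicat_real ?Q)" using fin[OF eI[of i]] by simp
    have "\<bar>l n (fst (e i)) (snd (e i))\<bar> \<le> (LINT x|lborel. \<bar>indicator ?Q x * s n x\<bar>)"
      unfolding l_def by (rule integral_abs_bound)
    also have "\<dots> \<le> (LINT x|lborel. indicator ?Q x + (s n x)\<^sup>2)"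
    proof (rule integral_mono)
      have "\<bar>t\<bar> \<le> 1 + t\<^sup>2" for t :: real
        using sum_squares_bound[of "\<bar>t\<bar>" 1] by simp
      then show "\<bar>indicator ?Q x * s n x\<bar> \<le> indicator ?Q x + (s n x)\<^sup>2" for x
        by (auto simp: indicator_def)
    qed (use li[OF eI[of i]] iQ s2 in auto)
    also have "\<dots> \<le> measure lborel ?Q + C0 / c" using iQ s2 s2b[of n] by simp
    finally show "\<bar>l n (fst (e i)) (snd (e i))\<bar> \<le> measure lborel ?Q + C0 / c" .
  qed
  then obtain r where r: "strict_mono r" "\<And>i. convergent (\<lambda>n. l (r n) (fst (e i)) (snd (e i)))"
    using diagonal_convergent_subsequence[of "\<lambda>i n. l n (fst (e i)) (snd (e i))"] by blast
  have conv: "convergent (\<lambda>n. l (r n) k p)" if "p \<in> cell k ` \<Omega>" for k p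
  proof -
    have "(k, p) \<in> I" using that by (auto simp: I_def)
    then obtain i where "e i = (k, p)" using from_nat_into_surj[OF I] by (auto simp: e_def)
    then show ?thesis using r(2)[of i] by simp
  qed
  \<comment> \<open>The low-frequency part of the squared distance between two members of the
    subsequence; the product filter expresses that both indices tend to infinity.\<close>
  define \<Phi> where "\<Phi> m ij = (\<Sum>k<m. \<Sum>p\<in>cell k ` \<Omega>. (2 ^ k) ^ ?N * (l (r (fst ij)) k p - l (r (snd ij)) k p)\<^sup>2)" for m ij
  have lim: "(\<Phi> m \<longlongrightarrow> 0) (sequentially \<times>\<^sub>F sequentially)" for m
  proof -
    have "((\<lambda>ij. (2 ^ k) ^ ?N * (l (r (fst ij)) k p - l (r (snd ij)) k p)\<^sup>2) \<longlongrightarrow> 0) (sequentially \<times>\<^sub>F sequentially)"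
      if p: "p \<in> cell k ` \<Omega>" for k p
    proof -
      obtain a where a: "(\<lambda>n. l (r n) k p) \<longlonglongrightarrow> a" using conv[OF p] by (auto simp: convergent_def)
      have "((\<lambda>ij. l (r (fst ij)) k p) \<longlongrightarrow> a) (sequentially \<times>\<^sub>F sequentially)"
        using filterlim_compose[OF a filterlim_fst] .
      moreover have "((\<lambda>ij. l (r (snd ij)) k p) \<longlongrightarrow> a) (sequentially \<times>\<^sub>F sequentially)"
        using filterlim_compose[OF a filterlim_snd] .
      ultimately have "((\<lambda>ij. (2 ^ k) ^ ?N * (l (r (fst ij)) k p - l (r (snd ij)) k p)\<^sup>2) \<longlongrightarrow> (2 ^ k) ^ ?N * (a - a)\<^sup>2) (sequentially \<times>\<^sub>F sequentially)"
        by (intro tendsto_intros)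
      then show ?thesis by simp
    qed
    then have "(\<Phi> m \<longlongrightarrow> (\<Sum>k<m. \<Sum>p\<in>cell k ` \<Omega>. 0)) (sequentially \<times>\<^sub>F sequentially)"
      unfolding \<Phi>_def[abs_def] by (intro tendsto_sum) auto
    then show ?thesis by simp
  qed
  have "\<exists>N. \<forall>i\<ge>N. \<forall>j\<ge>N. L2_inner \<Omega> (s (r i) - s (r j)) (s (r i) - s (r j)) < \<epsilon>" if \<epsilon>: "\<epsilon> > 0" for \<epsilon>
  proof -
    \<comment> \<open>Differences have energy at most \<open>4 * C0\<close>, so this choice keeps
      the energy term below half of \<open>real m * \<epsilon>\<close>.\<close>
    obtain m where m: "4 * C * C0 * 2 / \<epsilon> < real m" using reals_Archimedean2 by blast
    have m0: "real m > 0" using m C(1) C0 \<epsilon> by (smt (verit) divide_nonneg_pos mult_nonneg_nonneg)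
    have "\<forall>\<^sub>F ij in sequentially \<times>\<^sub>F sequentially. \<Phi> m ij < real m * \<epsilon> / 2"
      using order_tendstoD(2)[OF lim[of m], of "real m * \<epsilon> / 2"] m0 \<epsilon> by simp
    then obtain N where N: "\<And>i j. i \<ge> N \<Longrightarrow> j \<ge> N \<Longrightarrow> \<Phi> m (i, j) < real m * \<epsilon> / 2"
      unfolding eventually_prod_sequentially by blast
    have "L2_inner \<Omega> (s (r i) - s (r j)) (s (r i) - s (r j)) < \<epsilon>" if "i \<ge> N" "j \<ge> N" for i j
    proof -
      define w where "w = s (r i) - s (r j)"
      have wH: "w \<in> H_log" using sH by (simp add: w_def)
      have wL: "w \<in> L2_on \<Omega>" using sL by (simp add: w_def subspace_diff[OF subspace_L2_on])
      have b: "L2_inner \<Omega> w w = (LINT x|lborel. (w x)\<^sup>2)"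
        using L2_inner_eq[OF wL H_log_measurable[OF wH] \<Omega>m] by (simp add: power2_eq_square)
      have "log_form w w \<le> 2 * log_form (s (r i)) (s (r i)) + 2 * log_form (s (r j)) (s (r j))"
        unfolding w_def by (rule E.diff_le[OF sH sH])
      then have aw: "log_form w w \<le> 4 * C0" using s(2)[of "r i"] s(2)[of "r j"] by linarith
      have lw: "(LINT x|lborel. indicator (cell k -` {p}) x * w x) = l (r i) k p - l (r j) k p"
        if p: "p \<in> cell k ` \<Omega>" for k p
        unfolding l_def w_def using li[OF p] by (simp add: right_diff_distrib)
      have "real m * (LINT x|lborel. (w x)\<^sup>2) \<le> C * log_form w w + \<Phi> m (i, j)"
        using C(2)[OF wH wL, of m] by (simp add: \<Phi>_def lw)
      also have "\<dots> < C * (4 * C0) + real m * \<epsilon> / 2"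
        using aw C(1) N[OF that] by (intro add_le_less_mono mult_left_mono) auto
      also have "C * (4 * C0) \<le> real m * \<epsilon> / 2" using m \<epsilon> by (simp add: field_simps)
      finally have "real m * (LINT x|lborel. (w x)\<^sup>2) < real m * \<epsilon>" by linarith
      then show ?thesis using m0 b by (simp add: w_def)
    qed
    then show ?thesis by blast
  qed
  then show ?thesis using r(1) by blast
qed

section \<open>Completeness\<close>

text \<open>Fatou's lemma for nonnegative real functions, giving integrability of the limit together
  with the bound.\<close>

lemma integral_le_of_AE_tendsto:
  fixes g :: "nat \<Rightarrow> 'a \<Rightarrow> real"
  assumes [measurable]: "\<And>i. g i \<in> borel_measurable M" "h \<in> borel_measurable M"
    and nonneg: "\<And>i x. 0 \<le> g i x" "\<And>x. 0 \<le> h x"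
    and lim: "AE x in M. (\<lambda>i. g i x) \<longlonglongrightarrow> h x"
    and int: "\<And>i. integrable M (g i)" and le: "\<forall>\<^sub>F i in sequentially. integral\<^sup>L M (g i) \<le> e" and e: "0 \<le> e"
  shows "integrable M h \<and> integral\<^sup>L M h \<le> e"
proof -
  have "(\<integral>\<^sup>+x. ennreal (h x) \<partial>M) = (\<integral>\<^sup>+x. liminf (\<lambda>i. ennreal (g i x)) \<partial>M)"
  proof (rule nn_integral_cong_AE)
    show "AE x in M. ennreal (h x) = liminf (\<lambda>i. ennreal (g i x))"
      using lim
    proof eventually_elim
      case (elim x)
      then have "(\<lambda>i. ennreal (g i x)) \<longlonglongrightarrow> ennreal (h x)" by (rule tendsto_ennrealI)
      then show ?case by (intro lim_imp_Liminf[symmetric]) auto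
    qed
  qed
  also have "\<dots> \<le> liminf (\<lambda>i. \<integral>\<^sup>+x. ennreal (g i x) \<partial>M)" by (rule nn_integral_liminf) measurable
  also have "\<dots> \<le> limsup (\<lambda>i. \<integral>\<^sup>+x. ennreal (g i x) \<partial>M)" by (rule Liminf_le_Limsup) simp
  also have "\<dots> \<le> ennreal e"
  proof (rule Limsup_bounded)
    show "\<forall>\<^sub>F i in sequentially. (\<integral>\<^sup>+x. ennreal (g i x) \<partial>M) \<le> ennreal e"
      using le by eventually_elim (simp add: nn_integral_eq_integral[OF int] nonneg ennreal_leI)
  qed
  finally have fin: "(\<integral>\<^sup>+x. ennreal (h x) \<partial>M) \<le> ennreal e" .
  have hi: "integrable M h"
    by (rule integrableI_nonneg) (use fin nonneg in \<open>auto intro: le_less_trans\<close>)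
  then show ?thesis
    using fin e nonneg by (simp add: nn_integral_eq_integral[OF hi])
qed

lemma L2_on_integrable:
  assumes "u \<in> L2_on \<Omega>" "open \<Omega>" "bounded \<Omega>"
  shows "integrable lborel u"
proof -
  have [measurable]: "u \<in> borel_measurable borel" "\<Omega> \<in> sets borel" using assms by (auto simp: L2_on_iff)
  have "emeasure lborel \<Omega> < \<infinity>" using assms(3) by (rule emeasure_bounded_finite)
  then have i: "integrable lborel (\<lambda>x. indicator \<Omega> x * u x)"
    using assms(1) by (intro integrable_mult_of_squares) (auto simp: indicator_square L2_on_iff)
  have "AE x in lborel. x \<notin> \<Omega> \<longrightarrow> u x = 0" using assms(1) by (simp add: L2_on_iff)
  then show ?thesis using i by (subst integrable_cong_AE[where g="\<lambda>x. indicator \<Omega> x * u x"]) (auto simp: indicator_def)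
qed

text \<open>A Cauchy sequence for the form is Cauchy in \<open>L\<^sup>2\<close> by Poincare, and in
  \<open>L\<^sup>1\<close> because \<open>\<Omega>\<close> has finite measure. A subsequence
  therefore converges almost everywhere, also for pairs of points, and Fatou turns the Cauchy bounds
  into bounds on the distance to the pointwise limit.\<close>

lemma H0_log_complete:
  fixes \<Omega> :: "'a::euclidean_space set"
  assumes \<Omega>: "open \<Omega>" "bounded \<Omega>" and s: "\<And>n. s n \<in> H0_log \<Omega>"
    and cau: "\<And>e. e > 0 \<Longrightarrow> \<exists>N. \<forall>i\<ge>N. \<forall>j\<ge>N. log_form (s i - s j) (s i - s j) < e"
  shows "\<exists>u\<in>H0_log \<Omega>. (\<lambda>n. log_form (s n - u) (s n - u)) \<longlonglongrightarrow> 0"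
proof -
  have [measurable]: "\<Omega> \<in> sets borel" using \<Omega> by simp
  have sH: "s n \<in> H_log" and sL: "s n \<in> L2_on \<Omega>" for n
    using s by (auto intro: H0_log_subset_H_log H0_log_subset_L2_on[OF \<Omega>(1)])
  have sm [measurable]: "s n \<in> borel_measurable borel" for n using sH by (rule H_log_measurable)
  have dH: "s i - s j \<in> H_log" and dL: "s i - s j \<in> L2_on \<Omega>" for i j
    using sH sL by (auto intro: subspace_diff[OF subspace_L2_on])
  obtain c where c: "c > 0" "\<And>u. u \<in> H_log \<Longrightarrow> u \<in> L2_on \<Omega> \<Longrightarrow> c * (LINT x|lborel. (u x)\<^sup>2) \<le> log_form u u"
    using poincare[OF \<Omega>] by blast
  have fin: "emeasure lborel \<Omega> < \<infinity>" using \<Omega>(2) by (rule emeasure_bounded_finite)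
  define V where "V = measure lborel \<Omega>"
  have V0: "V \<ge> 0" by (simp add: V_def)
  have L1: "\<exists>N. \<forall>i\<ge>N. \<forall>j\<ge>N. (LINT x|lborel. norm (s i x - s j x)) < e" if e: "e > 0" for e
  proof -
    \<comment> \<open>The pointwise bound
      \<open>\<bar>t\<bar> \<le> \<delta> + t^2 / \<delta>\<close> compares the two norms. This
      \<open>\<delta>\<close> makes the first term contribute at most \<open>e / 2\<close>;
      \<open>V + 1\<close> allows for \<open>V = 0\<close>.\<close>
    define \<delta> where "\<delta> = e / (2 * (V + 1))"
    have \<delta>: "\<delta> > 0" using e V0 by (simp add: \<delta>_def)
    have "c * (\<delta> * e / 2) > 0" using c \<delta> e by simp
    then obtain N where N: "\<And>i j. i \<ge> N \<Longrightarrow> j \<ge> N \<Longrightarrow> log_form (s i - s j) (s i - s j) < c * (\<delta> * e / 2)"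
      using cau by blast
    have "(LINT x|lborel. norm (s i x - s j x)) < e" if "i \<ge> N" "j \<ge> N" for i j
    proof -
      have b: "(LINT x|lborel. ((s i - s j) x)\<^sup>2) < \<delta> * e / 2"
        using c(2)[OF dH dL, of i j] N[OF that] c(1) by (smt (verit) mult_le_cancel_left_pos)
      have ae: "AE x in lborel. x \<notin> \<Omega> \<longrightarrow> (s i - s j) x = 0" using dL by (simp add: L2_on_iff)
      have i2: "integrable lborel (\<lambda>x. ((s i - s j) x)\<^sup>2)" using dL by (simp add: L2_on_iff)
      have "(LINT x|lborel. norm (s i x - s j x)) \<le> (LINT x|lborel. \<delta> * indicator \<Omega> x + ((s i - s j) x)\<^sup>2 / \<delta>)"
      proof (rule integral_mono_AE)
        show "integrable lborel (\<lambda>x. norm (s i x - s j x))"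
          using L2_on_integrable[OF dL \<Omega>] by (simp add: fun_diff_def)
        show "integrable lborel (\<lambda>x. \<delta> * indicator \<Omega> x + ((s i - s j) x)\<^sup>2 / \<delta>)"
          using i2 fin by simp
        show "AE x in lborel. norm (s i x - s j x) \<le> \<delta> * indicator \<Omega> x + ((s i - s j) x)\<^sup>2 / \<delta>"
          using ae
        proof eventually_elim
          case (elim x)
          have t: "\<bar>t\<bar> \<le> \<delta> + t\<^sup>2 / \<delta>" for t
          proof (cases "\<bar>t\<bar> \<le> \<delta>")
            case False
            then have "\<bar>t\<bar> * \<delta> \<le> \<bar>t\<bar> * \<bar>t\<bar>" by (intro mult_left_mono) auto
            then have "\<bar>t\<bar> \<le> t\<^sup>2 / \<delta>" using \<delta> by (simp add: field_simps power2_eq_square)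
            then show ?thesis using \<delta> by simp
          qed (use \<delta> in \<open>simp add: add_increasing2\<close>)
          show ?case using t[of "(s i - s j) x"] elim by (cases "x \<in> \<Omega>") (auto simp: fun_diff_def)
        qed
      qed
      also have "\<dots> = \<delta> * V + (LINT x|lborel. ((s i - s j) x)\<^sup>2) / \<delta>"
        using i2 fin by (simp add: V_def)
      also have "\<dots> < e / 2 + e / 2"
      proof (rule add_le_less_mono)
        show "\<delta> * V \<le> e / 2" using V0 e by (simp add: \<delta>_def field_simps)
        show "(LINT x|lborel. ((s i - s j) x)\<^sup>2) / \<delta> < e / 2" using b \<delta> by (simp add: field_simps)
      qed
      finally show ?thesis by simp
    qed
    then show ?thesis by blast
  qed
  obtain r where r: "strict_mono r" "AE x in lborel. Cauchy (\<lambda>i. s (r i) x)"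
    by (rule cauchy_L1_AE_cauchy_subseq[of lborel s]) (use L2_on_integrable[OF sL \<Omega>] L1 in auto)
  define u where "u x = lim (\<lambda>i. s (r i) x)" for x
  have um [measurable]: "u \<in> borel_measurable borel" unfolding u_def[abs_def] by measurable
  have lim: "AE x in lborel. (\<lambda>i. s (r i) x) \<longlonglongrightarrow> u x"
    using r(2) by eventually_elim (simp add: u_def Cauchy_convergent convergent_LIMSEQ_iff[symmetric])
  have limp: "AE p in lborel \<Otimes>\<^sub>M lborel. (\<lambda>i. s (r i) (fst p)) \<longlonglongrightarrow> u (fst p) \<and> (\<lambda>i. s (r i) (snd p)) \<longlonglongrightarrow> u (snd p)"
    by (rule AE_pair_lborel[OF lim])
  \<comment> \<open>Of the factor \<open>1 / c + 1\<close>, the 1 is the energy and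
    \<open>1 / c\<close> the \<open>L\<^sup>2\<close> part bounded through Poincare.\<close>
  have key: "s m - u \<in> H_log \<and> H_form (s m - u) (s m - u) \<le> (1 / c + 1) * e"
    if e: "e > 0" and N: "\<And>i j. i \<ge> N \<Longrightarrow> j \<ge> N \<Longrightarrow> log_form (s i - s j) (s i - s j) < e" and m: "m \<ge> N" for e N m
  proof -
    have ev: "\<forall>\<^sub>F i in sequentially. log_form (s m - s (r i)) (s m - s (r i)) < e"
      using eventually_ge_at_top[of N]
    proof eventually_elim
      case (elim i)
      then have "r i \<ge> N" using strict_mono_imp_increasing[OF r(1), of i] by simp
      then show ?case using N[OF m] by simp
    qed
    have l: "integrable (lborel \<Otimes>\<^sub>M lborel) (\<lambda>p. (lift2 (s m - u) p)\<^sup>2) \<and>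
        (LINT p|(lborel \<Otimes>\<^sub>M lborel). (lift2 (s m - u) p)\<^sup>2) \<le> 2 * e"
    proof (rule integral_le_of_AE_tendsto[where g="\<lambda>i p. (lift2 (s m - s (r i)) p)\<^sup>2"])
      show "AE p in lborel \<Otimes>\<^sub>M lborel. (\<lambda>i. (lift2 (s m - s (r i)) p)\<^sup>2) \<longlonglongrightarrow> (lift2 (s m - u) p)\<^sup>2"
        using limp by eventually_elim (auto simp: lift2_def intro!: tendsto_intros)
      show "integrable (lborel \<Otimes>\<^sub>M lborel) (\<lambda>p. (lift2 (s m - s (r i)) p)\<^sup>2)" for i
        using dH[of m "r i"] by (simp add: H_log_iff)
      show "\<forall>\<^sub>F i in sequentially. (LINT p|(lborel \<Otimes>\<^sub>M lborel). (lift2 (s m - s (r i)) p)\<^sup>2) \<le> 2 * e"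
        using ev by eventually_elim (simp add: log_form_lift2 power2_eq_square)
    qed (use e in \<open>auto simp: fun_diff_def\<close>)
    have l': "integrable lborel (\<lambda>x. ((s m - u) x)\<^sup>2) \<and> (LINT x|lborel. ((s m - u) x)\<^sup>2) \<le> e / c"
    proof (rule integral_le_of_AE_tendsto[where g="\<lambda>i x. ((s m - s (r i)) x)\<^sup>2"])
      show "AE x in lborel. (\<lambda>i. ((s m - s (r i)) x)\<^sup>2) \<longlonglongrightarrow> ((s m - u) x)\<^sup>2"
        using lim by eventually_elim (auto intro!: tendsto_intros)
      show "integrable lborel (\<lambda>x. ((s m - s (r i)) x)\<^sup>2)" for i
        using dH[of m "r i"] by (simp only: H_log_iff)
      show "\<forall>\<^sub>F i in sequentially. (LINT x|lborel. ((s m - s (r i)) x)\<^sup>2) \<le> e / c"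
        using ev
      proof eventually_elim
        case (elim i)
        then have "c * (LINT x|lborel. ((s m - s (r i)) x)\<^sup>2) \<le> e" using c(2)[OF dH dL, of m "r i"] by linarith
        then show ?case using c(1) by (simp add: field_simps)
      qed
    qed (use e c in \<open>auto simp: fun_diff_def\<close>)
    have H: "s m - u \<in> H_log" using l l' by (auto simp: H_log_iff fun_diff_def)
    have "L2_inner UNIV (s m - u) (s m - u) = (LINT x|lborel. ((s m - u) x)\<^sup>2)"
      by (simp add: L2_inner_def set_lebesgue_integral_def power2_eq_square)
    moreover have "log_form (s m - u) (s m - u) \<le> e" using l by (simp add: log_form_lift2 power2_eq_square)
    ultimately show ?thesis using H l' by (simp add: H_form_def algebra_simps)
  qed
  obtain N1 where N1: "\<And>i j. i \<ge> N1 \<Longrightarrow> j \<ge> N1 \<Longrightarrow> log_form (s i - s j) (s i - s j) < 1" using cau[of 1] by auto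
  have "s N1 - u \<in> H_log" using key[OF _ N1, of N1] by auto
  then have "s N1 - (s N1 - u) \<in> H_log" by (rule E.mem(3)[OF sH])
  then have uH: "u \<in> H_log" by simp
  have conv: "(\<lambda>n. H_form (s n - u) (s n - u)) \<longlonglongrightarrow> 0"
  proof (rule LIMSEQ_I)
    fix e :: real assume e: "e > 0"
    define d where "d = e / (2 * (1 / c + 1))"
    have c1: "1 / c + 1 > 0" using c by (simp add: add_pos_pos)
    then have d: "d > 0" using e by (simp add: d_def)
    obtain N where N: "\<And>i j. i \<ge> N \<Longrightarrow> j \<ge> N \<Longrightarrow> log_form (s i - s j) (s i - s j) < d" using cau[OF d] by auto
    have de: "(1 / c + 1) * d = e / 2" using c1 unfolding d_def by (simp add: field_simps)
    show "\<exists>no. \<forall>n\<ge>no. norm (H_form (s n - u) (s n - u) - 0) < e"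
    proof (intro exI allI impI)
      fix n assume "n \<ge> N"
      then have "s n - u \<in> H_log" "H_form (s n - u) (s n - u) \<le> e / 2" using key[OF d N, of n] de by auto
      then show "norm (H_form (s n - u) (s n - u) - 0) < e" using H.nonneg[of "s n - u"] e by simp
    qed
  qed
  have "u \<in> H0_log \<Omega>"
  proof (rule H0_log_closed[OF uH])
    fix e :: real assume "e > 0"
    then have "\<forall>\<^sub>F n in sequentially. H_form (s n - u) (s n - u) < e" using order_tendstoD(2)[OF conv] by simp
    then show "\<exists>v\<in>H0_log \<Omega>. H_form (v - u) (v - u) < e" using s by (auto simp: eventually_sequentially)
  qed
  moreover have "(\<lambda>n. log_form (s n - u) (s n - u)) \<longlonglongrightarrow> 0"
    using conv
  proof (rule tendsto_0_le)
    show "0 \<le> log_form (s n - u) (s n - u)" "log_form (s n - u) (s n - u) \<le> H_form (s n - u) (s n - u)" for n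
      using sH uH by (auto intro!: E.nonneg H_form_ge)
  qed
  ultimately show ?thesis by blast
qed

text \<open>The existential hides the Poincare constant: what follows uses the locale but never the
  value of \<open>c\<close>.\<close>

lemma compact_form_H0_log:
  fixes \<Omega> :: "'a::euclidean_space set"
  assumes \<Omega>: "open \<Omega>" "bounded \<Omega>" "\<Omega> \<noteq> {}"
  shows "\<exists>c. compact_form (H0_log \<Omega>) (L2_on \<Omega>) log_form (L2_inner \<Omega>) c"
proof -
  have \<Omega>m [measurable]: "\<Omega> \<in> sets borel" using \<Omega> by simp
  interpret B: psd_form "L2_on \<Omega>" "L2_inner \<Omega>" by (rule psd_form_L2) simp
  have LV: "u \<in> L2_on \<Omega>" if "u \<in> H0_log \<Omega>" for u using that by (rule H0_log_subset_L2_on[OF \<Omega>(1)])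
  have b_eq: "L2_inner \<Omega> u u = (LINT x|lborel. (u x)\<^sup>2)" if "u \<in> L2_on \<Omega>" for u
    using L2_inner_eq[OF that _ \<Omega>m, of u] that by (simp add: L2_on_iff power2_eq_square)
  obtain c where c: "c > 0" "\<And>u. u \<in> H_log \<Longrightarrow> u \<in> L2_on \<Omega> \<Longrightarrow> c * (LINT x|lborel. (u x)\<^sup>2) \<le> log_form u u"
    using poincare[OF \<Omega>(1,2)] by blast
  show ?thesis
  proof (intro exI, unfold_locales)
    show "subspace (H0_log \<Omega>)" by (rule subspace_H0_log)
    fix u v w :: "'a \<Rightarrow> real" and t
    show "log_form u v = log_form v u" if "u \<in> H0_log \<Omega>" "v \<in> H0_log \<Omega>"
      using that by (intro E.sym) (auto intro: H0_log_subset_H_log)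
    show "log_form (u + v) w = log_form u w + log_form v w"
      if "u \<in> H0_log \<Omega>" "v \<in> H0_log \<Omega>" "w \<in> H0_log \<Omega>"
      using that by (intro E.add_left) (auto intro: H0_log_subset_H_log)
    show "log_form (t *\<^sub>R u) w = t * log_form u w" if "u \<in> H0_log \<Omega>" "w \<in> H0_log \<Omega>"
      using that by (intro E.scale_left) (auto intro: H0_log_subset_H_log)
    show "0 \<le> log_form u u" if "u \<in> H0_log \<Omega>"
      using that by (intro E.nonneg) (auto intro: H0_log_subset_H_log)
    show "H0_log \<Omega> \<subseteq> L2_on \<Omega>" using LV by blast
    show "c > 0" by (rule c(1))
    show "c * L2_inner \<Omega> u u \<le> log_form u u" if "u \<in> H0_log \<Omega>"
      using c(2)[OF H0_log_subset_H_log[OF that] LV[OF that]] b_eq[OF LV[OF that]] by simp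
    show "\<exists>g\<in>H0_log \<Omega>. L2_inner \<Omega> (u - g) (u - g) < t" if uL: "u \<in> L2_on \<Omega>" and t: "t > 0"
    proof -
      obtain g where g: "g \<in> Cc_inf \<Omega>" "(LINT x|lborel. (u x - g x)\<^sup>2) < t"
        using Cc_inf_dense_L2[OF \<Omega>(1,2) uL] t unfolding L2_approx_def by blast
      have gV: "g \<in> H0_log \<Omega>" using g(1) by (rule Cc_inf_subset_H0_log)
      then have "u - g \<in> L2_on \<Omega>" using uL LV by (intro B.mem) auto
      then show ?thesis using g(2) gV b_eq by (intro bexI[of _ g]) auto
    qed
    show "\<exists>e::nat \<Rightarrow> 'a \<Rightarrow> real. (\<forall>i. e i \<in> H0_log \<Omega>) \<and> (\<forall>i j. L2_inner \<Omega> (e i) (e j) = (if i = j then 1 else 0))"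
    proof -
      obtain f :: "nat \<Rightarrow> 'a \<Rightarrow> real" where f: "\<And>i. f i \<in> Cc_inf \<Omega>" "\<And>i j x. i \<noteq> j \<Longrightarrow> f i x * f j x = 0"
        "\<And>i. (LINT x|lborel. (f i x)\<^sup>2) > 0"
        using disjoint_test_functions[OF \<Omega>(1,3)] by blast
      have fV: "f i \<in> H0_log \<Omega>" for i using f(1) by (rule Cc_inf_subset_H0_log)
      define e where "e i = (1 / sqrt (LINT x|lborel. (f i x)\<^sup>2)) *\<^sub>R f i" for i
      have "e i \<in> H0_log \<Omega>" for i unfolding e_def using fV by (intro subspace_scale[OF subspace_H0_log])
      moreover have "L2_inner \<Omega> (e i) (e j) = (if i = j then 1 else 0)" for i j
      proof -
        have "L2_inner \<Omega> (f i) (f j) = (if i = j then (LINT x|lborel. (f i x)\<^sup>2) else 0)"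
        proof (cases "i = j")
          case False
          then have "(\<lambda>x. f i x * f j x) = (\<lambda>x. 0)" using f(2) by blast
          then show ?thesis using False by (simp add: L2_inner_def set_lebesgue_integral_def)
        qed (use b_eq[OF LV[OF fV[of i]]] in simp)
        then show ?thesis using LV[OF fV] f(3)[of i]
          by (auto simp: e_def B.expand real_div_sqrt divide_simps)
      qed
      ultimately show ?thesis by blast
    qed
  next
    fix s :: "nat \<Rightarrow> 'a \<Rightarrow> real"
    assume "\<And>n. s n \<in> H0_log \<Omega>" "\<And>e. e > 0 \<Longrightarrow> \<exists>N. \<forall>i\<ge>N. \<forall>j\<ge>N. log_form (s i - s j) (s i - s j) < e"
    then show "\<exists>u\<in>H0_log \<Omega>. (\<lambda>n. log_form (s n - u) (s n - u)) \<longlonglongrightarrow> 0" by (rule H0_log_complete[OF \<Omega>(1,2)])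
  next
    fix s :: "nat \<Rightarrow> 'a \<Rightarrow> real" and C
    assume "\<And>n. s n \<in> H0_log \<Omega>" "\<And>n. log_form (s n) (s n) \<le> C"
    then show "\<exists>r::nat \<Rightarrow> nat. strict_mono r \<and>
        (\<forall>e>0. \<exists>N. \<forall>i\<ge>N. \<forall>j\<ge>N. L2_inner \<Omega> (s (r i) - s (r j)) (s (r i) - s (r j)) < e)"
      by (rule compact_embedding[OF \<Omega>])
  qed
qed

section \<open>The first eigenfunction\<close>

lemma log_form_contraction:
  assumes "u \<in> H_log" "v \<in> H_log" "\<And>x y. \<bar>v x - v y\<bar> \<le> \<bar>u x - u y\<bar>"
  shows "log_form v v \<le> log_form u u"
proof -
  have "(lift2 v p)\<^sup>2 \<le> (lift2 u p)\<^sup>2" for p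
    using assms(3)[of "fst p" "snd p"]
    by (auto simp: lift2_def power_mult_distrib abs_le_square_iff intro!: mult_right_mono)
  then have "(LINT p|(lborel \<Otimes>\<^sub>M lborel). (lift2 v p)\<^sup>2) \<le> (LINT p|(lborel \<Otimes>\<^sub>M lborel). (lift2 u p)\<^sup>2)"
    using assms by (intro integral_mono) (auto simp: H_log_iff)
  then show ?thesis by (simp add: log_form_lift2 power2_eq_square)
qed

lemma H0_log_sequence:
  assumes "u \<in> H0_log \<Omega>"
  shows "\<exists>f. (\<forall>n. f n \<in> Cc_inf \<Omega>) \<and> (\<forall>n. H_form (f n - u) (f n - u) < 1 / Suc n)"
proof -
  have "\<exists>f\<in>Cc_inf \<Omega>. H_form (f - u) (f - u) < 1 / Suc n" for n using assms by (simp add: H0_log_iff)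
  then show ?thesis by metis
qed

lemma lim_1_over_Suc: "(\<lambda>n. 1 / real (Suc n)) \<longlonglongrightarrow> 0"
  using LIMSEQ_inverse_real_of_nat by (simp add: inverse_eq_divide)

lemma Cc_inf_zero_outside: "f \<in> Cc_inf \<Omega> \<Longrightarrow> x \<notin> \<Omega> \<Longrightarrow> f x = 0"
  using Cc_inf_support[of f \<Omega>] by blast

lemma L2_norm_zero_imp_AE:
  assumes "\<Omega> \<in> sets borel" "u \<in> L2_on \<Omega>" "L2_inner \<Omega> u u = 0"
  shows "AE x in lborel. u x = 0"
proof -
  have "(LINT x|lborel. (u x)\<^sup>2) = 0"
    using assms L2_inner_eq[OF assms(2) _ assms(1), of u] by (simp add: L2_on_iff power2_eq_square)
  then have "AE x in lborel. (u x)\<^sup>2 = 0"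
    using assms(2) by (subst (asm) integral_nonneg_eq_0_iff_AE) (auto simp: L2_on_iff)
  then show ?thesis by eventually_elim simp
qed

text \<open>Smoothed absolute values of approximating test functions are test functions. By
  contraction their energies stay bounded, and they converge to |u| in \<open>L\<^sup>2\<close>;
  \<open>bounded_b_limit\<close> then places |u| in the space, up to a null set. The energy
  inequality follows from contraction applied to |u| itself.\<close>

lemma H0_log_abs:
  fixes \<Omega> :: "'a::euclidean_space set"
  assumes \<Omega>: "open \<Omega>" "bounded \<Omega>" "\<Omega> \<noteq> {}" and u: "u \<in> H0_log \<Omega>"
  shows "(\<lambda>x. \<bar>u x\<bar>) \<in> H0_log \<Omega>" "log_form (\<lambda>x. \<bar>u x\<bar>) (\<lambda>x. \<bar>u x\<bar>) \<le> log_form u u"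
proof -
  have \<Omega>m [measurable]: "\<Omega> \<in> sets borel" using \<Omega> by simp
  obtain c where "compact_form (H0_log \<Omega>) (L2_on \<Omega>) log_form (L2_inner \<Omega>) c"
    using compact_form_H0_log[OF \<Omega>] by blast
  then interpret compact_form "H0_log \<Omega>" "L2_on \<Omega>" log_form "L2_inner \<Omega>" c .
  have uH: "u \<in> H_log" and uL: "u \<in> L2_on \<Omega>" using u by (auto intro: H0_log_subset_H_log)
  have um [measurable]: "u \<in> borel_measurable borel" using uH by (rule H_log_measurable)
  have ae: "AE x in lborel. x \<notin> \<Omega> \<longrightarrow> u x = 0" and u2: "integrable lborel (\<lambda>x. (u x)\<^sup>2)"
    using uL by (auto simp: L2_on_iff)
  obtain f where f: "\<And>n. f n \<in> Cc_inf \<Omega>" "\<And>n. H_form (f n - u) (f n - u) < 1 / Suc n"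
    using H0_log_sequence[OF u] by blast
  have fH: "f n \<in> H_log" for n using f(1) by (rule Cc_inf_subset_H_log)
  have fm [measurable]: "f n \<in> borel_measurable borel" for n using fH by (rule H_log_measurable)
  define w where "w = (\<lambda>x. \<bar>u x\<bar>)"
  have wm [measurable]: "w \<in> borel_measurable borel" unfolding w_def by measurable
  have wL: "w \<in> L2_on \<Omega>" using ae u2 um by (auto simp: L2_on_iff w_def)
  define v where "v n = (\<lambda>x. smooth_abs (1 / Suc n) (f n x))" for n
  have vC: "v n \<in> Cc_inf \<Omega>" for n unfolding v_def by (rule smooth_abs_Cc_inf[OF f(1)])
  have vV: "v n \<in> H0_log \<Omega>" for n using vC by (rule Cc_inf_subset_H0_log)
  have vm [measurable]: "v n \<in> borel_measurable borel" for n using vC by (rule Cc_inf_measurable)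
  have bound: "log_form (v n) (v n) \<le> 2 + 2 * log_form u u" for n
  proof -
    have "log_form (v n) (v n) \<le> log_form (f n) (f n)"
      using fH Cc_inf_subset_H_log[OF vC] by (rule log_form_contraction) (auto simp: v_def smooth_abs_lipschitz)
    also have "\<dots> = log_form ((f n - u) + u) ((f n - u) + u)" by simp
    also have "\<dots> \<le> 2 * log_form (f n - u) (f n - u) + 2 * log_form u u"
      using fH uH by (intro E.add_le E.mem)
    also have "log_form (f n - u) (f n - u) \<le> H_form (f n - u) (f n - u)" using fH uH by (intro H_form_ge) simp
    also have "\<dots> \<le> 1" using f(2)[of n] by (rule order_trans[OF less_imp_le]) simp
    finally show ?thesis by simp
  qed
  have fin: "emeasure lborel \<Omega> < \<infinity>" using \<Omega>(2) by (rule emeasure_bounded_finite)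
  have lim: "(\<lambda>n. L2_inner \<Omega> (v n - w) (v n - w)) \<longlonglongrightarrow> 0"
  proof (rule tendsto_0_le)
    \<comment> \<open>The first term is the smoothing error, present only on \<open>\<Omega>\<close>
      because \<open>smooth_abs\<close> vanishes at 0. The second is the distance from
      \<open>f n\<close> to \<open>u\<close>.\<close>
    have "(\<lambda>n. 2 * measure lborel \<Omega> * (1 / Suc n)\<^sup>2 + 2 * (1 / Suc n)) \<longlonglongrightarrow> 2 * measure lborel \<Omega> * 0\<^sup>2 + 2 * 0"
      by (intro tendsto_intros lim_1_over_Suc)
    then show "(\<lambda>n. 2 * measure lborel \<Omega> * (1 / Suc n)\<^sup>2 + 2 * (1 / Suc n)) \<longlonglongrightarrow> 0" by simp
    fix n
    have vwL: "v n - w \<in> L2_on \<Omega>" using vV wL by auto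
    show "0 \<le> L2_inner \<Omega> (v n - w) (v n - w)" using vwL by (rule B.nonneg)
    have fu: "f n - u \<in> H_log" using fH uH by simp
    then have fu2: "integrable lborel (\<lambda>x. ((f n - u) x)\<^sup>2)" by (simp only: H_log_iff)
    have "L2_inner \<Omega> (v n - w) (v n - w) = (LINT x|lborel. ((v n - w) x)\<^sup>2)"
      using L2_inner_eq[OF vwL _ \<Omega>m] vwL by (simp add: L2_on_iff power2_eq_square)
    also have "\<dots> \<le> (LINT x|lborel. 2 * (1 / Suc n)\<^sup>2 * indicator \<Omega> x + 2 * ((f n - u) x)\<^sup>2)"
    proof (rule integral_mono_AE)
      show "integrable lborel (\<lambda>x. ((v n - w) x)\<^sup>2)" using vwL by (simp only: L2_on_iff)
      show "integrable lborel (\<lambda>x. 2 * (1 / Suc n)\<^sup>2 * indicator \<Omega> x + 2 * ((f n - u) x)\<^sup>2)"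
        using fu2 fin by (intro Bochner_Integration.integrable_add integrable_mult_right) auto
      show "AE x in lborel. ((v n - w) x)\<^sup>2 \<le> 2 * (1 / Suc n)\<^sup>2 * indicator \<Omega> x + 2 * ((f n - u) x)\<^sup>2"
        using ae
      proof eventually_elim
        case (elim x)
        show ?case
        proof (cases "x \<in> \<Omega>")
          case True
          define p where "p = smooth_abs (1 / Suc n) (f n x) - \<bar>f n x\<bar>"
          define q where "q = \<bar>f n x\<bar> - \<bar>u x\<bar>"
          have "\<bar>p\<bar> \<le> 1 / Suc n" unfolding p_def by (rule smooth_abs_approx) simp
          then have p: "p\<^sup>2 \<le> (1 / Suc n)\<^sup>2" by (metis abs_ge_zero power2_abs power_mono)
          have "\<bar>q\<bar> \<le> \<bar>f n x - u x\<bar>" unfolding q_def by (rule abs_triangle_ineq3)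
          then have q: "q\<^sup>2 \<le> (f n x - u x)\<^sup>2" by (simp add: abs_le_square_iff)
          have "(v n - w) x = p + q" by (simp add: v_def w_def p_def q_def)
          moreover have "(p + q)\<^sup>2 \<le> 2 * p\<^sup>2 + 2 * q\<^sup>2"
            using sum_squares_bound[of p q] by (simp add: power2_sum)
          ultimately show ?thesis using True p q by simp
        next
          case False
          then have "f n x = 0" "u x = 0" using elim f(1) Cc_inf_zero_outside by auto
          then show ?thesis using False by (simp add: v_def w_def smooth_abs_def)
        qed
      qed
    qed
    also have "\<dots> = 2 * (1 / Suc n)\<^sup>2 * measure lborel \<Omega> + 2 * (LINT x|lborel. ((f n - u) x)\<^sup>2)"
    proof -
      have "integrable lborel (\<lambda>x. 2 * (1 / Suc n)\<^sup>2 * indicat_real \<Omega> x)" using fin by simp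
      moreover have "integrable lborel (\<lambda>x. 2 * ((f n - u) x)\<^sup>2)" using fu2 by (rule integrable_mult_right)
      ultimately show ?thesis by (subst Bochner_Integration.integral_add) auto
    qed
    also have "(LINT x|lborel. ((f n - u) x)\<^sup>2) \<le> 1 / Suc n"
      using H_form_ge(1)[OF fu] f(2)[of n] by linarith
    finally show "L2_inner \<Omega> (v n - w) (v n - w) \<le> 2 * measure lborel \<Omega> * (1 / Suc n)\<^sup>2 + 2 * (1 / Suc n)"
      by (simp add: mult_ac)
  qed
  obtain z where z: "z \<in> H0_log \<Omega>" "L2_inner \<Omega> (z - w) (z - w) = 0"
    using bounded_b_limit[of v, OF vV bound wL lim] by blast
  have "AE x in lborel. (z - w) x = 0"
    by (rule L2_norm_zero_imp_AE[OF \<Omega>m _ z(2)]) (use z wL in auto)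
  then have "AE x in lborel. z x = w x" by eventually_elim simp
  then have wV: "w \<in> H0_log \<Omega>" by (rule H0_log_AE_cong[OF z(1) wm])
  then show "(\<lambda>x. \<bar>u x\<bar>) \<in> H0_log \<Omega>" by (simp add: w_def)
  have "log_form w w \<le> log_form u u"
    by (rule log_form_contraction[OF uH H0_log_subset_H_log[OF wV]]) (simp add: w_def abs_triangle_ineq3)
  then show "log_form (\<lambda>x. \<bar>u x\<bar>) (\<lambda>x. \<bar>u x\<bar>) \<le> log_form u u" by (simp add: w_def)
qed

lemma H0_log_pos_part:
  fixes \<Omega> :: "'a::euclidean_space set"
  assumes \<Omega>: "open \<Omega>" "bounded \<Omega>" "\<Omega> \<noteq> {}" and u: "u \<in> H0_log \<Omega>"
  shows "(\<lambda>x. max (u x) 0) \<in> H0_log \<Omega>"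
proof -
  have "(1 / 2) *\<^sub>R ((\<lambda>x. \<bar>u x\<bar>) + u) \<in> H0_log \<Omega>"
    using H0_log_abs(1)[OF \<Omega> u] u subspace_H0_log by (intro subspace_scale subspace_add)
  moreover have "(1 / 2) *\<^sub>R ((\<lambda>x. \<bar>u x\<bar>) + u) = (\<lambda>x. max (u x) 0)" by (auto simp: fun_eq_iff max_def)
  ultimately show ?thesis by simp
qed

text \<open>
  Testing with the positive part of \<open>v - n \<phi>\<close> bounds the interaction between the zero set of
  \<open>\<phi>\<close> and \<open>\<phi>\<close> itself by a multiple of \<open>1 / n\<close>.
\<close>

lemma strong_maximum_principle:
  fixes \<Omega> :: "'a::euclidean_space set"
  assumes \<Omega>: "open \<Omega>" "bounded \<Omega>" "\<Omega> \<noteq> {}"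
    and \<phi>: "\<phi> \<in> H0_log \<Omega>" "\<And>x. 0 \<le> \<phi> x" and \<mu>: "0 \<le> \<mu>"
    and eig: "\<And>v. v \<in> H0_log \<Omega> \<Longrightarrow> log_form \<phi> v = \<mu> * L2_inner \<Omega> \<phi> v"
    and nz: "\<not> (AE x in lborel. \<phi> x = 0)"
  shows "AE x in lborel. x \<in> \<Omega> \<longrightarrow> 0 < \<phi> x"
proof -
  have \<Omega>m [measurable]: "\<Omega> \<in> sets borel" using \<Omega> by simp
  have \<phi>H: "\<phi> \<in> H_log" using \<phi>(1) by (rule H0_log_subset_H_log)
  have \<phi>m [measurable]: "\<phi> \<in> borel_measurable borel" using \<phi>H by (rule H_log_measurable)
  define Z where "Z = {x \<in> \<Omega>. \<phi> x = 0}"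
  have "Z = \<Omega> \<inter> \<phi> -` {0}" by (auto simp: Z_def)
  then have Zm [measurable]: "Z \<in> sets borel" using measurable_sets[OF \<phi>m, of "{0}"] by auto
  \<comment> \<open>Proved for every nonnegative \<open>v\<close> of the space, because the
    indicator of \<open>Z\<close> itself need not belong to it.\<close>
  have key: "AE x in lborel. indicator Z x * v x = 0" if v: "v \<in> H0_log \<Omega>" "\<And>x. 0 \<le> v x" for v
  proof (rule ccontr)
    assume nv: "\<not> (AE x in lborel. indicator Z x * v x = 0)"
    have vH: "v \<in> H_log" using v(1) by (rule H0_log_subset_H_log)
    have vm [measurable]: "v \<in> borel_measurable borel" using vH by (rule H_log_measurable)
    define M where "M = log_form v v / 2"
    define k where "k n p = indicator Z (fst p) * v (fst p) * max (\<phi> (snd p) - v (snd p) / Suc n) 0 * log_kernel (fst p - snd p)"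
      for n and p :: "'a \<times> 'a"
    define h where "h p = indicator Z (fst p) * v (fst p) * \<phi> (snd p) * log_kernel (fst p - snd p)" for p :: "'a \<times> 'a"
    have km [measurable]: "k n \<in> borel_measurable (lborel \<Otimes>\<^sub>M lborel)" for n unfolding k_def[abs_def] by measurable
    have hm [measurable]: "h \<in> borel_measurable (lborel \<Otimes>\<^sub>M lborel)" unfolding h_def[abs_def] by measurable
    have k0: "0 \<le> k n p" for n p using v(2) by (auto simp: k_def)
    have h0: "0 \<le> h p" for p using v(2) \<phi>(2) by (auto simp: h_def)
    have kint: "integrable (lborel \<Otimes>\<^sub>M lborel) (k n) \<and> integral\<^sup>L (lborel \<Otimes>\<^sub>M lborel) (k n) \<le> M / Suc n" for n
    proof -
      define m where "m = real (Suc n)"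
      have m: "m > 0" by (simp add: m_def)
      \<comment> \<open>On \<open>Z\<close> the function \<open>g\<close> equals \<open>v\<close>
        for every \<open>m\<close>, whereas elsewhere its negative part grows like
        \<open>m * \<phi>\<close>. The energy linking the two stays bounded by
        \<open>M\<close>.\<close>
      define g where "g = v - m *\<^sub>R \<phi>"
      define \<psi> where "\<psi> = (\<lambda>x. max (g x) 0)"
      have gV: "g \<in> H0_log \<Omega>"
        unfolding g_def using v(1) \<phi>(1) subspace_H0_log by (intro subspace_diff subspace_scale)
      have \<psi>V: "\<psi> \<in> H0_log \<Omega>" unfolding \<psi>_def by (rule H0_log_pos_part[OF \<Omega> gV])
      have gH: "g \<in> H_log" and \<psi>H: "\<psi> \<in> H_log" using gV \<psi>V by (auto intro: H0_log_subset_H_log)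
      have "log_form \<phi> \<psi> \<ge> 0"
      proof -
        have "0 \<le> L2_inner \<Omega> \<phi> \<psi>" unfolding L2_inner_def set_lebesgue_integral_def
          using \<phi>(2) by (intro Bochner_Integration.integral_nonneg) (auto simp: \<psi>_def)
        then show ?thesis using eig[OF \<psi>V] \<mu> by simp
      qed
      then have 1: "log_form g \<psi> \<le> log_form v \<psi>"
        using m vH \<phi>H \<psi>H by (simp add: g_def E.expand)
      \<comment> \<open>Completing the square bounds
        \<open>log_form v \<psi> - log_form \<psi> \<psi>\<close> by a quarter of
        \<open>log_form v v\<close>. The integral of \<open>G\<close> carries no factor 1/2, so its
        bound \<open>M\<close> is half of \<open>log_form v v\<close>.\<close>
      have "0 \<le> log_form (v - 2 *\<^sub>R \<psi>) (v - 2 *\<^sub>R \<psi>)" using vH \<psi>H by (intro E.nonneg) simp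
      then have 2: "log_form v \<psi> - log_form \<psi> \<psi> \<le> log_form v v / 4"
        using vH \<psi>H E.sym[of v \<psi>] by (simp add: E.expand)
      define G where "G p = lift2 g p * lift2 \<psi> p - lift2 \<psi> p * lift2 \<psi> p" for p
      have Gi: "integrable (lborel \<Otimes>\<^sub>M lborel) G"
        unfolding G_def using gH \<psi>H by (intro Bochner_Integration.integrable_diff log_integrand_integrable)
      have "integral\<^sup>L (lborel \<Otimes>\<^sub>M lborel) G = 2 * (log_form g \<psi> - log_form \<psi> \<psi>)"
        unfolding G_def using gH \<psi>H by (simp add: log_form_lift2 log_integrand_integrable)
      then have GM: "integral\<^sup>L (lborel \<Otimes>\<^sub>M lborel) G \<le> M" using 1 2 by (simp add: M_def)
      have pw: "m * k n p \<le> G p" for p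
      proof -
        obtain x y where p: "p = (x, y)" by (cases p)
        \<comment> \<open>With positive parts \<open>s+\<close>, \<open>t+\<close> and negative
          parts \<open>s-\<close>, \<open>t-\<close>, the right side equals
          \<open>s+ * t- + t+ * s-\<close>.\<close>
        have a: "max s 0 * max (- t) 0 \<le> (s - t) * (max s 0 - max t 0) - (max s 0 - max t 0)\<^sup>2" for s t :: real
          by (auto simp: max_def power2_eq_square algebra_simps mult_nonneg_nonpos mult_nonpos_nonneg mult_le_0_iff)
        have b: "indicator Z x * v x * (m * max (\<phi> y - v y / m) 0) \<le> \<psi> x * max (- g y) 0"
        proof (rule mult_mono)
          show "indicator Z x * v x \<le> \<psi> x" using v(2)[of x] by (auto simp: indicator_def Z_def \<psi>_def g_def)
          show "m * max (\<phi> y - v y / m) 0 \<le> max (- g y) 0" using m by (auto simp: g_def max_def field_simps)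
        qed (use m in \<open>auto simp: \<psi>_def\<close>)
        have "m * k n p = (indicator Z x * v x * (m * max (\<phi> y - v y / m) 0)) * log_kernel (x - y)"
          by (simp add: k_def p m_def mult_ac)
        also have "\<dots> \<le> ((g x - g y) * (\<psi> x - \<psi> y) - (\<psi> x - \<psi> y)\<^sup>2) * log_kernel (x - y)"
          using b a[of "g x" "g y"] by (intro mult_right_mono) (auto simp: \<psi>_def)
        also have "\<dots> = G p"
        proof -
          have J: "log_kernel (x - y) = sqrt (log_kernel (x - y)) * sqrt (log_kernel (x - y))" by simp
          show ?thesis unfolding G_def lift2_def p fst_conv snd_conv by (subst J) (simp only: power2_eq_square algebra_simps)
        qed
        finally show ?thesis .
      qed
      have ki: "integrable (lborel \<Otimes>\<^sub>M lborel) (\<lambda>p. m * k n p)"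
      proof (rule Bochner_Integration.integrable_bound[OF Gi])
        have "norm (m * k n p) \<le> norm (G p)" for p using pw[of p] k0[of n p] m by simp
        then show "AE p in lborel \<Otimes>\<^sub>M lborel. norm (m * k n p) \<le> norm (G p)" by simp
      qed simp
      have "(LINT p|(lborel \<Otimes>\<^sub>M lborel). m * k n p) \<le> M"
        using integral_mono[OF ki Gi pw] GM by simp
      then have "integral\<^sup>L (lborel \<Otimes>\<^sub>M lborel) (k n) \<le> M / m" using m by (simp add: field_simps)
      moreover have "integrable (lborel \<Otimes>\<^sub>M lborel) (k n)" using ki m by simp
      ultimately show ?thesis by (simp add: m_def)
    qed
    have klim: "(\<lambda>n. k n p) \<longlonglongrightarrow> h p" for p
    proof -
      have "(\<lambda>n. indicator Z (fst p) * v (fst p) * max (\<phi> (snd p) - v (snd p) * (1 / Suc n)) 0 * log_kernel (fst p - snd p))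
        \<longlonglongrightarrow> indicator Z (fst p) * v (fst p) * max (\<phi> (snd p) - v (snd p) * 0) 0 * log_kernel (fst p - snd p)"
        by (intro tendsto_intros lim_1_over_Suc)
      then show ?thesis using \<phi>(2)[of "snd p"] by (simp add: k_def h_def max_def)
    qed
    have hle: "integrable (lborel \<Otimes>\<^sub>M lborel) h \<and> integral\<^sup>L (lborel \<Otimes>\<^sub>M lborel) h \<le> e" if e: "e > 0" for e
    proof (rule integral_le_of_AE_tendsto[where g=k])
      have "(\<lambda>n. M * (1 / Suc n)) \<longlonglongrightarrow> M * 0" by (intro tendsto_intros lim_1_over_Suc)
      then have "\<forall>\<^sub>F n in sequentially. M * (1 / Suc n) < e" using e by (intro order_tendstoD(2)) auto
      then show "\<forall>\<^sub>F n in sequentially. integral\<^sup>L (lborel \<Otimes>\<^sub>M lborel) (k n) \<le> e"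
      proof eventually_elim
        case (elim n)
        then show ?case using kint[of n] by simp
      qed
    qed (use k0 h0 klim kint e in auto)
    have "integral\<^sup>L (lborel \<Otimes>\<^sub>M lborel) h \<le> 0" by (rule field_le_epsilon) (use hle in simp)
    then have "integral\<^sup>L (lborel \<Otimes>\<^sub>M lborel) h = 0" using h0 by (simp add: antisym)
    then have "AE p in lborel \<Otimes>\<^sub>M lborel. h p = 0"
      using hle[of 1] h0 by (subst (asm) integral_nonneg_eq_0_iff_AE) auto
    then have ae: "AE x in lborel. AE y in lborel. h (x, y) = 0" by (rule lborel_pair.AE_pair)
    \<comment> \<open>A single point suffices: where \<open>v x > 0\<close> on \<open>Z\<close> and
      the section of \<open>h\<close> is null, positivity of the kernel off the diagonal forces
      \<open>\<phi>\<close> to vanish almost everywhere.\<close>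
    have "\<exists>x. indicator Z x * v x \<noteq> 0 \<and> (AE y in lborel. h (x, y) = 0)"
    proof (rule ccontr)
      assume no: "\<not> ?thesis"
      have "AE x in lborel. indicator Z x * v x = 0" using ae by eventually_elim (use no in blast)
      then show False using nv by contradiction
    qed
    then obtain x where x: "indicator Z x * v x \<noteq> 0" "AE y in lborel. h (x, y) = 0" by blast
    have "AE y in lborel. y \<noteq> x" by (rule AE_lborel_singleton)
    then have "AE y in lborel. \<phi> y = 0"
      using x(2)
    proof eventually_elim
      case (elim y)
      then have "log_kernel (x - y) \<noteq> 0" using log_kernel_pos[of "x - y"] by simp
      then show ?case using elim(2) x(1) by (auto simp: h_def)
    qed
    then show False using nz by contradiction
  qed
  have "emeasure lborel Z = 0"
  proof (rule ccontr)
    assume ne: "emeasure lborel Z \<noteq> 0"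
    have fin: "emeasure lborel Z < \<infinity>"
      by (rule emeasure_bounded_finite) (rule bounded_subset[OF \<Omega>(2)], auto simp: Z_def)
    have mp: "measure lborel Z > 0"
      using ne fin by (simp add: measure_def enn2real_positive_iff zero_less_iff_neq_zero)
    \<comment> \<open>By \<open>key\<close> for |f|, the function \<open>f\<close> vanishes almost
      everywhere on \<open>Z\<close>. Its squared distance to the indicator is then at least the
      measure of \<open>Z\<close>, against the choice of \<open>f\<close>.\<close>
    obtain f where f: "f \<in> Cc_inf \<Omega>" "(LINT x|lborel. (indicator Z x - f x)\<^sup>2) < measure lborel Z"
      using L2_approx_set[OF \<Omega>(1,2) Zm] mp unfolding L2_approx_def Z_def by blast
    have fV: "f \<in> H0_log \<Omega>" using f(1) by (rule Cc_inf_subset_H0_log)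
    have fm [measurable]: "f \<in> borel_measurable borel" using f(1) by (rule Cc_inf_measurable)
    have "AE x in lborel. indicator Z x * \<bar>f x\<bar> = 0"
      by (rule key[OF H0_log_abs(1)[OF \<Omega> fV]]) simp
    then have ae: "AE x in lborel. indicat_real Z x \<le> (indicator Z x - f x)\<^sup>2"
      by eventually_elim (auto simp: indicator_def split: if_splits)
    have i: "integrable lborel (\<lambda>x. (indicat_real Z x - f x)\<^sup>2)"
      using fin Cc_inf_square_integrable[OF f(1)]
      by (intro integrable_square_diff) (auto simp: indicator_square)
    have "(LINT x|lborel. indicat_real Z x) \<le> (LINT x|lborel. (indicator Z x - f x)\<^sup>2)"
      using fin i ae by (intro integral_mono_AE) auto
    then show False using f(2) by simp
  qed
  then have "AE x in lborel. x \<notin> Z" by (intro AE_not_in) auto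
  then show ?thesis
  proof eventually_elim
    case (elim x)
    then show ?case using \<phi>(2)[of x] by (auto simp: Z_def less_le)
  qed
qed

text \<open>Both sides are continuous for the energy, by Cauchy-Schwarz and coercivity, and test
  functions are dense. This permits testing with positive parts, which are not smooth.\<close>

lemma weak_solution_iff:
  fixes \<Omega> :: "'a::euclidean_space set"
  assumes \<Omega>: "open \<Omega>" "bounded \<Omega>" "\<Omega> \<noteq> {}"
  shows "weak_solution \<Omega> \<mu> u \<longleftrightarrow> u \<in> H0_log \<Omega> \<and> (\<forall>v\<in>H0_log \<Omega>. log_form u v = \<mu> * L2_inner \<Omega> u v)"
proof
  obtain c where "compact_form (H0_log \<Omega>) (L2_on \<Omega>) log_form (L2_inner \<Omega>) c"
    using compact_form_H0_log[OF \<Omega>] by blast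
  then interpret compact_form "H0_log \<Omega>" "L2_on \<Omega>" log_form "L2_inner \<Omega>" c .
  assume w: "weak_solution \<Omega> \<mu> u"
  then have u: "u \<in> H0_log \<Omega>" by (simp add: weak_solution_def)
  have "log_form u v = \<mu> * L2_inner \<Omega> u v" if v: "v \<in> H0_log \<Omega>" for v
  proof -
    obtain f where f: "\<And>n. f n \<in> Cc_inf \<Omega>" "\<And>n. H_form (f n - v) (f n - v) < 1 / Suc n"
      using H0_log_sequence[OF v] by blast
    have fV: "f n \<in> H0_log \<Omega>" for n using f(1) by (rule Cc_inf_subset_H0_log)
    have conv: "(\<lambda>n. log_form (f n - v) (f n - v)) \<longlonglongrightarrow> 0"
      using lim_1_over_Suc
    proof (rule tendsto_0_le)
      fix n
      have H: "f n - v \<in> H_log" using A.mem(3)[OF fV v] by (rule H0_log_subset_H_log)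
      show "0 \<le> log_form (f n - v) (f n - v)" using H by (rule E.nonneg)
      show "log_form (f n - v) (f n - v) \<le> 1 / Suc n" using H_form_ge(2)[OF H] f(2)[of n] by linarith
    qed
    have "(\<lambda>n. log_form (f n) u) \<longlonglongrightarrow> log_form v u" using fV v u conv by (rule A.tendsto_left)
    moreover have "(\<lambda>n. \<mu> * L2_inner \<Omega> (f n) u) \<longlonglongrightarrow> \<mu> * L2_inner \<Omega> v u"
      using fV v u b_tendsto_if_a_tendsto[OF fV v conv] by (intro tendsto_intros B.tendsto_left) auto
    moreover have "log_form (f n) u = \<mu> * L2_inner \<Omega> (f n) u" for n
      using w f(1)[of n] A.sym[OF fV u] B.sym[OF VL[OF fV] VL[OF u]]
      by (simp add: weak_solution_def L2_inner_def)
    ultimately have "log_form v u = \<mu> * L2_inner \<Omega> v u" using LIMSEQ_unique by simp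
    then show ?thesis using A.sym[OF v u] B.sym[OF VL[OF v] VL[OF u]] by simp
  qed
  then show "u \<in> H0_log \<Omega> \<and> (\<forall>v\<in>H0_log \<Omega>. log_form u v = \<mu> * L2_inner \<Omega> u v)" using u by blast
next
  assume "u \<in> H0_log \<Omega> \<and> (\<forall>v\<in>H0_log \<Omega>. log_form u v = \<mu> * L2_inner \<Omega> u v)"
  then show "weak_solution \<Omega> \<mu> u"
    using Cc_inf_subset_H0_log by (auto simp: weak_solution_def L2_inner_def)
qed

text \<open>\<open>log_form - \<mu> * L2_inner\<close> is positive semidefinite and vanishes at
  \<open>u\<close>. Taking absolute values preserves the \<open>L\<^sup>2\<close> norm and does not
  raise the energy, so it vanishes at |u| as well, and Cauchy-Schwarz gives the equation
  there.\<close>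

lemma eigen_abs:
  fixes \<Omega> :: "'a::euclidean_space set"
  assumes \<Omega>: "open \<Omega>" "bounded \<Omega>" "\<Omega> \<noteq> {}"
    and min: "\<And>w. w \<in> H0_log \<Omega> \<Longrightarrow> \<mu> * L2_inner \<Omega> w w \<le> log_form w w"
    and u: "weak_solution \<Omega> \<mu> u"
  shows "weak_solution \<Omega> \<mu> (\<lambda>x. \<bar>u x\<bar>)"
proof -
  obtain c where "compact_form (H0_log \<Omega>) (L2_on \<Omega>) log_form (L2_inner \<Omega>) c"
    using compact_form_H0_log[OF \<Omega>] by blast
  then interpret compact_form "H0_log \<Omega>" "L2_on \<Omega>" log_form "L2_inner \<Omega>" c .
  define w where "w = (\<lambda>x. \<bar>u x\<bar>)"
  have uV: "u \<in> H0_log \<Omega>" and ue: "\<And>v. v \<in> H0_log \<Omega> \<Longrightarrow> log_form u v = \<mu> * L2_inner \<Omega> u v"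
    using u by (auto simp: weak_solution_iff[OF \<Omega>])
  have wV: "w \<in> H0_log \<Omega>" and wle: "log_form w w \<le> log_form u u"
    using H0_log_abs[OF \<Omega> uV] by (simp_all add: w_def)
  interpret D: psd_form "H0_log \<Omega>" "\<lambda>x y. log_form x y - \<mu> * L2_inner \<Omega> x y"
    by unfold_locales (use min in \<open>auto simp: A.expand B.expand algebra_simps A.sym B.sym subspace_H0_log\<close>)
  have "L2_inner \<Omega> w w = L2_inner \<Omega> u u" by (simp add: w_def L2_inner_def)
  then have "log_form w w - \<mu> * L2_inner \<Omega> w w \<le> 0" using ue[OF uV] wle by simp
  then have z: "log_form w w - \<mu> * L2_inner \<Omega> w w = 0" using D.nonneg[OF wV] by linarith
  have "log_form w v = \<mu> * L2_inner \<Omega> w v" if "v \<in> H0_log \<Omega>" for v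
    using D.cauchy_schwarz[OF wV that] z by simp
  then show ?thesis using wV by (simp add: weak_solution_iff[OF \<Omega>] w_def)
qed

lemma eigen_linear:
  assumes \<Omega>: "open \<Omega>" "bounded \<Omega>" "\<Omega> \<noteq> {}"
    and u: "weak_solution \<Omega> \<mu> u" and v: "weak_solution \<Omega> \<mu> v"
  shows "weak_solution \<Omega> \<mu> (s *\<^sub>R u + t *\<^sub>R v)"
proof -
  obtain c where "compact_form (H0_log \<Omega>) (L2_on \<Omega>) log_form (L2_inner \<Omega>) c"
    using compact_form_H0_log[OF \<Omega>] by blast
  then interpret compact_form "H0_log \<Omega>" "L2_on \<Omega>" log_form "L2_inner \<Omega>" c .
  show ?thesis using u v by (auto simp: weak_solution_iff[OF \<Omega>] A.expand B.expand algebra_simps)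
qed

text \<open>The positive and the negative part, as combinations of |u| and \<open>u\<close>, are
  solutions too. If one of them is not null it is positive almost everywhere on
  \<open>\<Omega>\<close>, so \<open>u\<close> has one sign, and zero mean then forces
  \<open>u = 0\<close>.\<close>

lemma first_eigen_zero_mean:
  fixes \<Omega> :: "'a::euclidean_space set"
  assumes \<Omega>: "open \<Omega>" "bounded \<Omega>" "\<Omega> \<noteq> {}"
    and min: "\<And>w. w \<in> H0_log \<Omega> \<Longrightarrow> \<mu> * L2_inner \<Omega> w w \<le> log_form w w" and \<mu>: "0 \<le> \<mu>"
    and u: "weak_solution \<Omega> \<mu> u" and mean: "(LINT x|lborel. u x) = 0"
  shows "AE x in lborel. u x = 0"
proof -
  have uV: "u \<in> H0_log \<Omega>" using u by (simp add: weak_solution_def)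
  have uL: "u \<in> L2_on \<Omega>" by (rule H0_log_subset_L2_on[OF \<Omega>(1) uV])
  have ae: "AE x in lborel. x \<notin> \<Omega> \<longrightarrow> u x = 0" using uL by (simp add: L2_on_iff)
  have part: "AE x in lborel. max (\<sigma> * u x) 0 = 0" if \<sigma>: "\<bar>\<sigma>\<bar> = 1" for \<sigma>
  proof (rule ccontr)
    assume nz: "\<not> (AE x in lborel. max (\<sigma> * u x) 0 = 0)"
    have "weak_solution \<Omega> \<mu> ((1 / 2) *\<^sub>R (\<lambda>x. \<bar>u x\<bar>) + (\<sigma> / 2) *\<^sub>R u)"
      by (rule eigen_linear[OF \<Omega> eigen_abs[OF \<Omega> min u] u])
    moreover have "(1 / 2) *\<^sub>R (\<lambda>x. \<bar>u x\<bar>) + (\<sigma> / 2) *\<^sub>R u = (\<lambda>x. max (\<sigma> * u x) 0)"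
      using \<sigma> by (auto simp: fun_eq_iff max_def abs_if split: if_splits)
    ultimately have p: "weak_solution \<Omega> \<mu> (\<lambda>x. max (\<sigma> * u x) 0)" by simp
    have "AE x in lborel. x \<in> \<Omega> \<longrightarrow> 0 < max (\<sigma> * u x) 0"
      by (rule strong_maximum_principle[OF \<Omega> _ _ \<mu> _ nz]) (use p in \<open>auto simp: weak_solution_iff[OF \<Omega>]\<close>)
    then have pos: "AE x in lborel. 0 \<le> \<sigma> * u x"
      using ae
    proof eventually_elim
      case (elim x)
      then show ?case by (cases "x \<in> \<Omega>") auto
    qed
    have "integrable lborel (\<lambda>x. \<sigma> * u x)" using L2_on_integrable[OF uL \<Omega>(1,2)] by simp
    moreover have "(LINT x|lborel. \<sigma> * u x) = 0" using mean by simp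
    ultimately have "AE x in lborel. \<sigma> * u x = 0" using integral_nonneg_eq_0_iff_AE[OF _ pos] by simp
    then have "AE x in lborel. max (\<sigma> * u x) 0 = 0" by eventually_elim auto
    then show False using nz by contradiction
  qed
  have "AE x in lborel. max (1 * u x) 0 = 0" "AE x in lborel. max (- 1 * u x) 0 = 0"
    by (rule part, simp)+
  then show ?thesis by eventually_elim (auto simp: max_def split: if_splits)
qed

lemma AE_eq_imp_L2_inner_eq:
  assumes "\<Omega> \<in> sets borel" "u \<in> borel_measurable borel" "v \<in> borel_measurable borel" "w \<in> borel_measurable borel"
    and "AE x in lborel. u x = v x"
  shows "L2_inner \<Omega> u w = L2_inner \<Omega> v w"
  unfolding L2_inner_def set_lebesgue_integral_def
  by (rule integral_cong_AE) (use assms in auto)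

section \<open>Normalisation of the first eigenfunction and the full spectrum\<close>

theorem theorem1p3:
  fixes \<Omega> :: "'a::euclidean_space set"
  assumes "open \<Omega>" and "bounded \<Omega>" and "\<Omega> \<noteq> {}"
  shows "\<exists>(ev :: nat \<Rightarrow> real) (\<phi> :: nat \<Rightarrow> 'a \<Rightarrow> real).
    \<comment> \<open>(i)\<close>
    (ev 1 > 0 \<and> eigenvalue \<Omega> (ev 1) \<and>
     ev 1 = (INF u\<in>{u \<in> H0_log \<Omega>. \<not> (AE x in lborel. u x = 0)}. log_form u u / (L2_norm \<Omega> u)\<^sup>2) \<and>
     ev 1 = (INF u\<in>{u \<in> H0_log \<Omega>. L2_norm \<Omega> u = 1}. log_form u u) \<and>
     \<phi> 1 \<in> H0_log \<Omega> \<and> (\<forall>x\<in>\<Omega>. \<phi> 1 x > 0) \<and> eigenfunction \<Omega> (ev 1) (\<phi> 1) \<and>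
     L2_norm \<Omega> (\<phi> 1) = 1 \<and> ev 1 = log_form (\<phi> 1) (\<phi> 1)) \<and>
    \<comment> \<open>(ii)\<close>
    (\<forall>u. weak_solution \<Omega> (ev 1) u \<longrightarrow> (\<exists>\<alpha>. AE x in lborel. u x = \<alpha> * \<phi> 1 x)) \<and>
    \<comment> \<open>(iii)\<close>
    (0 < ev 1 \<and> ev 1 < ev 2 \<and> (\<forall>k\<ge>2. ev k \<le> ev (k + 1)) \<and>
     (\<forall>k\<ge>1. eigenvalue \<Omega> (ev k) \<and> eigenfunction \<Omega> (ev k) (\<phi> k)) \<and>
     filterlim ev at_top sequentially \<and>
     (\<forall>k\<ge>1. ev k = (INF u\<in>P_set \<Omega> \<phi> k. log_form u u))) \<and>
    \<comment> \<open>(iv)\<close>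
    (L2_orthonormal_basis \<Omega> \<phi> \<and> H0_log_orthogonal \<Omega> \<phi>)"
proof -
  note \<Omega> = assms
  have \<Omega>m [measurable]: "\<Omega> \<in> sets borel" using \<Omega> by simp
  obtain c where "compact_form (H0_log \<Omega>) (L2_on \<Omega>) log_form (L2_inner \<Omega>) c"
    using compact_form_H0_log[OF \<Omega>] by blast
  then interpret compact_form "H0_log \<Omega>" "L2_on \<Omega>" log_form "L2_inner \<Omega>" c .
  let ?V = "H0_log \<Omega>" and ?a = "log_form :: ('a \<Rightarrow> real) \<Rightarrow> _" and ?b = "L2_inner \<Omega>"
  have meas: "u \<in> borel_measurable borel" if "u \<in> ?V" for u
    using that by (intro H_log_measurable H0_log_subset_H_log)
  obtain \<phi>0 :: "nat \<Rightarrow> 'a \<Rightarrow> real" and \<mu> where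
    V0: "\<And>k. \<phi>0 k \<in> ?V" and on0: "\<And>i j. ?b (\<phi>0 i) (\<phi>0 j) = (if i = j then 1 else 0)"
    and eig0: "\<And>k v. v \<in> ?V \<Longrightarrow> ?a (\<phi>0 k) v = \<mu> k * ?b (\<phi>0 k) v" and pos: "\<And>k. 0 < \<mu> k"
    and mono: "mono \<mu>" and inf: "filterlim \<mu> at_top sequentially"
    and min0: "\<And>k u. u \<in> ?V \<Longrightarrow> (\<forall>j<k. ?b u (\<phi>0 j) = 0) \<Longrightarrow> \<mu> k * ?b u u \<le> ?a u u"
    using eigen_sequence by blast
  have min1: "\<mu> 0 * ?b w w \<le> ?a w w" if "w \<in> ?V" for w using min0[OF that, of 0] by simp
  have \<mu>0: "0 \<le> \<mu> 0" using pos[of 0] by simp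
  have weak0: "weak_solution \<Omega> (\<mu> k) (\<phi>0 k)" for k using V0 eig0 by (simp add: weak_solution_iff[OF \<Omega>])

  define \<psi> where "\<psi> x = \<bar>\<phi>0 0 x\<bar>" for x
  have \<psi>w: "weak_solution \<Omega> (\<mu> 0) \<psi>"
    unfolding \<psi>_def using eigen_abs[OF \<Omega> min1 weak0] by simp
  then have \<psi>V: "\<psi> \<in> ?V" by (simp add: weak_solution_def)
  have \<psi>1: "?b \<psi> \<psi> = 1" using on0[of 0 0] by (simp add: \<psi>_def L2_inner_def)
  have nz: "\<not> (AE x in lborel. u x = 0)" if "u \<in> ?V" "?b u u \<noteq> 0" for u
  proof
    assume "AE x in lborel. u x = 0"
    then have "?b u u = ?b (\<lambda>x. 0) u" using meas[OF that(1)] by (intro AE_eq_imp_L2_inner_eq) auto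
    then show False using that(2) by (simp add: L2_inner_def set_lebesgue_integral_def)
  qed
  have \<psi>pos: "AE x in lborel. x \<in> \<Omega> \<longrightarrow> 0 < \<psi> x"
  proof (rule strong_maximum_principle[OF \<Omega> \<psi>V _ \<mu>0])
    show "\<not> (AE x in lborel. \<psi> x = 0)" by (rule nz[OF \<psi>V]) (simp add: \<psi>1)
  qed (use \<psi>w in \<open>auto simp: weak_solution_iff[OF \<Omega>] \<psi>_def\<close>)
  \<comment> \<open>Positivity is wanted at every point of \<open>\<Omega>\<close>, while the
    maximum principle gives it almost everywhere. On the exceptional null set any positive value
    will do.\<close>
  define \<phi>1 where "\<phi>1 x = (if x \<in> \<Omega> \<and> \<psi> x = 0 then 1 else \<psi> x)" for x
  have \<phi>1pos: "\<phi>1 x > 0" if "x \<in> \<Omega>" for x using that by (auto simp: \<phi>1_def \<psi>_def)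
  have \<psi>m [measurable]: "\<psi> \<in> borel_measurable borel" by (rule meas[OF \<psi>V])
  have \<phi>1m [measurable]: "\<phi>1 \<in> borel_measurable borel" unfolding \<phi>1_def[abs_def] by measurable
  have ae1: "AE x in lborel. \<psi> x = \<phi>1 x" using \<psi>pos by eventually_elim (auto simp: \<phi>1_def)
  have \<phi>1V: "\<phi>1 \<in> ?V" by (rule H0_log_AE_cong[OF \<psi>V \<phi>1m ae1])
  have a1: "?a \<phi>1 v = ?a \<psi> v" if "v \<in> ?V" for v
    using H_log_AE_cong(3)[OF H0_log_subset_H_log[OF \<psi>V] \<phi>1m ae1 H0_log_subset_H_log[OF that]] .
  have b1: "?b \<psi> v = ?b \<phi>1 v" if "v \<in> ?V" for v
    using meas[OF that] ae1 by (intro AE_eq_imp_L2_inner_eq) auto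
  have \<phi>1w: "weak_solution \<Omega> (\<mu> 0) \<phi>1"
    using \<psi>w \<phi>1V a1 b1 by (simp add: weak_solution_iff[OF \<Omega>])
  have \<phi>11: "?b \<phi>1 \<phi>1 = 1"
    using \<psi>1 b1[OF \<psi>V] b1[OF \<phi>1V] B.sym[OF VL[OF \<psi>V] VL[OF \<phi>1V]] by simp

  have simple: "\<exists>\<alpha>. AE x in lborel. u x = \<alpha> * \<phi>1 x" if u: "weak_solution \<Omega> (\<mu> 0) u" for u
  proof -
    have uV: "u \<in> ?V" using u by (simp add: weak_solution_def)
    have i1: "integrable lborel \<phi>1" and iu: "integrable lborel u"
      using L2_on_integrable[OF VL \<Omega>(1,2)] \<phi>1V uV by auto
    have nn: "AE x in lborel. 0 \<le> \<phi>1 x" by (rule AE_I2) (auto simp: \<phi>1_def \<psi>_def)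
    have "(LINT x|lborel. \<phi>1 x) \<noteq> 0"
      using integral_nonneg_eq_0_iff_AE[OF i1 nn] nz[OF \<phi>1V] \<phi>11 by simp
    then have I: "(LINT x|lborel. \<phi>1 x) \<noteq> 0" .
    \<comment> \<open>The multiple of \<open>\<phi>1\<close> with the same mean as \<open>u\<close>;
      the difference is then a first eigenfunction of zero mean.\<close>
    define \<alpha> where "\<alpha> = (LINT x|lborel. u x) / (LINT x|lborel. \<phi>1 x)"
    have "AE x in lborel. (1 *\<^sub>R u + (- \<alpha>) *\<^sub>R \<phi>1) x = 0"
    proof (rule first_eigen_zero_mean[OF \<Omega> min1 \<mu>0])
      show "weak_solution \<Omega> (\<mu> 0) (1 *\<^sub>R u + (- \<alpha>) *\<^sub>R \<phi>1)" by (rule eigen_linear[OF \<Omega> u \<phi>1w])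
      have "(LINT x|lborel. (1 *\<^sub>R u + (- \<alpha>) *\<^sub>R \<phi>1) x) = (LINT x|lborel. u x) - \<alpha> * (LINT x|lborel. \<phi>1 x)"
        using i1 iu by simp
      then show "(LINT x|lborel. (1 *\<^sub>R u + (- \<alpha>) *\<^sub>R \<phi>1) x) = 0" using I by (simp add: \<alpha>_def)
    qed
    then have "AE x in lborel. u x = \<alpha> * \<phi>1 x" by eventually_elim simp
    then show ?thesis by blast
  qed

  \<comment> \<open>The vector produced by minimisation is a nonzero multiple of
    \<open>\<phi>1\<close>. Orthogonality to one is orthogonality to the other, so the rest of the
    sequence and its minimality survive the exchange.\<close>
  obtain \<beta> where \<beta>: "AE x in lborel. \<phi>0 0 x = \<beta> * \<phi>1 x" using simple[OF weak0] by blast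
  have b\<beta>: "?b (\<phi>0 0) v = \<beta> * ?b \<phi>1 v" if "v \<in> ?V" for v
  proof -
    have "?b (\<phi>0 0) v = ?b (\<beta> *\<^sub>R \<phi>1) v"
      using meas[OF that] meas[OF V0] \<beta> meas[OF A.mem(4)[OF \<phi>1V]] by (intro AE_eq_imp_L2_inner_eq) auto
    then show ?thesis using \<phi>1V that by (simp add: B.expand)
  qed
  have \<beta>0: "\<beta> \<noteq> 0" using b\<beta>[OF V0[of 0]] on0[of 0 0] by auto
  define \<theta> where "\<theta> k = (if k = 0 then \<phi>1 else \<phi>0 k)" for k
  have V: "\<theta> k \<in> ?V" for k using \<phi>1V V0 by (simp add: \<theta>_def)
  have b1k: "?b \<phi>1 (\<phi>0 k) = 0" if "k \<noteq> 0" for k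
    using b\<beta>[OF V0[of k]] on0[of 0 k] \<beta>0 that by simp
  have on: "?b (\<theta> i) (\<theta> j) = (if i = j then 1 else 0)" for i j
    using b1k[of i] b1k[of j] on0[of i j] \<phi>11 B.sym[OF VL[OF \<phi>1V] VL[OF V0[of i]]]
    by (auto simp: \<theta>_def)
  have weak: "weak_solution \<Omega> (\<mu> k) (\<theta> k)" for k using \<phi>1w weak0 by (simp add: \<theta>_def)
  then have eig: "?a (\<theta> k) v = \<mu> k * ?b (\<theta> k) v" if "v \<in> ?V" for k v
    using that by (simp add: weak_solution_iff[OF \<Omega>])
  have min: "\<mu> k * ?b u u \<le> ?a u u" if u: "u \<in> ?V" and orth0: "\<forall>j<k. ?b u (\<theta> j) = 0" for k u
  proof (rule min0[OF u], intro allI impI)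
    fix j assume j: "j < k"
    show "?b u (\<phi>0 j) = 0"
    proof (cases "j = 0")
      case True
      have "?b u (\<phi>0 0) = \<beta> * ?b u \<phi>1"
        using b\<beta>[OF u] B.sym[OF VL[OF u] VL[OF \<phi>1V]] B.sym[OF VL[OF u] VL[OF V0[of 0]]] by simp
      then show ?thesis using orth0 j True by (auto simp: \<theta>_def)
    next
      case False
      then show ?thesis using orth0 j by (auto simp: \<theta>_def)
    qed
  qed
  have eigf: "eigenfunction \<Omega> (\<mu> k) (\<theta> k)" for k
    unfolding eigenfunction_def using weak nz[OF V] on by simp
  have a\<theta>: "?a (\<theta> k) (\<theta> k) = \<mu> k" for k using eig[OF V] on by simp
  have norm1: "L2_norm \<Omega> u = 1 \<longleftrightarrow> ?b u u = 1" for u by (simp add: L2_norm_eq)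

  \<comment> \<open>Shift to indices from 1; by truncated subtraction the entry at 0 merely repeats
    the first one.\<close>
  define ev where "ev k = \<mu> (k - 1)" for k :: nat
  define \<phi> where "\<phi> k = \<theta> (k - 1)" for k :: nat
  have P: "P_set \<Omega> \<phi> k = {u \<in> ?V. (\<forall>j<k - 1. ?b u (\<theta> j) = 0) \<and> ?b u u = 1}" for k
  proof -
    have "(\<forall>j\<in>{1..<k}. ?b u (\<phi> j) = 0) \<longleftrightarrow> (\<forall>j<k - 1. ?b u (\<theta> j) = 0)" for u
    proof (intro iffI ballI allI impI)
      fix j assume "\<forall>j\<in>{1..<k}. ?b u (\<phi> j) = 0" "j < k - 1"
      then show "?b u (\<theta> j) = 0" by (auto simp: \<phi>_def dest!: bspec[of _ _ "Suc j"])
    next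
      fix j assume "\<forall>j<k - 1. ?b u (\<theta> j) = 0" "j \<in> {1..<k}"
      then show "?b u (\<phi> j) = 0" by (auto simp: \<phi>_def)
    qed
    then show ?thesis by (simp add: P_set_def norm1 L2_inner_def)
  qed
  have INF_P: "ev k = (INF u\<in>P_set \<Omega> \<phi> k. ?a u u)" if "k \<ge> 1" for k
  proof (rule cInf_eq_minimum[symmetric])
    \<comment> \<open>The infimum is attained by the eigenfunction itself.\<close>
    have "\<theta> (k - 1) \<in> P_set \<Omega> \<phi> k" using V on by (simp add: P)
    then show "ev k \<in> (\<lambda>u. ?a u u) ` P_set \<Omega> \<phi> k"
      by (rule rev_image_eqI) (simp add: a\<theta> ev_def)
    fix y assume "y \<in> (\<lambda>u. ?a u u) ` P_set \<Omega> \<phi> k"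
    then obtain u where u: "u \<in> P_set \<Omega> \<phi> k" "y = ?a u u" by blast
    then show "ev k \<le> y" using min[of u "k - 1"] by (simp add: P ev_def)
  qed
  have INF1: "ev 1 = (INF u\<in>{u \<in> ?V. L2_norm \<Omega> u = 1}. ?a u u)"
    using INF_P[of 1] by (simp add: P norm1)
  have INF2: "ev 1 = (INF u\<in>{u \<in> ?V. \<not> (AE x in lborel. u x = 0)}. ?a u u / (L2_norm \<Omega> u)\<^sup>2)"
  proof (rule cInf_eq_minimum[symmetric])
    have n2: "(L2_norm \<Omega> u)\<^sup>2 = ?b u u" if "u \<in> ?V" for u
      using B.nonneg[OF VL[OF that]] by (simp add: L2_norm_eq)
    have "\<theta> 0 \<in> {u \<in> ?V. \<not> (AE x in lborel. u x = 0)}" using V nz[OF V[of 0]] on by simp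
    then show "ev 1 \<in> (\<lambda>u. ?a u u / (L2_norm \<Omega> u)\<^sup>2) ` {u \<in> ?V. \<not> (AE x in lborel. u x = 0)}"
      by (rule rev_image_eqI) (simp add: n2[OF V] a\<theta> on ev_def)
    fix y assume "y \<in> (\<lambda>u. ?a u u / (L2_norm \<Omega> u)\<^sup>2) ` {u \<in> ?V. \<not> (AE x in lborel. u x = 0)}"
    then obtain u where u: "u \<in> ?V" "\<not> (AE x in lborel. u x = 0)" "y = ?a u u / ?b u u"
      using n2 by auto
    have "?b u u \<noteq> 0" using L2_norm_zero_imp_AE[OF \<Omega>m VL[OF u(1)]] u(2) by blast
    then have "?b u u > 0" using B.nonneg[OF VL[OF u(1)]] by simp
    then show "ev 1 \<le> y" using min1[OF u(1)] unfolding u(3) by (simp add: ev_def pos_le_divide_eq)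
  qed
  \<comment> \<open>Equality would make \<open>\<theta> 1\<close> a first eigenfunction, hence by
    simplicity a multiple of \<open>\<phi>1\<close>, to which it is orthogonal although it has norm
    1.\<close>
  have gap: "\<mu> 0 < \<mu> 1"
  proof (rule ccontr)
    assume "\<not> \<mu> 0 < \<mu> 1"
    then have "\<mu> 1 = \<mu> 0" using monoD[OF mono, of 0 1] by simp
    then obtain \<alpha> where \<alpha>: "AE x in lborel. \<theta> 1 x = \<alpha> * \<phi>1 x" using simple[of "\<theta> 1"] weak[of 1] by auto
    have *: "?b (\<theta> 1) v = \<alpha> * ?b \<phi>1 v" if "v \<in> ?V" for v
    proof -
      have "?b (\<theta> 1) v = ?b (\<alpha> *\<^sub>R \<phi>1) v"
        using meas[OF that] meas[OF V] \<alpha> meas[OF A.mem(4)[OF \<phi>1V]] by (intro AE_eq_imp_L2_inner_eq) auto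
      then show ?thesis using \<phi>1V that by (simp add: B.expand)
    qed
    have "\<alpha> = 0" using *[OF \<phi>1V] on[of 1 0] \<phi>11 by (simp add: \<theta>_def)
    then show False using *[OF V[of 1]] on[of 1 1] by simp
  qed
  have lim: "filterlim ev at_top sequentially"
    using inf by (subst filterlim_sequentially_Suc[symmetric]) (simp add: ev_def)
  have basis: "L2_orthonormal_basis \<Omega> \<phi>"
    unfolding L2_orthonormal_basis_def
  proof (intro conjI allI impI ballI)
    show "\<phi> k \<in> L2_on \<Omega>" for k using V by (simp add: \<phi>_def)
    show "?b (\<phi> j) (\<phi> k) = (if j = k then 1 else 0)" if "1 \<le> j" "1 \<le> k" for j k
      using on that by (auto simp: \<phi>_def)
    fix f assume f: "f \<in> L2_on \<Omega>"
    have "(\<lambda>n. ?b (f - (\<Sum>j<n. ?b f (\<theta> j) *\<^sub>R \<theta> j)) (f - (\<Sum>j<n. ?b f (\<theta> j) *\<^sub>R \<theta> j))) \<longlonglongrightarrow> 0"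
      by (rule eigen_basis[OF V on eig inf min f])
    then have "(\<lambda>n. sqrt (?b (f - (\<Sum>j<n. ?b f (\<theta> j) *\<^sub>R \<theta> j)) (f - (\<Sum>j<n. ?b f (\<theta> j) *\<^sub>R \<theta> j)))) \<longlonglongrightarrow> sqrt 0"
      by (rule tendsto_real_sqrt)
    moreover have "(\<lambda>x. f x - (\<Sum>k=1..n. ?b f (\<phi> k) * \<phi> k x)) = f - (\<Sum>j<n. ?b f (\<theta> j) *\<^sub>R \<theta> j)" for n
      by (simp add: fun_eq_iff sum_fun_apply sum.atLeast1_atMost_eq \<phi>_def)
    ultimately show "(\<lambda>n. L2_norm \<Omega> (\<lambda>x. f x - (\<Sum>k=1..n. ?b f (\<phi> k) * \<phi> k x))) \<longlonglongrightarrow> 0"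
      by (simp add: L2_norm_eq)
  qed
  have orth: "H0_log_orthogonal \<Omega> \<phi>"
    unfolding H0_log_orthogonal_def using V eig[OF V] on by (auto simp: \<phi>_def)
  have eigfun: "eigenfunction \<Omega> (ev k) (\<phi> k)" for k
    using eigf by (simp add: ev_def \<phi>_def)
  have eigval: "eigenvalue \<Omega> (ev k)" for k
    unfolding eigenvalue_def using eigfun by blast
  have step: "ev k \<le> ev (k + 1)" for k using monoD[OF mono, of "k - 1" k] by (simp add: ev_def)
  have one: "\<phi> 1 = \<phi>1" "ev 1 = \<mu> 0" "ev 2 = \<mu> 1" by (simp_all add: \<phi>_def \<theta>_def ev_def)
  have "0 < ev 1" "ev 1 < ev 2" using pos gap one by simp_all
  moreover have "\<phi> 1 \<in> ?V" "L2_norm \<Omega> (\<phi> 1) = 1" using \<phi>1V \<phi>11 norm1 one by simp_all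
  moreover have "ev 1 = ?a (\<phi> 1) (\<phi> 1)" using a\<theta>[of 0] one by (simp add: \<theta>_def)
  moreover have "\<phi> 1 x > 0" if "x \<in> \<Omega>" for x using \<phi>1pos[OF that] one by simp
  moreover have "\<exists>\<alpha>. AE x in lborel. u x = \<alpha> * \<phi> 1 x" if "weak_solution \<Omega> (ev 1) u" for u
    using simple[of u] that one by simp
  ultimately show ?thesis
    by (intro exI[of _ ev] exI[of _ \<phi>] conjI allI impI ballI INF1 INF2 INF_P lim basis orth eigfun eigval step)
qed

end
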